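(* Let $p$ be a prime. Then the number of isomorphism types of right conjugacy closed loops of order $2p$ (including groups) equals $$p-2+I_{p-1}+\frac{1}{p-1}\sum_{d=1}^{p-1} I_{p-1,d}.$$
   Context: For positive integers $n,d$ and an $n$-cycle $\zeta\in S_n$, $I_{n,d}$ denotes the number of $\tau\in S_n$ with $\tau^2=1$ and $\tau\zeta^d=\zeta^d\tau$ (this does not depend on the choice of $\zeta$), and $I_n:=I_{n,n}$, the number of $\tau\in S_n$ with $\tau^2=1$. A loop is right conjugacy closed if the set $\{R_a\}$ of its right multiplication maps $R_a\colon x\mapsto xa$ is closed under conjugation by its own elements (equivalently, is a union of conjugacy classes of the group they generate). *)

theory Defs
  imports Complex_Main "HOL-Combinatorics.Permutations" "HOL-Computational_Algebra.Primes"
begin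

text \<open>A loop of order n, represented (up to isomorphism) on the carrier {0..<n}
  by its multiplication table m (values outside the carrier are irrelevant).\<close>
definition is_loop :: "nat \<Rightarrow> (nat \<Rightarrow> nat \<Rightarrow> nat) \<Rightarrow> bool" where
  "is_loop n m \<longleftrightarrow>
     (\<forall>x<n. \<forall>y<n. m x y < n) \<and>
     (\<exists>e<n. \<forall>x<n. m e x = x \<and> m x e = x) \<and>
     (\<forall>a<n. \<forall>b<n. (\<exists>!x. x < n \<and> m a x = b) \<and> (\<exists>!y. y < n \<and> m y a = b))"

definition right_mult :: "(nat \<Rightarrow> nat \<Rightarrow> nat) \<Rightarrow> nat \<Rightarrow> nat \<Rightarrow> nat" where
  "right_mult m a = (\<lambda>x. m x a)"

definition is_rcc :: "nat \<Rightarrow> (nat \<Rightarrow> nat \<Rightarrow> nat) \<Rightarrow> bool" where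
  "is_rcc n m \<longleftrightarrow>
     (\<forall>a<n. \<forall>b<n. \<exists>c<n. \<forall>x<n.
        inv_into {0..<n} (right_mult m a) (right_mult m b (right_mult m a x)) = right_mult m c x)"

definition loop_iso :: "nat \<Rightarrow> (nat \<Rightarrow> nat \<Rightarrow> nat) \<Rightarrow> (nat \<Rightarrow> nat \<Rightarrow> nat) \<Rightarrow> bool" where
  "loop_iso n m m' \<longleftrightarrow>
     (\<exists>\<phi>. bij_betw \<phi> {0..<n} {0..<n} \<and> (\<forall>x<n. \<forall>y<n. \<phi> (m x y) = m' (\<phi> x) (\<phi> y)))"

definition num_rcc_loops :: "nat \<Rightarrow> nat" where
  "num_rcc_loops n = card ({m. is_loop n m \<and> is_rcc n m} // {(m, m'). loop_iso n m m'})"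

definition ncycle :: "nat \<Rightarrow> nat \<Rightarrow> nat" where
  "ncycle n i = (if i < n then Suc i mod n else i)"

definition I2 :: "nat \<Rightarrow> nat \<Rightarrow> nat" where
  "I2 n d = card {\<tau>. \<tau> permutes {0..<n} \<and> \<tau> \<circ> \<tau> = id \<and>
                     \<tau> \<circ> (ncycle n ^^ d) = (ncycle n ^^ d) \<circ> \<tau>}"

definition I1 :: "nat \<Rightarrow> nat" where
  "I1 n = I2 n n"

end

theory Submission
  imports Defs "HOL-Number_Theory.Residue_Primitive_Roots" "HOL-Algebra.Sylow"
begin

unbundle no m_inv_syntax

text \<open>
  The right multiplications of a right conjugacy closed loop form a sharply transitive set \<open>T\<close> of
  permutations that contains the identity and is closed under conjugation by its elements, and loops
  are isomorphic iff their sets \<open>T\<close> are conjugate in the symmetric group.  Let \<open>T\<close> have degree \<open>2p\<close>,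
  and let \<open>z\<close> be an element of order \<open>p\<close> in the normaliser of \<open>T\<close>.  The number of elements of \<open>T\<close>
  commuting with \<open>z\<close> is divisible by \<open>p\<close>; playing this off against the sharp transitivity for \<open>z\<close> and
  its conjugates, one finds that \<open>T\<close> preserves a partition into two blocks of size \<open>p\<close>.  The elements
  fixing the blocks act on each block as the group of translations, so there are coordinates in which
  they are \<open>(x + i, x + \<sigma> i)\<close> for a permutation \<open>\<sigma>\<close> of the residues, while the elements swapping the
  blocks are affine on each block.  Closure under conjugation leaves two families: \<open>\<sigma>\<close> is the identity
  and the swaps are \<open>(a x + u, a x + u)\<close> with \<open>a\<close> different from \<open>0\<close> and \<open>- 1\<close>, which gives \<open>p - 2\<close>
  loops; or \<open>\<sigma>\<close> is an involution fixing \<open>0\<close> and the swaps are \<open>(x + u, x + d - u)\<close>.  In the second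
  family \<open>(\<sigma>, d)\<close> is determined up to simultaneous scaling by nonzero residues.  A primitive root turns
  \<open>\<sigma>\<close> into an involution of \<open>p - 1\<close> points and scaling into conjugation by powers of a
  \<open>(p - 1)\<close>-cycle, and Burnside's lemma counts the orbits: nontrivial powers fix only pairs with
  \<open>d = 0\<close>, the trivial one contributes all \<open>p\<close> values of \<open>d\<close>.
\<close>

section \<open>Powers of a map of prime order\<close>

text \<open>If an element of order \<open>p\<close> in the normaliser has a fixed point, its fixed
  points already form a block, so the difficulty is the case in which all such elements are
  fixed-point-free. There the centraliser of \<open>z\<close> in the normaliser is at most twice as
  large as the group generated by \<open>z\<close>. Without a block, exactly \<open>p\<close>
  elements of \<open>T\<close> commute with \<open>z\<close>, and likewise with a conjugate
  \<open>y\<close> outside that group. Of those commuting with \<open>y\<close>, at most two commute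
  with \<open>z\<close> and at most one does not; hence \<open>p \<le> 3\<close>, and
  \<open>p = 3\<close> survives the count. The prime 2 is settled by hand, since the argument needs
  squaring to be injective on a group of order \<open>p\<close>. The involution arises because
  conjugation by a swap exchanges the two entries of \<open>(i, \<sigma> i)\<close>, up to the
  slopes. The slope \<open>- 1\<close> is missing from the first family because reflecting one block
  turns that set into a member of the second, with negation as \<open>\<sigma>\<close>.\<close>

lemma funpow_fix_coprime:
  assumes "(f ^^ a) x = x" "(f ^^ b) x = x" "coprime a b"
  shows "f x = x"
proof (cases "a = 0")
  case True
  then show ?thesis using assms by simp
next
  case False
  then obtain u v where uv: "a * u = b * v + 1"
    using bezout_nat[of a b] assms(3) by auto
  have "(f ^^ (a * u)) x = x" "(f ^^ (b * v)) x = x"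
    using funpow_mod_eq[OF assms(1), of "a * u"] funpow_mod_eq[OF assms(2), of "b * v"] by simp_all
  then show ?thesis using uv by simp
qed

lemma funpow_prime_eq_iff:
  assumes p: "prime p" and fp: "(f ^^ p) x = x" and ne: "f x \<noteq> x"
  shows "(f ^^ i) x = (f ^^ j) x \<longleftrightarrow> [i = j] (mod p)"
proof
  assume "[i = j] (mod p)"
  then show "(f ^^ i) x = (f ^^ j) x"
    by (metis funpow_mod_eq[OF fp] cong_def)
next
  have main: "[i = j] (mod p)" if "i \<le> j" "(f ^^ i) x = (f ^^ j) x" for i j
  proof -
    have p0: "p > 0" using p by (simp add: prime_gt_0_nat)
    have ip: "i \<le> p * i" using p0 by simp
    \<comment> \<open>\<open>f\<close> need not be invertible, so \<open>i\<close> is cancelled by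
      applying further iterates until the exponent of the left side is a multiple of
      \<open>p\<close>.\<close>
    have "(f ^^ (p * i - i + i)) x = (f ^^ (p * i - i + j)) x"
      using that(2) by (simp add: funpow_add)
    also have "p * i - i + i = p * i" using ip by simp
    also have "p * i - i + j = p * i + (j - i)" using ip that(1) by simp
    finally have "x = (f ^^ (j - i)) x"
      using funpow_mod_eq[OF fp, of "p * i"] funpow_mod_eq[OF fp, of "p * i + (j - i)"]
        funpow_mod_eq[OF fp, of "j - i"] by simp
    then have "\<not> coprime p (j - i)"
      using funpow_fix_coprime[OF fp, of "j - i"] ne by metis
    then have "p dvd (j - i)" using p prime_imp_coprime by blast
    then show ?thesis using that(1) by (metis cong_altdef_nat cong_sym)
  qed
  assume "(f ^^ i) x = (f ^^ j) x"
  then show "[i = j] (mod p)" using main[of i j] main[of j i] by (metis cong_sym nat_le_linear)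
qed

lemma card_funpow_orbit:
  assumes p: "prime p" and fp: "(f ^^ p) x = x" and ne: "f x \<noteq> x"
  shows "card ((\<lambda>i. (f ^^ i) x) ` {..<p}) = p"
proof -
  have "inj_on (\<lambda>i. (f ^^ i) x) {..<p}"
    using funpow_prime_eq_iff[OF assms] by (auto simp: inj_on_def cong_def)
  then show ?thesis by (simp add: card_image)
qed

text \<open>Removing the orbit of a moved point takes away exactly \<open>p\<close> points and
  leaves a set that \<open>f\<close> still maps into itself.\<close>

lemma card_fixpoints_cong:
  assumes "finite X" "prime p" "f ` X \<subseteq> X" "\<And>x. x \<in> X \<Longrightarrow> (f ^^ p) x = x"
  shows "[card X = card {x \<in> X. f x = x}] (mod p)"
  using assms(1,3,4)
proof (induction X rule: finite_psubset_induct)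
  case (psubset X)
  show ?case
  proof (cases "\<exists>x\<in>X. f x \<noteq> x")
    case False
    then have "{x \<in> X. f x = x} = X" by auto
    then show ?thesis by simp
  next
    case True
    then obtain x where x: "x \<in> X" "f x \<noteq> x" by blast
    let ?O = "(\<lambda>i. (f ^^ i) x) ` {..<p}"
    have p0: "p > 0" using assms(2) by (simp add: prime_gt_0_nat)
    have fpx: "(f ^^ p) x = x" using psubset.prems(2) x by blast
    have cO: "card ?O = p" using card_funpow_orbit[OF assms(2) fpx x(2)] .
    have mem: "(f ^^ i) x \<in> X" for i
      using x(1) psubset.prems(1) by (induction i) auto
    have OX: "?O \<subseteq> X" using mem by auto
    have pow_in: "(f ^^ i) x \<in> ?O" for i
    proof -
      have "(f ^^ (i mod p)) x \<in> ?O" using p0 by (intro imageI) simp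
      then show ?thesis using funpow_mod_eq[OF fpx] by simp
    qed
    \<comment> \<open>\<open>f ^^ (p - 1)\<close> acts as the inverse of \<open>f\<close> on
      \<open>X\<close>, so nothing outside the orbit is mapped into it.\<close>
    have pre: "y \<in> ?O" if "y \<in> X" "f y \<in> ?O" for y
    proof -
      from that(2) obtain i where "f y = (f ^^ i) x" by auto
      then have "(f ^^ (p - 1)) (f y) = (f ^^ (p - 1 + i)) x" by (simp add: funpow_add)
      moreover have "(f ^^ (p - 1)) (f y) = y"
        using psubset.prems(2)[OF that(1)] p0
        by (metis Suc_diff_1 comp_apply funpow_Suc_right)
      ultimately show ?thesis using pow_in by metis
    qed
    have fixO: "f y \<noteq> y" if "y \<in> ?O" for y
    proof
      assume fy: "f y = y"
      from that obtain i where i: "y = (f ^^ i) x" by auto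
      then have "(f ^^ Suc i) x = (f ^^ i) x" using fy by simp
      then have "[Suc i = i] (mod p)" using funpow_prime_eq_iff[OF assms(2) fpx x(2)] by blast
      then have "p dvd Suc i - i" using cong_altdef_nat[of i "Suc i" p] by simp
      then show False using assms(2) by simp
    qed
    have "[card (X - ?O) = card {y \<in> X - ?O. f y = y}] (mod p)"
    proof (rule psubset.IH)
      show "X - ?O \<subset> X" using x(1) pow_in[of 0] by auto
      show "f ` (X - ?O) \<subseteq> X - ?O"
      proof (rule image_subsetI)
        fix y assume "y \<in> X - ?O"
        then show "f y \<in> X - ?O" using pre[of y] psubset.prems(1) by (auto simp del: image_iff)
      qed
    qed (simp add: psubset.prems(2))
    moreover have "{y \<in> X - ?O. f y = y} = {y \<in> X. f y = y}"
      by (rule Collect_cong) (metis DiffD1 DiffI fixO)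
    moreover have "card X = card (X - ?O) + p"
      using OX cO psubset.hyps by (metis card_Diff_subset card_mono finite_subset le_add_diff_inverse2)
    ultimately show ?thesis by (simp add: cong_def)
  qed
qed

section \<open>Sharply transitive sets closed under conjugation\<close>

definition conj_by :: "('a \<Rightarrow> 'a) \<Rightarrow> ('a \<Rightarrow> 'a) \<Rightarrow> 'a \<Rightarrow> 'a" where
  "conj_by g t = g \<circ> t \<circ> inv g"

lemma conj_by_apply: "g permutes S \<Longrightarrow> conj_by g t (g x) = g (t x)"
  by (simp add: conj_by_def permutes_inverses)

lemma conj_by_permutes: "g permutes S \<Longrightarrow> t permutes S \<Longrightarrow> conj_by g t permutes S"
  by (simp add: conj_by_def permutes_compose permutes_inv)

lemma conj_by_eq_iff: "g permutes S \<Longrightarrow> conj_by g t = r \<longleftrightarrow> g \<circ> t = r \<circ> g"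
  unfolding conj_by_def
  by (metis comp_assoc comp_id permutes_inv_o(1) permutes_inv_o(2))

lemma conj_by_inj: "g permutes S \<Longrightarrow> inj (conj_by g)"
  by (rule injI) (metis conj_by_apply permutes_inj injD ext)

lemma conj_by_comp: "g permutes S \<Longrightarrow> h permutes S \<Longrightarrow> conj_by (g \<circ> h) t = conj_by g (conj_by h t)"
  by (simp add: conj_by_def permutes_inj permutes_inv o_inv_distrib permutes_bij comp_assoc)

lemma conj_by_id [simp]: "conj_by id t = t"
  by (simp add: conj_by_def)

lemma conj_by_id_right: "g permutes S \<Longrightarrow> conj_by g id = id"
  by (simp add: conj_by_eq_iff)

lemma conj_by_funpow: "g permutes S \<Longrightarrow> conj_by (g ^^ n) t = (conj_by g ^^ n) t"
proof (induction n)
  case (Suc n)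
  have "g ^^ n permutes S" using Suc.prems by (induction n) (auto intro: permutes_compose)
  then show ?case using conj_by_comp[OF Suc.prems, of "g ^^ n" t] Suc.IH[OF Suc.prems]
    by (metis comp_apply funpow.simps(2))
qed simp

lemma conj_by_of_comp: "g permutes S \<Longrightarrow> conj_by g (s \<circ> t) = conj_by g s \<circ> conj_by g t"
  by (auto simp: conj_by_def fun_eq_iff permutes_inverses)

lemma conj_by_pow: "g permutes S \<Longrightarrow> conj_by g (t ^^ n) = conj_by g t ^^ n"
  by (induction n) (simp_all add: conj_by_of_comp conj_by_id_right)

text \<open>Elements of prime order are taken from the full normaliser of \<open>T\<close> in the symmetric group, not from
  the group generated by \<open>T\<close>: membership is then a condition on a single permutation.\<close>

definition normalizes :: "'a set \<Rightarrow> ('a \<Rightarrow> 'a) set \<Rightarrow> ('a \<Rightarrow> 'a) \<Rightarrow> bool" where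
  "normalizes S T g \<longleftrightarrow> g permutes S \<and> conj_by g ` T = T"

lemma normalizes_comp: "normalizes S T g \<Longrightarrow> normalizes S T h \<Longrightarrow> normalizes S T (g \<circ> h)"
proof -
  assume g: "normalizes S T g" and h: "normalizes S T h"
  then have "conj_by (g \<circ> h) = conj_by g \<circ> conj_by h"
    by (auto simp: normalizes_def conj_by_comp)
  then have "conj_by (g \<circ> h) ` T = conj_by g ` (conj_by h ` T)" by (simp only: image_comp)
  then show ?thesis using g h by (simp add: normalizes_def permutes_compose)
qed

lemma normalizes_id [simp]: "normalizes S T id"
  by (simp add: normalizes_def)

lemma normalizes_funpow: "normalizes S T g \<Longrightarrow> normalizes S T (g ^^ n)"
  by (induction n) (auto intro: normalizes_comp)

lemma normalizes_inv: 
  assumes "normalizes S T g" shows "normalizes S T (inv g)"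
proof -
  have g: "g permutes S" and T: "conj_by g ` T = T" using assms by (auto simp: normalizes_def)
  have gi: "inv g permutes S" using g by (rule permutes_inv)
  have "conj_by (inv g) (conj_by g t) = t" for t
    using conj_by_comp[OF gi g, of t] by (simp add: permutes_inv_o(2)[OF g])
  then have "conj_by (inv g) ` (conj_by g ` T) = T" by (simp add: image_image)
  then show ?thesis using T gi by (simp add: normalizes_def)
qed

text \<open>Closure under conjugation is stated without inverses; as \<open>T\<close> is finite, the direction of the
  conjugation does not matter.\<close>

locale rcc_set =
  fixes S :: "'a set" and T :: "('a \<Rightarrow> 'a) set"
  assumes fin: "finite S"
    and perm: "t \<in> T \<Longrightarrow> t permutes S"
    and id_in: "id \<in> T"
    and transitive: "x \<in> S \<Longrightarrow> y \<in> S \<Longrightarrow> \<exists>t\<in>T. t x = y"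
    and sharp: "s \<in> T \<Longrightarrow> t \<in> T \<Longrightarrow> x \<in> S \<Longrightarrow> s x = t x \<Longrightarrow> s = t"
    and conj_closed: "s \<in> T \<Longrightarrow> t \<in> T \<Longrightarrow> \<exists>r\<in>T. t \<circ> s = s \<circ> r"
begin

lemma finite_T: "finite T"
  by (rule finite_subset[OF _ finite_permutations[OF fin]]) (use perm in blast)

lemma in_normalizes:
  assumes "s \<in> T" shows "normalizes S T s"
proof -
  have s: "s permutes S" using assms perm by blast
  have "T \<subseteq> conj_by s ` T"
  proof
    fix t assume "t \<in> T"
    then obtain r where "r \<in> T" "t \<circ> s = s \<circ> r" using conj_closed assms by blast
    then show "t \<in> conj_by s ` T" using conj_by_eq_iff[OF s, of r t] by force
  qed
  moreover have "card (conj_by s ` T) = card T"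
    using conj_by_inj[OF s] by (meson card_image inj_on_subset subset_UNIV)
  ultimately have "conj_by s ` T = T"
    using finite_T by (metis card_subset_eq finite_imageI)
  then show ?thesis using s by (simp add: normalizes_def)
qed

lemma card_T: "x \<in> S \<Longrightarrow> card T = card S"
proof -
  assume x: "x \<in> S"
  have "bij_betw (\<lambda>t. t x) T S"
    unfolding bij_betw_def
  proof
    show "inj_on (\<lambda>t. t x) T" using sharp x by (auto simp: inj_on_def)
    show "(\<lambda>t. t x) ` T = S"
    proof (intro equalityI subsetI)
      fix y assume "y \<in> (\<lambda>t. t x) ` T"
      then show "y \<in> S" using perm x permutes_in_image by fastforce
    next
      fix y assume "y \<in> S"
      then show "y \<in> (\<lambda>t. t x) ` T" using transitive[OF x] by fast
    qed
  qed
  then show ?thesis by (rule bij_betw_same_card)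
qed

text \<open>\<open>T\<close> lies in the normaliser and contains exactly one element for each image
  of \<open>x\<close>, so it is a transversal of the stabiliser of \<open>x\<close>: each
  normalising element is uniquely \<open>t \<circ> h\<close> with \<open>t\<close> in
  \<open>T\<close> and \<open>h\<close> fixing \<open>x\<close>.\<close>

lemma card_normalizer_dvd:
  assumes "x \<in> S"
  shows "card S dvd card {g. normalizes S T g}"
proof -
  let ?H = "{g. normalizes S T g \<and> g x = x}"
  have "bij_betw (\<lambda>(t, h). t \<circ> h) (T \<times> ?H) {g. normalizes S T g}"
    unfolding bij_betw_def
  proof
    show "inj_on (\<lambda>(t, h). t \<circ> h) (T \<times> ?H)"
    proof (rule inj_onI, clarsimp)
      fix t h s k assume *: "t \<in> T" "s \<in> T" "h x = x" "k x = x" "t \<circ> h = s \<circ> k"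
      then have "t x = s x" by (metis comp_apply)
      then have ts: "t = s" using sharp * assms by blast
      moreover have "inj t" using perm * permutes_inj by blast
      ultimately have "h = k" using *(5) by (metis fun.inj_map_strong injD ext comp_apply)
      then show "t = s \<and> h = k" using ts by simp
    qed
    show "(\<lambda>(t, h). t \<circ> h) ` (T \<times> ?H) = {g. normalizes S T g}"
    proof (intro equalityI subsetI)
      fix g assume "g \<in> (\<lambda>(t, h). t \<circ> h) ` (T \<times> ?H)"
      then show "g \<in> {g. normalizes S T g}" using in_normalizes normalizes_comp by fastforce
    next
      fix g assume "g \<in> {g. normalizes S T g}"
      then have g: "normalizes S T g" by simp
      then have "g x \<in> S" using assms by (simp add: normalizes_def permutes_in_image)
      then obtain t where t: "t \<in> T" "t x = g x" using transitive assms by blast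
      have tp: "t permutes S" using t perm by blast
      have "normalizes S T (inv t \<circ> g)"
        using normalizes_comp[OF normalizes_inv[OF in_normalizes[OF t(1)]] g] .
      moreover have "(inv t \<circ> g) x = x" using t tp by (metis comp_apply permutes_inverses(2))
      moreover have "g = t \<circ> (inv t \<circ> g)" using permutes_inv_o(1)[OF tp] by (simp add: o_assoc)
      ultimately show "g \<in> (\<lambda>(t, h). t \<circ> h) ` (T \<times> ?H)" using t(1) by (intro image_eqI[where x = "(t, inv t \<circ> g)"]) auto
    qed
  qed
  from bij_betw_same_card[OF this]
  have "card {g. normalizes S T g} = card (T \<times> ?H)" by simp
  then show ?thesis using card_T[OF assms] by (simp add: card_cartesian_product)
qed

text \<open>Cauchy's theorem in the normaliser, whose order is a multiple of
  \<open>card S\<close>.\<close>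

lemma ex_normalizer_prime_order:
  assumes "prime p" "p dvd card S" "S \<noteq> {}"
  obtains z where "normalizes S T z" "z ^^ p = id" "z \<noteq> id"
proof -
  define G where "G = \<lparr>carrier = {g. normalizes S T g}, mult = (\<circ>), one = (id :: 'a \<Rightarrow> 'a)\<rparr>"
  have grp: "group G"
  proof (rule groupI)
    fix g assume "g \<in> carrier G"
    then have g: "normalizes S T g" by (simp add: G_def)
    then have "inv g \<circ> g = id" by (auto simp: normalizes_def permutes_inv_o(2))
    then show "\<exists>h\<in>carrier G. h \<otimes>\<^bsub>G\<^esub> g = \<one>\<^bsub>G\<^esub>"
      using normalizes_inv[OF g] by (intro bexI[of _ "inv g"]) (simp_all add: G_def)
  qed (auto simp: G_def normalizes_comp o_assoc)
  have fG: "finite (carrier G)"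
    by (rule finite_subset[OF _ finite_permutations[OF fin]]) (auto simp: G_def normalizes_def)
  have "p dvd order G"
    using assms card_normalizer_dvd by (metis G_def order_def partial_object.select_convs(1) dvd_trans ex_in_conv)
  \<comment> \<open>With exponent 1, Sylow's theorem gives a subgroup of order exactly
    \<open>p\<close>, whatever power of \<open>p\<close> divides the order.\<close>
  then obtain m where "order G = p ^ 1 * m" by auto
  from sylow_thm[OF assms(1) grp this fG]
  obtain H where H: "subgroup H G" "card H = p" by auto
  have "H \<noteq> {id}" using H(2) assms(1) by (auto simp: prime_gt_1_nat)
  moreover have "id \<in> H" using subgroup.one_closed[OF H(1)] by (simp add: G_def)
  ultimately obtain z where z: "z \<in> H" "z \<noteq> id" by blast
  interpret K: group "G\<lparr>carrier := H\<rparr>" using subgroup.subgroup_is_group[OF H(1) grp] .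
  have "z [^]\<^bsub>G\<lparr>carrier := H\<rparr>\<^esub> order (G\<lparr>carrier := H\<rparr>) = \<one>\<^bsub>G\<lparr>carrier := H\<rparr>\<^esub>"
    by (rule K.pow_order_eq_1) (use z in simp)
  moreover have "z [^]\<^bsub>G\<lparr>carrier := H\<rparr>\<^esub> (n::nat) = z ^^ n" for n
    by (induction n) (simp_all add: G_def funpow_swap1 fun_eq_iff)
  ultimately have "z ^^ p = id" using H(2) by (simp add: order_def G_def)
  moreover have "normalizes S T z" using z(1) subgroup.subset[OF H(1)] by (auto simp: G_def)
  ultimately show thesis using that z(2) by blast
qed

text \<open>Conjugation by \<open>z\<close> permutes \<open>T\<close> with \<open>p\<close>-th power
  the identity, and its fixed points are the elements that commute with \<open>z\<close>.\<close>

lemma commuting_card_cong: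
  assumes "prime p" "normalizes S T z" "z ^^ p = id" "x \<in> S"
  shows "[card S = card {t \<in> T. z \<circ> t = t \<circ> z}] (mod p)"
proof -
  have z: "z permutes S" and T: "conj_by z ` T = T" using assms(2) by (auto simp: normalizes_def)
  have "[card T = card {t \<in> T. conj_by z t = t}] (mod p)"
    using T conj_by_funpow[OF z, of p] assms(1,3) 
    by (intro card_fixpoints_cong finite_T) auto
  then show ?thesis using card_T[OF assms(4)] by (simp add: conj_by_eq_iff[OF z])
qed

end

section \<open>Degree p\<close>

text \<open>Reducing the exponent modulo \<open>p\<close> gives meaning to negative exponents
  without the inverse of \<open>z\<close>, so orbits are indexed by integers.\<close>

definition cyc :: "('a \<Rightarrow> 'a) \<Rightarrow> nat \<Rightarrow> 'a \<Rightarrow> int \<Rightarrow> 'a" where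
  "cyc z p x i = (z ^^ nat (i mod int p)) x"

lemma cyc_eq_iff:
  assumes "prime p" "z ^^ p = id" "z x \<noteq> x"
  shows "cyc z p x i = cyc z p x j \<longleftrightarrow> [i = j] (mod int p)"
proof -
  have p: "int p > 0" using assms(1) by (simp add: prime_gt_0_nat)
  have "cyc z p x i = cyc z p x j \<longleftrightarrow> [nat (i mod int p) = nat (j mod int p)] (mod p)"
    unfolding cyc_def by (rule funpow_prime_eq_iff) (use assms in auto)
  also have "\<dots> \<longleftrightarrow> [i = j] (mod int p)"
    using p by (simp add: cong_int_iff [symmetric] cong_def)
  finally show ?thesis .
qed

lemma cyc_of_nat: "z ^^ p = id \<Longrightarrow> cyc z p x (int n) = (z ^^ n) x"
  unfolding cyc_def using funpow_mod_eq[of p z x n] by (simp add: zmod_int [symmetric] del: of_nat_mod)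

lemma cyc_0 [simp]: "cyc z p x 0 = x"
  by (simp add: cyc_def)

lemma funpow_cyc:
  assumes "z ^^ p = id" "p > 0"
  shows "(z ^^ n) (cyc z p x i) = cyc z p x (int n + i)"
proof -
  have "(z ^^ n) (cyc z p x i) = (z ^^ (n + nat (i mod int p))) x"
    by (simp add: cyc_def funpow_add)
  also have "\<dots> = cyc z p x (int (n + nat (i mod int p)))"
    using cyc_of_nat[OF assms(1)] by metis
  also have "\<dots> = cyc z p x (int n + i)"
    using assms(2) by (simp add: cyc_def mod_add_right_eq)
  finally show ?thesis .
qed

lemma cyc_cyc: "z ^^ p = id \<Longrightarrow> p > 0 \<Longrightarrow> cyc z p (cyc z p x j) i = cyc z p x (i + j)"
  using funpow_cyc[of p z "nat (i mod int p)" x j]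
  by (simp add: cyc_def [of z p "cyc z p x j"]) (simp add: cyc_def mod_add_left_eq)

lemma cyc_commute:
  assumes "t \<circ> z = z \<circ> t" shows "t (cyc z p x i) = cyc z p (t x) i"
proof -
  have "t ((z ^^ n) x) = (z ^^ n) (t x)" for n
    using assms by (induction n) (simp_all add: fun_eq_iff)
  then show ?thesis by (simp add: cyc_def)
qed

lemma range_cyc: "p > 0 \<Longrightarrow> range (cyc z p x) = (\<lambda>i. (z ^^ i) x) ` {..<p}"
proof (intro equalityI subsetI)
  fix y assume p: "p > 0" and "y \<in> (\<lambda>i. (z ^^ i) x) ` {..<p}"
  then obtain i where "i < p" "y = (z ^^ i) x" by blast
  then have "y = cyc z p x (int i)" by (simp add: cyc_def nat_mod_as_int [symmetric] zmod_int [symmetric] del: of_nat_mod)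
  then show "y \<in> range (cyc z p x)" by blast
next
  fix y assume p: "p > 0" and "y \<in> range (cyc z p x)"
  then obtain i where "y = (z ^^ nat (i mod int p)) x" by (auto simp: cyc_def)
  moreover have "nat (i mod int p) < p" using p by (simp add: nat_less_iff)
  ultimately show "y \<in> (\<lambda>i. (z ^^ i) x) ` {..<p}" by blast
qed

lemma card_range_cyc:
  assumes "prime p" "z ^^ p = id" "z x \<noteq> x"
  shows "card (range (cyc z p x)) = p"
proof -
  have "p > 0" using assms(1) by (simp add: prime_gt_0_nat)
  then show ?thesis using card_funpow_orbit[OF assms(1), of z x] assms by (simp add: range_cyc)
qed

lemma funpow_permutes: "f permutes S \<Longrightarrow> (f ^^ n) permutes S"
  by (induction n) (auto intro: permutes_compose)

lemma range_cyc_subset: "z permutes S \<Longrightarrow> x \<in> S \<Longrightarrow> range (cyc z p x) \<subseteq> S"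
  by (auto simp: cyc_def permutes_in_image funpow_permutes)

lemma permutes_moves: "g permutes S \<Longrightarrow> g \<noteq> id \<Longrightarrow> \<exists>x\<in>S. g x \<noteq> x"
  by (metis eq_id_iff permutes_not_in)

lemma permutes_comp_cong: "g permutes S \<Longrightarrow> g \<circ> h = g \<circ> k \<Longrightarrow> h = k"
  by (metis comp_assoc id_comp permutes_inv_o(2))

context rcc_set
begin

text \<open>The number of elements commuting with \<open>z\<close> is a multiple of \<open>p\<close>
  and positive because of \<open>id\<close>, so all of \<open>T\<close> commutes with the
  \<open>p\<close>-cycle \<open>z\<close>; a map commuting with a cycle is a translation along
  it.\<close>

lemma prime_degree:
  assumes p: "prime p" and S: "card S = p"
  obtains k :: "int \<Rightarrow> 'a" where "\<And>i j. k i = k j \<longleftrightarrow> [i = j] (mod int p)" "range k = S"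
    "\<And>t. t \<in> T \<Longrightarrow> \<exists>i. \<forall>x. t (k x) = k (x + i)"
proof -
  have p0: "p > 0" using p by (simp add: prime_gt_0_nat)
  then have "S \<noteq> {}" using S by auto
  then obtain z where z: "normalizes S T z" "z ^^ p = id" "z \<noteq> id"
    using ex_normalizer_prime_order[OF p _ \<open>S \<noteq> {}\<close>] S by (metis dvd_refl)
  have zp: "z permutes S" using z(1) by (simp add: normalizes_def)
  obtain x where x: "x \<in> S" "z x \<noteq> x" using permutes_moves[OF zp z(3)] by blast
  let ?C = "{t \<in> T. z \<circ> t = t \<circ> z}"
  have "[p = card ?C] (mod p)"
    using commuting_card_cong[OF p z(1,2) x(1)] S by simp
  then have "p dvd card ?C" by (simp add: cong_def mod_0_imp_dvd)
  moreover have "id \<in> ?C" using id_in by simp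
  then have "?C \<noteq> {}" by blast
  then have "card ?C > 0" using finite_T by (simp add: card_gt_0_iff)
  ultimately have "p \<le> card ?C" by (simp add: dvd_imp_le)
  then have C: "?C = T" using card_T[OF x(1)] S finite_T
    by (intro card_seteq) auto
  let ?k = "cyc z p x"
  have r: "range ?k = S"
    using range_cyc_subset[OF zp x(1), of p] card_range_cyc[OF p z(2) x(2)] S fin by (simp add: card_subset_eq)
  have "\<exists>i. \<forall>y. t (?k y) = ?k (y + i)" if "t \<in> T" for t
  proof -
    have "t x \<in> range ?k" using that perm x(1) r permutes_in_image by fastforce
    then obtain i where i: "t x = ?k i" by blast
    have "t \<circ> z = z \<circ> t" using that C by (metis (mono_tags, lifting) mem_Collect_eq)
    then show ?thesis using cyc_commute[of t z p x] i cyc_cyc[OF z(2) p0] by metis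
  qed
  then show thesis using that[of ?k] cyc_eq_iff[OF p z(2) x(2)] r by blast
qed

end

section \<open>Degree 2p: a half-size block\<close>

definition half_block :: "'a set \<Rightarrow> ('a \<Rightarrow> 'a) set \<Rightarrow> 'a set \<Rightarrow> bool" where
  "half_block S T F \<longleftrightarrow> F \<subseteq> S \<and> card S = 2 * card F \<and> (\<forall>t\<in>T. t ` F = F \<or> t ` F = S - F)"

lemma pow_eq_id_iff:
  assumes "prime p" "z ^^ p = id" "z \<noteq> id"
  shows "z ^^ n = id \<longleftrightarrow> p dvd n"
proof
  assume *: "z ^^ n = id"
  show "p dvd n"
  proof (rule ccontr)
    assume "\<not> p dvd n"
    then have "coprime p n" using assms(1) by (simp add: prime_imp_coprime)
    then have "z x = x" for x
      using funpow_fix_coprime[of p z x n] * assms(2) by simp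
    then show False using assms(3) by auto
  qed
next
  assume "p dvd n"
  then show "z ^^ n = id"
    using assms(2) by (auto simp: funpow_mult [symmetric] simp: id_funpow)
qed

lemma pow_generates:
  assumes "prime p" "z ^^ p = id" "z ^^ a \<noteq> id"
  shows "\<exists>c. (z ^^ a) ^^ c = z"
proof -
  have pow_dvd: "z ^^ n = id" if "p dvd n" for n
    using that assms(2) by (auto simp: funpow_mult [symmetric] id_funpow)
  have "\<not> p dvd a" using pow_dvd assms(3) by blast
  then have "coprime a p" using assms(1) prime_imp_coprime coprime_commute by blast
  moreover have "a \<noteq> 0" using assms(3) by (intro notI) simp
  ultimately obtain u v where "a * u = p * v + 1" using bezout_nat[of a p] by auto
  then have "z ^^ (a * u) = z \<circ> z ^^ (p * v)" by simp
  then have "(z ^^ a) ^^ u = z" using pow_dvd[of "p * v"] by (simp add: funpow_mult)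
  then show ?thesis by blast
qed

context rcc_set
begin

text \<open>If the image of \<open>F\<close> misses \<open>F\<close>, it fills the complement, which
  has the same size; only images that meet \<open>F\<close> have to be examined.\<close>

lemma half_blockI:
  assumes "F \<subseteq> S" "card S = 2 * card F" 
    "\<And>t x. t \<in> T \<Longrightarrow> x \<in> F \<Longrightarrow> t x \<in> F \<Longrightarrow> t ` F \<subseteq> F"
  shows "half_block S T F"
  unfolding half_block_def
proof (intro conjI ballI assms(1,2))
  fix t assume t: "t \<in> T"
  then have tp: "t permutes S" using perm by blast
  then have c: "card (t ` F) = card F" by (meson card_image permutes_inj inj_on_subset subset_UNIV)
  have fF: "finite F" using assms(1) fin finite_subset by blast
  show "t ` F = F \<or> t ` F = S - F"
  proof (cases "\<exists>x\<in>F. t x \<in> F")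
    case True
    then have "t ` F \<subseteq> F" using assms(3) t by blast
    then show ?thesis using c fF card_subset_eq by blast
  next
    case False
    then have "t ` F \<subseteq> S - F" using tp assms(1) by (auto simp: permutes_in_image)
    moreover have "card (S - F) = card F" using assms(1,2) fF by (simp add: card_Diff_subset)
    ultimately show ?thesis using c fin by (metis card_subset_eq finite_Diff)
  qed
qed

text \<open>If \<open>t\<close> maps some fixed point of \<open>z\<close> to a fixed point, then \<open>t\<close> and its conjugate by \<open>z\<close> agree at that
  point and hence coincide.\<close>

lemma half_block_fixpoints:
  assumes p: "prime p" and S: "card S = 2 * p"
    and z: "normalizes S T z" "z ^^ p = id" "z \<noteq> id" and x: "x \<in> S" "z x = x"
  shows "half_block S T {y \<in> S. z y = y}"
proof (rule half_blockI)
  let ?F = "{y \<in> S. z y = y}"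
  have zp: "z permutes S" and T: "conj_by z ` T = T" using z(1) by (auto simp: normalizes_def)
  have "[card S = card ?F] (mod p)"
    using z(2) by (intro card_fixpoints_cong fin p) (auto simp: permutes_image[OF zp])
  then have d: "p dvd card ?F" using S by (metis cong_dvd_iff dvd_triv_right)
  have "?F \<noteq> {}" using x by blast
  then have "card ?F \<noteq> 0" using fin by simp
  moreover obtain y where "y \<in> S" "z y \<noteq> y" using permutes_moves[OF zp z(3)] by blast
  then have "?F \<subset> S" by blast
  then have "card ?F < 2 * p" using psubset_card_mono[OF fin] S by metis
  moreover obtain m where "card ?F = p * m" using d by (elim dvdE)
  ultimately have "m = 1" "card ?F = p * m" using p by (simp_all add: prime_gt_0_nat)
  then have "card ?F = p" by simp
  then show "card S = 2 * card ?F" using S by simp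
  fix t y assume t: "t \<in> T" and y: "y \<in> ?F" "t y \<in> ?F"
  have "conj_by z t \<in> T" using t T by blast
  moreover have "conj_by z t y = t y" using conj_by_apply[OF zp, of t y] y by simp
  ultimately have "conj_by z t = t" using sharp t y by blast
  then have "z \<circ> t = t \<circ> z" using conj_by_eq_iff[OF zp] by blast
  then have "z (t w) = t (z w)" for w by (metis comp_apply)
  moreover have "t permutes S" using t perm by blast
  ultimately show "t ` ?F \<subseteq> ?F" by (auto simp: permutes_in_image)
qed auto

text \<open>By \<open>norm\<close>, the elements of \<open>T\<close> normalise the group generated
  by \<open>z\<close> and therefore permute its orbits.\<close>

lemma half_block_orbit:
  assumes p: "prime p" and S: "card S = 2 * p"
    and z: "z permutes S" "z ^^ p = id" and x: "x \<in> S" "z x \<noteq> x"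
    and norm: "\<And>t. t \<in> T \<Longrightarrow> \<exists>m. conj_by t z = z ^^ m"
  shows "half_block S T (range (cyc z p x))"
proof (rule half_blockI)
  have p0: "p > 0" using p by (simp add: prime_gt_0_nat)
  let ?F = "range (cyc z p x)"
  show "?F \<subseteq> S" using range_cyc_subset[OF z(1) x(1)] .
  show "card S = 2 * card ?F" using card_range_cyc[OF p z(2) x(2)] S by simp
  fix t y assume t: "t \<in> T" and y: "y \<in> ?F" "t y \<in> ?F"
  obtain m where m: "conj_by t z = z ^^ m" using norm t by blast
  have tp: "t permutes S" using t perm by blast
  have tz: "t ((z ^^ n) w) = (z ^^ (m * n)) (t w)" for n w
  proof -
    have "t ((z ^^ n) w) = (conj_by t (z ^^ n)) (t w)" using conj_by_apply[OF tp] by metis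
    also have "conj_by t (z ^^ n) = z ^^ (m * n)"
      using conj_by_pow[OF tp] m by (simp add: funpow_mult)
    finally show ?thesis .
  qed
  obtain j l where j: "y = cyc z p x j" and l: "t y = cyc z p x l" using y by blast
  show "t ` ?F \<subseteq> ?F"
  proof clarify
    fix i
    have "cyc z p x i = cyc z p y (i - j)" using cyc_cyc[OF z(2) p0] j by simp
    then obtain n where "cyc z p x i = (z ^^ n) y" by (simp add: cyc_def)
    then have "t (cyc z p x i) = (z ^^ (m * n)) (t y)" using tz by simp
    also have "\<dots> = cyc z p x (int (m * n) + l)" using l funpow_cyc[OF z(2) p0] by simp
    finally show "t (cyc z p x i) \<in> ?F" by simp
  qed
qed

end

section \<open>Centralisers of fixed-point-free elements of odd prime order \<open>p\<close>\<close>

locale rcc_set_2p = rcc_set +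
  fixes p :: nat
  assumes p: "prime p" and odd_p: "p > 2" and card_S: "card S = 2 * p"
begin

lemma p0: "p > 0" using p by (simp add: prime_gt_0_nat)

text \<open>As \<open>p\<close> is prime, such a \<open>z\<close> is a product of two
  \<open>p\<close>-cycles on the \<open>2 * p\<close> points.\<close>

definition ffree :: "('a \<Rightarrow> 'a) \<Rightarrow> bool" where
  "ffree z \<longleftrightarrow> normalizes S T z \<and> z ^^ p = id \<and> (\<forall>x\<in>S. z x \<noteq> x)"

definition cent :: "('a \<Rightarrow> 'a) \<Rightarrow> ('a \<Rightarrow> 'a) set" where
  "cent z = {g. normalizes S T g \<and> g \<circ> z = z \<circ> g}"

lemma S_nonempty: "\<exists>x. x \<in> S"
  using card_S p0 by (metis all_not_in_conv card.empty mult_is_0 neq0_conv zero_neq_numeral)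

lemma ffree_ne_id: "ffree z \<Longrightarrow> z \<noteq> id"
  using S_nonempty by (auto simp: ffree_def)

lemma ffree_perm: "ffree z \<Longrightarrow> z permutes S"
  by (simp add: ffree_def normalizes_def)

lemma cent_comp: "g \<in> cent z \<Longrightarrow> h \<in> cent z \<Longrightarrow> g \<circ> h \<in> cent z"
  unfolding cent_def by (auto simp: normalizes_comp) (metis comp_assoc)

lemma pow_in_cent: "ffree z \<Longrightarrow> z ^^ n \<in> cent z"
  unfolding cent_def by (simp add: ffree_def normalizes_funpow funpow_swap1 fun_eq_iff)

lemma cent_perm: "g \<in> cent z \<Longrightarrow> g permutes S"
  by (simp add: cent_def normalizes_def)

lemma cent_id: "id \<in> cent z"
  by (simp add: cent_def)

lemma cent_funpow: "g \<in> cent z \<Longrightarrow> g ^^ n \<in> cent z"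
  by (induction n) (auto simp only: funpow.simps intro: cent_id cent_comp)

lemma cent_cyc: "g \<in> cent z \<Longrightarrow> g (cyc z p x i) = cyc z p (g x) i"
  by (rule cyc_commute) (simp add: cent_def)

lemma orbit_sym:
  assumes "ffree z" "y \<in> range (cyc z p x)"
  shows "x \<in> range (cyc z p y)"
proof -
  obtain i where i: "y = cyc z p x i" using assms(2) by blast
  then have "x = cyc z p y (- i)" using assms(1) p0 by (simp add: cyc_cyc ffree_def)
  then show ?thesis by blast
qed

lemma orbit_trans:
  assumes "ffree z" "y \<in> range (cyc z p x)" "w \<in> range (cyc z p y)"
  shows "w \<in> range (cyc z p x)"
proof -
  obtain i where "y = cyc z p x i" using assms(2) by blast
  moreover obtain j where "w = cyc z p y j" using assms(3) by blast
  ultimately have "w = cyc z p x (j + i)" using assms(1) p0 by (simp add: cyc_cyc ffree_def)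
  then show ?thesis by blast
qed

lemma two_orbits:
  assumes z: "ffree z" and S: "x \<in> S" "y \<in> S" "w \<in> S"
    and "y \<notin> range (cyc z p x)" "w \<notin> range (cyc z p x)"
  shows "w \<in> range (cyc z p y)"
proof -
  let ?X = "range (cyc z p x)" and ?Y = "range (cyc z p y)"
  have zp: "z permutes S" and zz: "z ^^ p = id" using z ffree_perm by (auto simp: ffree_def)
  have sub: "?X \<subseteq> S" "?Y \<subseteq> S" using range_cyc_subset[OF zp] S by blast+
  have "card ?X = p" "card ?Y = p" using card_range_cyc[OF p zz] z S by (auto simp: ffree_def)
  moreover have "?X \<inter> ?Y = {}" using orbit_sym[OF z] orbit_trans[OF z] assms(5) by blast
  moreover have "finite ?X" "finite ?Y" using sub fin finite_subset by blast+
  ultimately have "card (?X \<union> ?Y) = card S" using card_S by (simp add: card_Un_disjoint)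
  then have "?X \<union> ?Y = S" using sub fin by (simp add: card_subset_eq)
  then show ?thesis using assms(4,6) by blast
qed

end

text \<open>The case left open by \<open>half_block_fixpoints\<close>.\<close>

locale all_ffree = rcc_set_2p +
  assumes all_ffree: "normalizes S T z \<Longrightarrow> z ^^ p = id \<Longrightarrow> z \<noteq> id \<Longrightarrow> ffree z"
begin

text \<open>After correction by a power of \<open>z\<close>, \<open>g\<close> fixes \<open>x\<close>
  and hence the whole orbit of \<open>x\<close>, while on the other orbit it acts as a power of
  \<open>z\<close>. Its \<open>p\<close>-th power is then the identity, and an element of order
  \<open>p\<close> with a fixed point is excluded, so the corrected element is trivial.\<close>

lemma cent_orbit_pow:
  assumes z: "ffree z" and g: "g \<in> cent z" and x: "x \<in> S" "g x \<in> range (cyc z p x)"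
  shows "\<exists>n. g = z ^^ n"
proof -
  have zz: "z ^^ p = id" using z by (simp add: ffree_def)
  obtain i where i: "g x = cyc z p x i" using x by blast
  define m where "m = nat ((- i) mod int p)"
  define h where "h = z ^^ m \<circ> g"
  have int_m: "int m = (- i) mod int p" using p0 by (simp add: m_def)
  have "h x = cyc z p x ((- i) mod int p + i)"
    using funpow_cyc[OF zz p0] i int_m by (simp add: h_def)
  then have hx: "h x = x" by (simp add: cyc_def mod_add_left_eq)
  have h: "h \<in> cent z" unfolding h_def by (intro cent_comp pow_in_cent z g)
  have hid: "h = id"
  proof (rule ccontr)
    assume ne: "h \<noteq> id"
    obtain y where y: "y \<in> S" "h y \<noteq> y" using permutes_moves[OF cent_perm[OF h] ne] by blast
    have fixX: "h w = w" if "w \<in> range (cyc z p x)" for w using that cent_cyc[OF h] hx by auto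
    then have yX: "y \<notin> range (cyc z p x)" using y by blast
    have "h y \<notin> range (cyc z p x)"
      using fixX y permutes_inj[OF cent_perm[OF h]] by (metis injD)
    moreover have "h y \<in> S" using y cent_perm[OF h] by (simp add: permutes_in_image)
    ultimately obtain j where j: "h y = cyc z p y j" using two_orbits[OF z x(1) y(1) _ yX] by blast
    have hn: "(h ^^ n) y = cyc z p y (int n * j)" for n
    proof (induction n)
      case (Suc n)
      then have "(h ^^ Suc n) y = cyc z p (h y) (int n * j)" using cent_cyc[OF h] by simp
      then show ?case using j cyc_cyc[OF zz p0] by (simp add: algebra_simps)
    qed simp
    have hc: "h ^^ n \<in> cent z" for n 
      using h by (rule cent_funpow)
    have "(h ^^ p) y = y" using hn[of p] by (simp add: cyc_def)
    then have fY: "(h ^^ p) w = w" if "w \<in> range (cyc z p y)" for w using that cent_cyc[OF hc] by auto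
    have fX: "(h ^^ n) w = w" if "w \<in> range (cyc z p x)" for w n using fixX that by (induction n) auto
    have "(h ^^ p) w = w" for w
    proof (cases "w \<in> S")
      case True
      then show ?thesis using two_orbits[OF z x(1) y(1) True yX] fX fY by blast
    next
      case False
      then show ?thesis using cent_perm[OF hc] permutes_not_in by metis
    qed
    then have "h ^^ p = id" by auto
    then have "ffree h" using all_ffree h ne by (simp add: cent_def)
    then show False using hx x by (auto simp: ffree_def)
  qed
  have "m < p" using p0 by (simp add: m_def nat_less_iff)
  then have "z ^^ (p - m) \<circ> z ^^ m = id" using zz by (simp add: funpow_add [symmetric])
  then have "g = z ^^ (p - m) \<circ> h" unfolding h_def by (simp add: comp_assoc [symmetric])
  then show ?thesis using hid by auto
qed

text \<open>An element of the centraliser either preserves an orbit of \<open>z\<close> or exchanges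
  the two; in the second case its square preserves them, and \<open>cent_orbit_pow\<close>
  applies.\<close>

lemma cent_square:
  assumes z: "ffree z" and g: "g \<in> cent z"
  shows "\<exists>n. g \<circ> g = z ^^ n"
proof -
  obtain x where x: "x \<in> S" using S_nonempty by blast
  have gS: "g x \<in> S" "g (g x) \<in> S" using x cent_perm[OF g] by (simp_all add: permutes_in_image)
  show ?thesis
  proof (cases "g x \<in> range (cyc z p x) \<or> g (g x) \<in> range (cyc z p (g x))")
    case True
    then obtain n where "g = z ^^ n" using cent_orbit_pow[OF z g] x gS by blast
    then show ?thesis by (metis funpow_add)
  next
    case False
    then have "g (g x) \<in> range (cyc z p x)" using two_orbits[OF z x gS(1) gS(2)] by blast
    then show ?thesis using cent_orbit_pow[OF z cent_comp[OF g g] x] by simp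
  qed
qed

lemma pow_square_id:
  assumes z: "ffree z" and "z ^^ n \<circ> z ^^ n = id"
  shows "z ^^ n = id"
proof -
  have zz: "z ^^ p = id" using z by (simp add: ffree_def)
  have "z ^^ (n + n) = id" using assms(2) by (metis funpow_add)
  then have "p dvd 2 * n" using pow_eq_id_iff[OF p zz ffree_ne_id[OF z]] by (metis mult_2)
  moreover have "\<not> p dvd 2" using odd_p by (auto dest: dvd_imp_le)
  ultimately have "p dvd n" using p prime_dvd_mult_iff by blast
  then show ?thesis using pow_eq_id_iff[OF p zz ffree_ne_id[OF z]] by blast
qed

text \<open>The powers of \<open>z\<close> contain no involution because \<open>p\<close> is odd, so
  \<open>k\<close> and \<open>l\<close> both exchange the two orbits. Their product preserves them,
  which gives \<open>l = z ^^ n \<circ> k\<close>; as \<open>k\<close> commutes with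
  \<open>z\<close>, squaring gives \<open>z ^^ n \<circ> z ^^ n = id\<close>, and
  \<open>z ^^ n\<close> is trivial.\<close>

lemma cent_involution_unique:
  assumes z: "ffree z" and k: "k \<in> cent z" "k \<circ> k = id" "k \<noteq> id"
    and l: "l \<in> cent z" "l \<circ> l = id" "l \<noteq> id"
  shows "k = l"
proof -
  obtain x where x: "x \<in> S" using S_nonempty by blast
  have S: "k x \<in> S" "l (k x) \<in> S" using x cent_perm k l by (simp_all add: permutes_in_image)
  have "k x \<notin> range (cyc z p x)" using cent_orbit_pow[OF z k(1) x] pow_square_id[OF z] k by blast
  then have "x \<notin> range (cyc z p (k x))" using orbit_sym[OF z] by blast
  moreover have "l (k x) \<notin> range (cyc z p (k x))"
    using cent_orbit_pow[OF z l(1) S(1)] pow_square_id[OF z] l by blast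
  ultimately have "l (k x) \<in> range (cyc z p x)" using two_orbits[OF z S(1) x S(2)] by blast
  then obtain n where n: "l \<circ> k = z ^^ n" using cent_orbit_pow[OF z cent_comp[OF l(1) k(1)] x] by auto
  then have l_eq: "l = z ^^ n \<circ> k" using k(2) by (metis comp_assoc comp_id)
  have zk: "k \<circ> z ^^ n = z ^^ n \<circ> k"
    using k(1) by (induction n) (auto simp: cent_def fun_eq_iff)
  have "id = (z ^^ n \<circ> k) \<circ> (z ^^ n \<circ> k)" using l(2) l_eq by simp
  also have "\<dots> = z ^^ n \<circ> (k \<circ> z ^^ n) \<circ> k" by (simp add: comp_assoc)
  also have "\<dots> = z ^^ n \<circ> z ^^ n \<circ> (k \<circ> k)" using zk by (simp add: comp_assoc)
  finally have "z ^^ n = id" using pow_square_id[OF z, of n] k(2) by simp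
  then show ?thesis using l_eq by simp
qed

text \<open>Two groups of prime order that share a nontrivial element coincide.\<close>

lemma pow_subset_imp:
  assumes z: "ffree z" "ffree y" and "z ^^ a = y ^^ b" "z ^^ a \<noteq> id"
  shows "\<exists>c. y = z ^^ c" "\<exists>c. z = y ^^ c"
proof -
  have zz: "z ^^ p = id" "y ^^ p = id" using z by (auto simp: ffree_def)
  obtain c where "(z ^^ a) ^^ c = z" using pow_generates[OF p zz(1) assms(4)] by blast
  then show "\<exists>c. z = y ^^ c" using assms(3) by (metis funpow_mult)
  obtain c where "(y ^^ b) ^^ c = y" using pow_generates[OF p zz(2)] assms(3,4) by metis
  then show "\<exists>c. y = z ^^ c" using assms(3) by (metis funpow_mult)
qed

lemma ffree_conj:
  assumes z: "ffree z" and g: "normalizes S T g" shows "ffree (conj_by g z)"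
proof -
  have gp: "g permutes S" using g by (simp add: normalizes_def)
  have zn: "normalizes S T z" and zz: "z ^^ p = id" using z by (auto simp: ffree_def)
  have "normalizes S T (conj_by g z)" unfolding conj_by_def
    by (intro normalizes_comp g zn normalizes_inv)
  moreover have "conj_by g z ^^ p = id"
    using conj_by_pow[OF gp, of p z] zz conj_by_id_right[OF gp] by simp
  moreover have "conj_by g z \<noteq> id"
    using ffree_ne_id[OF z] conj_by_eq_iff[OF gp] permutes_comp_cong[OF gp, of z id] by auto
  ultimately show ?thesis using all_ffree by blast
qed

lemma no_normal_orbit:
  assumes "\<nexists>F. half_block S T F" and z: "ffree z"
  shows "\<exists>t\<in>T. \<forall>m. conj_by t z \<noteq> z ^^ m"
proof (rule ccontr)
  assume "\<not> ?thesis"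
  then have norm: "\<And>t. t \<in> T \<Longrightarrow> \<exists>m. conj_by t z = z ^^ m" by blast
  obtain x where x: "x \<in> S" using S_nonempty by blast
  have "half_block S T (range (cyc z p x))"
    by (rule half_block_orbit[OF p card_S ffree_perm[OF z] _ x]) (use z norm x in \<open>auto simp: ffree_def\<close>)
  then show False using assms(1) by blast
qed

text \<open>The number is a positive multiple of \<open>p\<close>. It is not \<open>2 * p\<close>,
  since otherwise all of \<open>T\<close> would commute with \<open>z\<close> and an orbit of
  \<open>z\<close> would be a half-size block.\<close>

lemma card_T_cent:
  assumes "\<nexists>F. half_block S T F" and z: "ffree z"
  shows "card (T \<inter> cent z) = p"
proof -
  have zn: "normalizes S T z" and zz: "z ^^ p = id" using z by (auto simp: ffree_def)
  obtain x where x: "x \<in> S" using S_nonempty by blast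
  have eq: "{t \<in> T. z \<circ> t = t \<circ> z} = T \<inter> cent z"
    using in_normalizes by (auto simp: cent_def)
  have "[card S = card (T \<inter> cent z)] (mod p)" using commuting_card_cong[OF p zn zz x] eq by simp
  then have "p dvd card (T \<inter> cent z)" using card_S by (metis cong_dvd_iff dvd_triv_right)
  then obtain m where m: "card (T \<inter> cent z) = p * m" by (elim dvdE)
  have "id \<in> T \<inter> cent z" using id_in by (simp add: cent_def)
  then have "T \<inter> cent z \<noteq> {}" by blast
  then have "m \<noteq> 0" using m finite_T by (metis card_0_eq finite_Int mult_is_0)
  have "T \<inter> cent z \<noteq> T"
  proof
    assume *: "T \<inter> cent z = T"
    obtain t where t: "t \<in> T" "\<forall>m. conj_by t z \<noteq> z ^^ m" using no_normal_orbit[OF assms] by blast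
    then have "t \<circ> z = z \<circ> t" using * by (auto simp: cent_def)
    then have "conj_by t z = z ^^ 1" using conj_by_eq_iff[OF perm[OF t(1)]] by simp
    then show False using t(2) by blast
  qed
  then have "card (T \<inter> cent z) < 2 * p"
    using psubset_card_mono[OF finite_T, of "T \<inter> cent z"] card_T[OF x] card_S by (metis Int_lower1 psubsetI)
  then have "m < 2" using m p0 by simp
  then show ?thesis using m \<open>m \<noteq> 0\<close> by (simp add: less_2_cases_iff)
qed

section \<open>Comparing the centralisers of two independent elements\<close>

lemma inter_cent_square:
  assumes z: "ffree z" "ffree y" and ne: "\<forall>m. y \<noteq> z ^^ m" and t: "t \<in> cent z" "t \<in> cent y"
  shows "t \<circ> t = id"
  using cent_square[OF z(1) t(1)] cent_square[OF z(2) t(2)] pow_subset_imp(1)[OF z] ne by metis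

text \<open>The square of a common element is a power of both \<open>z\<close> and \<open>y\<close>,
  hence trivial; besides \<open>id\<close> there is room only for the one involution that commutes
  with \<open>z\<close>.\<close>

lemma inter_cent_subset:
  assumes z: "ffree z" "ffree y" and ne: "\<forall>m. y \<noteq> z ^^ m"
  shows "card (T \<inter> cent z \<inter> cent y) \<le> 2"
proof (cases "\<exists>k \<in> T \<inter> cent z \<inter> cent y. k \<noteq> id")
  case True
  then obtain k where k: "k \<in> T \<inter> cent z \<inter> cent y" "k \<noteq> id" by blast
  have "T \<inter> cent z \<inter> cent y \<subseteq> {id, k}"
  proof
    fix l assume l: "l \<in> T \<inter> cent z \<inter> cent y"
    have "k \<circ> k = id" "l \<circ> l = id" using inter_cent_square[OF z ne] k l by auto
    then show "l \<in> {id, k}" using cent_involution_unique[OF z(1), of k l] k l by auto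
  qed
  then show ?thesis by (metis card_2_iff card_mono finite.emptyI finite.insertI k(2))
next
  case False
  then have "T \<inter> cent z \<inter> cent y \<subseteq> {id}" by blast
  then have "card (T \<inter> cent z \<inter> cent y) \<le> card {id :: 'a \<Rightarrow> 'a}" by (intro card_mono) auto
  then show ?thesis by simp
qed

lemma conj_by_in_T: "normalizes S T g \<Longrightarrow> t \<in> T \<Longrightarrow> conj_by g t \<in> T"
  by (auto simp: normalizes_def)

lemma cent_inv:
  assumes "g \<in> cent z" shows "inv g \<in> cent z"
proof -
  have gp: "g permutes S" using cent_perm assms by blast
  have "normalizes S T (inv g)" using assms normalizes_inv by (auto simp: cent_def)
  moreover have "g \<circ> z = z \<circ> g" using assms by (simp add: cent_def)
  then have "inv g \<circ> (g \<circ> z) \<circ> inv g = inv g \<circ> (z \<circ> g) \<circ> inv g" by simp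
  then have "z \<circ> inv g = inv g \<circ> z"
    by (metis comp_assoc comp_id id_comp permutes_inv_o(1)[OF gp] permutes_inv_o(2)[OF gp])
  ultimately show ?thesis by (simp add: cent_def)
qed

lemma conj_by_in_cent: "g \<in> cent z \<Longrightarrow> t \<in> cent z \<Longrightarrow> conj_by g t \<in> cent z"
  unfolding conj_by_def using cent_comp cent_inv by blast

text \<open>\<open>T - cent z\<close> has \<open>p\<close> elements, so conjugation by \<open>z\<close> permutes them in a single cycle.\<close>

lemma complement_cent_conj:
  assumes "\<nexists>F. half_block S T F" and z: "ffree z" and y: "y \<in> T - cent z" "w \<in> T - cent z"
  shows "\<exists>i<p. w = conj_by (z ^^ i) y"
proof -
  have zn: "normalizes S T z" and zz: "z ^^ p = id" using z by (auto simp: ffree_def)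
  have zp: "z permutes S" using ffree_perm[OF z] .
  let ?f = "conj_by z"
  let ?O = "(\<lambda>i. (?f ^^ i) y) ` {..<p}"
  obtain x where x: "x \<in> S" using S_nonempty by blast
  have "(?f ^^ p) y = y" using conj_by_funpow[OF zp, of p y] zz by simp
  moreover have "?f y \<noteq> y" using y in_normalizes conj_by_eq_iff[OF zp] by (auto simp: cent_def)
  ultimately have "card ?O = p" by (rule card_funpow_orbit[OF p])
  moreover have "card (T - cent z) = p"
    using card_T_cent[OF assms(1) z] card_T[OF x] card_S finite_T
    by (metis Diff_Int_distrib2 Int_Diff Int_absorb card_Diff_subset_Int diff_add_inverse finite_Int mult_2)
  moreover have "?O \<subseteq> T - cent z"
  proof (rule image_subsetI)
    fix i
    have eq: "(?f ^^ i) y = conj_by (z ^^ i) y" using conj_by_funpow[OF zp] by metis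
    have zi: "normalizes S T (z ^^ i)" using normalizes_funpow[OF zn] .
    have zic: "z ^^ i \<in> cent z" using pow_in_cent[OF z] .
    have "y = conj_by (inv (z ^^ i)) (conj_by (z ^^ i) y)"
      using conj_by_comp[of "inv (z ^^ i)" S "z ^^ i" y] funpow_permutes[OF zp, of i]
      by (simp add: permutes_inv permutes_inv_o(2))
    moreover have "inv (z ^^ i) \<in> cent z" using cent_inv[OF zic] .
    ultimately have "conj_by (z ^^ i) y \<notin> cent z" using conj_by_in_cent y by (metis DiffD2)
    then show "(?f ^^ i) y \<in> T - cent z" using eq conj_by_in_T[OF zi] y by simp
  qed
  ultimately have "?O = T - cent z" using finite_T by (metis card_subset_eq finite_Diff)
  then show ?thesis using y(2) conj_by_funpow[OF zp] by (metis (no_types, lifting) imageE lessThan_iff)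
qed

text \<open>Two distinct such elements are conjugate under some \<open>z ^^ i\<close>, and their
  squares generate the group of \<open>y\<close>; so \<open>z ^^ i\<close> normalises that group. A
  map of order \<open>p\<close> cannot act nontrivially on a group of order \<open>p\<close> by
  automorphisms, so \<open>z ^^ i\<close> commutes with \<open>y\<close>. Then \<open>z\<close> does
  as well, and the groups of \<open>z\<close> and \<open>y\<close> coincide.\<close>

lemma card_diff_cent:
  assumes nb: "\<nexists>F. half_block S T F" and z: "ffree z" "ffree y" and ne: "\<forall>m. y \<noteq> z ^^ m"
    and u: "u \<in> T \<inter> cent y - cent z" and w: "w \<in> T \<inter> cent y - cent z"
  shows "u = w"
proof (rule ccontr)
  assume uw: "u \<noteq> w"
  have yy: "y ^^ p = id" and zz: "z ^^ p = id" using z by (auto simp: ffree_def)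
  obtain i where i: "w = conj_by (z ^^ i) u" using complement_cent_conj[OF nb z(1)] u w by blast
  have ip: "z ^^ i permutes S" using ffree_perm[OF z(1)] funpow_permutes by blast
  have zi: "z ^^ i \<noteq> id" using i uw by auto
  have ww: "w \<circ> w = conj_by (z ^^ i) (u \<circ> u)" using i conj_by_of_comp[OF ip] by metis
  obtain b where b: "u \<circ> u = y ^^ b" using cent_square[OF z(2)] u by blast
  obtain c where c: "w \<circ> w = y ^^ c" using cent_square[OF z(2)] w by blast
  \<comment> \<open>Otherwise \<open>u\<close> and \<open>w\<close> would be two different
    involutions in the centraliser of \<open>y\<close>.\<close>
  have "u \<circ> u \<noteq> id"
  proof
    assume uu: "u \<circ> u = id"
    then have "w \<circ> w = id" using ww conj_by_id_right[OF ip] by simp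
    moreover have "u \<noteq> id" "w \<noteq> id" using u w cent_id by blast+
    ultimately show False using cent_involution_unique[OF z(2), of u w] u w uu uw by blast
  qed
  then obtain d where d: "(y ^^ b) ^^ d = y" using pow_generates[OF p yy] b by metis
  have "conj_by (z ^^ i) y = conj_by (z ^^ i) (y ^^ b) ^^ d" using d conj_by_pow[OF ip] by metis
  also have "conj_by (z ^^ i) (y ^^ b) = y ^^ c" using ww b c by simp
  also have "(y ^^ c) ^^ d = y ^^ (c * d)" by (simp add: funpow_mult)
  finally have conj_y: "conj_by (z ^^ i) y = y ^^ (c * d)" .
  \<comment> \<open>\<open>X\<close> is the group generated by \<open>y\<close>. Conjugation by
    \<open>z ^^ i\<close> permutes it and fixes \<open>id\<close>, so the number of fixed elements
    is a positive multiple of \<open>p\<close> and equals \<open>p\<close>.\<close>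
  define X where "X = (\<lambda>n. y ^^ n) ` {..<p}"
  have pow_in: "y ^^ n \<in> X" for n
  proof -
    have "y ^^ n = y ^^ (n mod p)" using yy by (simp add: fun_eq_iff funpow_mod_eq)
    then show ?thesis using p0 unfolding X_def by (metis imageI lessThan_iff mod_less_divisor)
  qed
  have "inj_on (\<lambda>n. y ^^ n) {..<p}"
  proof (rule inj_onI)
    fix m n assume *: "m \<in> {..<p}" "n \<in> {..<p}" "y ^^ m = y ^^ n"
    obtain x where "x \<in> S" using S_nonempty by blast
    then have "[m = n] (mod p)"
      using funpow_prime_eq_iff[OF p, of y x m n] yy z(2) *(3) by (simp add: ffree_def)
    then show "m = n" using * by (simp add: cong_def)
  qed
  then have cX: "card X = p" by (simp add: X_def card_image)
  have "[card X = card {g \<in> X. conj_by (z ^^ i) g = g}] (mod p)"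
  proof (rule card_fixpoints_cong[OF _ p])
    show "conj_by (z ^^ i) ` X \<subseteq> X"
    proof (rule image_subsetI)
      fix g assume "g \<in> X"
      then obtain n where n: "g = y ^^ n" by (auto simp: X_def)
      have "conj_by (z ^^ i) (y ^^ n) = y ^^ (c * d * n)"
        using conj_by_pow[OF ip] conj_y by (simp add: funpow_mult)
      then show "conj_by (z ^^ i) g \<in> X" using pow_in n by simp
    qed
    fix g
    have "(z ^^ i) ^^ p = (z ^^ p) ^^ i" by (simp add: funpow_mult mult.commute)
    then have "(z ^^ i) ^^ p = id" using zz by (simp add: id_funpow)
    then show "(conj_by (z ^^ i) ^^ p) g = g" using conj_by_funpow[OF ip, of p g] by simp
  qed (simp add: X_def)
  then have "p dvd card {g \<in> X. conj_by (z ^^ i) g = g}" using cX by (simp add: cong_def mod_0_imp_dvd)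
  moreover have "id \<in> {g \<in> X. conj_by (z ^^ i) g = g}"
    using pow_in[of 0] conj_by_id_right[OF ip] by (simp only: funpow.simps mem_Collect_eq)
  then have "{g \<in> X. conj_by (z ^^ i) g = g} \<noteq> {}" by blast
  then have "card {g \<in> X. conj_by (z ^^ i) g = g} > 0" by (simp add: card_gt_0_iff X_def)
  ultimately have "card X \<le> card {g \<in> X. conj_by (z ^^ i) g = g}" using cX by (simp add: dvd_imp_le)
  then have "{g \<in> X. conj_by (z ^^ i) g = g} = X" by (intro card_seteq) (auto simp: X_def)
  then have "conj_by (z ^^ i) y = y" using pow_in[of 1] by auto
  then have comm: "z ^^ i \<in> cent y"
    using conj_by_eq_iff[OF ip] normalizes_funpow z(1) by (auto simp: cent_def ffree_def)
  obtain e where "(z ^^ i) ^^ e = z" using pow_generates[OF p zz zi] by blast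
  then have "z \<in> cent y" using cent_funpow[OF comm] by metis
  then obtain n where n: "z \<circ> z = y ^^ n" using cent_square[OF z(2)] by blast
  \<comment> \<open>For odd \<open>p\<close> the square of \<open>z\<close> is a nontrivial element
    shared by the two groups.\<close>
  have "z ^^ 2 \<noteq> id" using pow_eq_id_iff[OF p zz ffree_ne_id[OF z(1)]] odd_p by (auto dest: dvd_imp_le)
  moreover have "z ^^ 2 = y ^^ n" using n by (simp add: numeral_2_eq_2)
  ultimately show False using pow_subset_imp(1)[OF z] ne by blast
qed

text \<open>The case that counting does not exclude.  Here \<open>k\<close> cuts the six points into three pairs, on which the
  three conjugates of \<open>u\<close> under \<open>z\<close> act by the same 3-cycle; so they send a point into the same pair,
  which has room for only two of them.\<close>

lemma three_conjugates:
  assumes z: "ffree z" and p3: "p = 3"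
    and u: "u \<in> T - cent z" and k: "k \<in> T \<inter> cent z" "k \<noteq> id" "k \<circ> k = id" "k \<circ> u = u \<circ> k"
  shows False
proof -
  have zn: "normalizes S T z" and zz: "z ^^ p = id" using z by (auto simp: ffree_def)
  have zp: "z permutes S" using ffree_perm[OF z] .
  have up: "u permutes S" using u perm by blast
  have kp: "k permutes S" using k perm by blast
  obtain e where e: "e \<in> S" using S_nonempty by blast
  define P where "P x = {x, k x}" for x
  define a where "a = z e"
  define b where "b = z a"
  have z3: "z (z (z x)) = x" for x using zz p3 by (simp add: numeral_3_eq_3 fun_eq_iff)
  have kk: "k (k x) = x" for x using k(3) by (metis comp_apply id_apply)
  have ku: "k (u x) = u (k x)" for x using k(4) by (metis comp_apply)
  have kz: "k (z x) = z (k x)" for x using k(1) by (auto simp: cent_def fun_eq_iff)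
  have S: "a \<in> S" "b \<in> S" using e zp by (simp_all add: a_def b_def permutes_in_image)
  have kx: "k x \<noteq> x" if "x \<in> S" for x using sharp[of k id x] k id_in that by auto
  \<comment> \<open>By sharp transitivity \<open>u\<close> agrees nowhere with \<open>id\<close> or
    with \<open>k\<close>, the two elements of \<open>T\<close> that preserve the pair of
    \<open>x\<close>; so \<open>u\<close> moves every pair.\<close>
  have ux: "u x \<notin> P x" if "x \<in> S" for x
    using sharp[of u id x] sharp[of u k x] u k id_in that cent_id by (auto simp: P_def)
  have zx: "z x \<notin> P x" if "x \<in> S" for x
  proof
    assume "z x \<in> P x"
    moreover have "z x \<noteq> x" using z that by (simp add: ffree_def)
    ultimately have "z x = k x" by (simp add: P_def)
    then have "z (z x) = x" using kz kk by metis
    then show False using z3 \<open>z x \<noteq> x\<close> by metis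
  qed
  have Psym: "x \<in> P y" if "y \<in> P x" for x y using that kk by (auto simp: P_def)
  have Ptrans: "w \<in> P x" if "y \<in> P x" "w \<in> P y" for w x y using that kk by (auto simp: P_def)
  have zP: "z y \<in> P (z x)" if "y \<in> P x" for x y using that kz by (auto simp: P_def)
  have uP: "y \<in> P x" if "u y \<in> P (u x)" for x y
    using that ku permutes_inj[OF up] by (auto simp: P_def dest: injD)
  have zb: "z b = e" using z3 by (simp add: a_def b_def)
  have ne: "a \<notin> P e" "b \<notin> P a" "e \<notin> P b" using zx[of e] zx[of a] zx[of b] e S zb by (simp_all add: a_def b_def)
  have cover: "x \<in> P e \<or> x \<in> P a \<or> x \<in> P b" if "x \<in> S" for x
  proof -
    have sub: "P e \<union> P a \<union> P b \<subseteq> S" using e S kp by (auto simp: P_def permutes_in_image)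
    have "card (P x) = 2" if "x \<in> S" for x using kx[OF that] by (auto simp: P_def)
    moreover have "P e \<inter> P a = {}" "(P e \<union> P a) \<inter> P b = {}" using ne Psym Ptrans by blast+
    moreover have "finite (P x)" for x by (simp add: P_def)
    ultimately have "card (P e \<union> P a \<union> P b) = 6" using e S by (simp add: card_Un_disjoint)
    then have "P e \<union> P a \<union> P b = S" using sub fin card_S p3 by (simp add: card_subset_eq)
    then show ?thesis using that by blast
  qed
  have uS: "u e \<in> S" "u a \<in> S" "u b \<in> S" using e S up by (simp_all add: permutes_in_image)
  let ?f = "conj_by z"
  have f1: "?f t x = z (t (z (z x)))" for t x
    using conj_by_apply[OF zp, of t "z (z x)"] z3 by simp
  have "\<exists>w. u e \<in> P w \<and> ?f u e \<in> P w \<and> ?f (?f u) e \<in> P w"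
  proof (cases "u e \<in> P a")
    case True
    have "u b \<in> P e" using cover[OF uS(3)] ux[OF S(2)] uP[of b e] ne True Psym Ptrans by blast
    then have "z (u b) \<in> P a" using zP by (simp add: a_def)
    moreover have "u a \<in> P b" using cover[OF uS(2)] ux[OF S(1)] uP[of a b] ne \<open>u b \<in> P e\<close> Psym Ptrans by blast
    then have "z (z (u a)) \<in> P (z (z b))" using zP by blast
    then have "z (z (u a)) \<in> P a" using zb by (simp add: a_def)
    ultimately show ?thesis using True f1 by (intro exI[of _ a]) (simp add: a_def b_def z3)
  next
    case False
    then have ub: "u e \<in> P b" using cover[OF uS(1)] ux[OF e] by blast
    have "u a \<in> P e" using cover[OF uS(2)] ux[OF S(1)] uP[of a e] ne ub Psym Ptrans by blast
    then have "z (z (u a)) \<in> P (z (z e))" using zP by blast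
    then have "z (z (u a)) \<in> P b" by (simp add: a_def b_def)
    moreover have "u b \<in> P a" using cover[OF uS(3)] ux[OF S(2)] uP[of b a] ne \<open>u a \<in> P e\<close> Psym Ptrans by blast
    then have "z (u b) \<in> P b" using zP by (simp add: b_def)
    ultimately show ?thesis using ub f1 by (intro exI[of _ b]) (simp add: a_def b_def z3)
  qed
  then obtain w where "u e \<in> P w" "?f u e \<in> P w" "?f (?f u) e \<in> P w" by blast
  then have "u e = ?f u e \<or> u e = ?f (?f u) e \<or> ?f u e = ?f (?f u) e" by (auto simp: P_def)
  moreover have fT: "?f u \<in> T" "?f (?f u) \<in> T" using u conj_by_in_T[OF zn] by auto
  ultimately have "u = ?f u \<or> u = ?f (?f u) \<or> ?f u = ?f (?f u)" using sharp e u by blast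
  then have "(?f ^^ 0) u = (?f ^^ 1) u \<or> (?f ^^ 0) u = (?f ^^ 2) u \<or> (?f ^^ 1) u = (?f ^^ 2) u"
    by (simp add: numeral_2_eq_2)
  moreover have "(?f ^^ p) u = u" using conj_by_funpow[OF zp, of p u] zz by simp
  moreover have "?f u \<noteq> u" using u in_normalizes conj_by_eq_iff[OF zp] by (auto simp: cent_def)
  ultimately have "[0 = 1] (mod p) \<or> [0 = 2] (mod p) \<or> [1 = 2] (mod p)"
    using funpow_prime_eq_iff[OF p, of ?f u] by blast
  then show False using p3 by (simp add: cong_def)
qed

lemma half_block_exists: "\<exists>F. half_block S T F"
proof (rule ccontr)
  assume nb: "\<nexists>F. half_block S T F"
  obtain x where x: "x \<in> S" using S_nonempty by blast
  obtain z where "normalizes S T z" "z ^^ p = id" "z \<noteq> id"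
    using ex_normalizer_prime_order[OF p, of thesis] card_S x by auto
  then have z: "ffree z" using all_ffree by blast
  obtain t where t: "t \<in> T" "\<forall>m. conj_by t z \<noteq> z ^^ m" using no_normal_orbit[OF nb z] by blast
  define y where "y = conj_by t z"
  have y: "ffree y" "\<forall>m. y \<noteq> z ^^ m" using ffree_conj[OF z in_normalizes[OF t(1)]] t(2) by (auto simp: y_def)
  let ?A = "T \<inter> cent z \<inter> cent y" and ?B = "T \<inter> cent y - cent z"
  have fin: "finite ?A" "finite ?B" using finite_T by auto
  have "p = card (?A \<union> ?B)" using card_T_cent[OF nb y(1)]
    by (metis Int_assoc Int_commute Un_Diff_Int Un_commute)
  also have "\<dots> = card ?A + card ?B" using fin by (intro card_Un_disjoint) auto
  finally have cc: "p = card ?A + card ?B" .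
  have A: "card ?A \<le> 2" using inter_cent_subset[OF z y] .
  have B: "card ?B \<le> Suc 0" using card_le_Suc0_iff_eq[OF fin(2)] card_diff_cent[OF nb z y] by blast
  have p3: "p = 3" "card ?A = 2" "card ?B = 1" using cc A B odd_p by auto
  then obtain u where u: "u \<in> ?B" by (metis card_1_singletonE insertI1)
  have "?A \<noteq> {id}" using p3 by auto
  moreover have "id \<in> ?A" using id_in cent_id by blast
  ultimately obtain k where k: "k \<in> ?A" "k \<noteq> id" by blast
  have kk: "k \<circ> k = id" using inter_cent_square[OF z y] k by blast
  have up: "u permutes S" using u perm by blast
  \<comment> \<open>\<open>u\<close> and \<open>k\<close> both lie in the centraliser of
    \<open>y\<close>; as that contains a single involution, conjugation by \<open>u\<close> cannot
    move \<open>k\<close>.\<close>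
  have "conj_by u k \<in> cent y" using conj_by_in_cent u k by blast
  moreover have "conj_by u k \<circ> conj_by u k = id"
    using conj_by_of_comp[OF up, of k k] kk conj_by_id_right[OF up] by simp
  moreover have "conj_by u k \<noteq> id"
    using k(2) conj_by_eq_iff[OF up, of k id] permutes_comp_cong[OF up, of k id] by auto
  ultimately have "conj_by u k = k" using cent_involution_unique[OF y(1), of _ k] k kk by blast
  then have "k \<circ> u = u \<circ> k" using conj_by_eq_iff[OF up] by metis
  then show False using three_conjugates[OF z p3(1), of u k] u k kk by blast
qed

end

text \<open>It suffices to find \<open>t\<close> in \<open>T\<close> that exchanges \<open>e\<close>
  with another point: an element of \<open>T\<close> mapping a point of \<open>{e, t e}\<close> into
  the pair agrees there with \<open>id\<close> or \<open>t\<close>, hence is one of them.\<close>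

lemma (in rcc_set) half_block_4:
  assumes "card S = 4" shows "\<exists>F. half_block S T F"
proof -
  obtain e a where ea: "e \<in> S" "a \<in> S" "a \<noteq> e"
    using assms by (metis One_nat_def card_le_Suc0_iff_eq fin numeral_le_one_iff semiring_norm(69))
  obtain s where s: "s \<in> T" "s e = a" using transitive ea by blast
  have free: "t x \<noteq> x" if "t \<in> T" "t e \<noteq> e" "x \<in> S" for t x using sharp[of t id x] that id_in by auto
  have inv_ex: "\<exists>t\<in>T. t e \<noteq> e \<and> t (t e) = e"
  proof (cases "s a = e")
    case True
    then show ?thesis using s ea by (intro bexI[of _ s]) auto
  next
    case False
    \<comment> \<open>Here \<open>s\<close> turns out to be the 4-cycle through \<open>e\<close>,
      \<open>a\<close>, \<open>b\<close>, \<open>c\<close>. The element \<open>t\<close> taking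
      \<open>e\<close> to \<open>b\<close> has no fixed point and agrees nowhere with
      \<open>s\<close>, which forces it to take \<open>b\<close> back to \<open>e\<close>.\<close>
    define b where "b = s a"
    have sp: "s permutes S" using s perm by blast
    have b: "b \<in> S" "b \<noteq> e" "b \<noteq> a" using ea sp False free[of s a] s by (auto simp: b_def permutes_in_image)
    have "card (S - {e, a, b}) = 1" using assms ea b by (simp add: card_Diff_subset)
    then obtain c where "S - {e, a, b} = {c}" by (rule card_1_singletonE)
    then have c: "S = {e, a, b, c}" "c \<noteq> e" "c \<noteq> a" "c \<noteq> b" using ea b by auto
    have cS: "c \<in> S" using c(1) by blast
    have sfree: "s x \<noteq> x" if "x \<in> S" for x using free[OF s(1) _ that] s(2) ea(3) by blast
    have sS: "s x \<in> S" if "x \<in> S" for x using permutes_in_image[OF sp] that by blast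
    have si: "s x = s y \<longleftrightarrow> x = y" for x y using permutes_inj[OF sp] by (auto dest: injD)
    have "s b \<in> {e, a, b, c}" "s c \<in> {e, a, b, c}" using sS b(1) cS c(1) by blast+
    moreover have "s b \<noteq> a" "s c \<noteq> a" "s c \<noteq> b" "s b \<noteq> s c" using si s(2) b c b_def by metis+
    ultimately have sbc: "s b = c" "s c = e" using sfree[OF b(1)] sfree[OF cS] c(2-4) by auto
    obtain t where t: "t \<in> T" "t e = b" using transitive ea b by blast
    have tp: "t permutes S" using t perm by blast
    have tfree: "t x \<noteq> x" if "x \<in> S" for x using free[OF t(1) _ that] t(2) b(2) by blast
    have tS: "t x \<in> S" if "x \<in> S" for x using permutes_in_image[OF tp] that by blast
    have ti: "t x = t y \<longleftrightarrow> x = y" for x y using permutes_inj[OF tp] by (auto dest: injD)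
    have nst: "t x \<noteq> s x" if "x \<in> S" for x using sharp[OF t(1) s(1) that] t s b by metis
    have "t b \<in> {e, a, b, c}" "t a \<in> {e, a, b, c}" "t c \<in> {e, a, b, c}" using tS ea b(1) cS c(1) by blast+
    moreover have "t c \<noteq> b" "t a \<noteq> t b" "t c \<noteq> t b" "t a \<noteq> t c" using ti t(2) b c by metis+
    moreover have "t b \<noteq> c" "t c \<noteq> e" using nst[OF b(1)] nst[OF cS] sbc by auto
    moreover have "t a \<noteq> b" using nst[OF ea(2)] b_def by simp
    ultimately have "t b = e" using tfree[OF ea(2)] tfree[OF b(1)] tfree[OF cS] by auto
    then show ?thesis using t b by (intro bexI[of _ t]) auto
  qed
  then obtain t where t: "t \<in> T" "t e \<noteq> e" "t (t e) = e" by blast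
  have tp: "t permutes S" using t perm by blast
  have "half_block S T {e, t e}"
  proof (rule half_blockI)
    show "{e, t e} \<subseteq> S" using ea tp by (simp add: permutes_in_image)
    show "card S = 2 * card {e, t e}" using assms t by simp
    fix r x assume r: "r \<in> T" "x \<in> {e, t e}" "r x \<in> {e, t e}"
    have "t e \<in> S" using ea tp by (simp add: permutes_in_image)
    then have "r = id \<or> r = t" using r t sharp[of r id x] sharp[of r t x] id_in ea by auto
    then show "r ` {e, t e} \<subseteq> {e, t e}" using t by auto
  qed
  then show ?thesis by blast
qed

theorem (in rcc_set) ex_half_block:
  assumes p: "prime p" and S: "card S = 2 * p" shows "\<exists>F. half_block S T F"
proof (cases "p = 2")
  case True
  then show ?thesis using half_block_4 S by simp
next
  case False
  then have p2: "p > 2" using p by (metis le_neq_implies_less prime_ge_2_nat)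
  interpret A: rcc_set_2p S T p by standard (use p p2 S in auto)
  show ?thesis
  proof (cases "\<exists>z x. normalizes S T z \<and> z ^^ p = id \<and> z \<noteq> id \<and> x \<in> S \<and> z x = x")
    case True
    then show ?thesis using half_block_fixpoints[OF p S] by blast
  next
    case False
    interpret all_ffree S T p by standard (use False in \<open>auto simp: A.ffree_def\<close>)
    show ?thesis by (rule half_block_exists)
  qed
qed

section \<open>Coordinates\<close>

text \<open>Reduces a congruence to a polynomial identity over the integers; the factor
  \<open>k\<close>, and \<open>l\<close> in the variant with two hypotheses, is a certificate
  supplied by hand.\<close>

lemma cong_comb:
  fixes x y a b k m :: int
  assumes "[a = b] (mod m)" "x - y = k * (a - b)"
  shows "[x = y] (mod m)"
  using assms by (simp add: cong_iff_dvd_diff)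

lemma cong_comb2:
  fixes x y a b c d k l m :: int
  assumes "[a = b] (mod m)" "[c = d] (mod m)" "x - y = k * (a - b) + l * (c - d)"
  shows "[x = y] (mod m)"
  using assms by (simp add: cong_iff_dvd_diff)

text \<open>\<open>\<kappa> b x\<close> is the point with coordinate \<open>x\<close>, an integer modulo \<open>p\<close>, in block \<open>b\<close>.  The map \<open>t\<close> acts as
  \<open>x \<mapsto> a x + u\<close> on block \<open>False\<close> and as \<open>x \<mapsto> b x + v\<close> on block \<open>True\<close>, and swaps the blocks iff \<open>s\<close>.\<close>

definition aff :: "(bool \<Rightarrow> int \<Rightarrow> 'a) \<Rightarrow> bool \<Rightarrow> int \<Rightarrow> int \<Rightarrow> int \<Rightarrow> int \<Rightarrow> ('a \<Rightarrow> 'a) \<Rightarrow> bool" where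
  "aff \<kappa> s a u b v t \<longleftrightarrow>
     (\<forall>x. t (\<kappa> False x) = \<kappa> s (a * x + u)) \<and> (\<forall>x. t (\<kappa> True x) = \<kappa> (\<not> s) (b * x + v))"

text \<open>Integers stand for residues and each \<open>\<kappa> b\<close> has period
  \<open>p\<close>, so affine maps can be written and composed over \<open>int\<close>.\<close>

locale coordinates =
  fixes p :: nat and S :: "'a set" and \<kappa> :: "bool \<Rightarrow> int \<Rightarrow> 'a"
  assumes p: "prime p"
    and kappa_eq: "\<kappa> b x = \<kappa> c y \<longleftrightarrow> b = c \<and> [x = y] (mod int p)"
    and kappa_range: "S = {\<kappa> b x | b x. True}"
begin

lemma p0: "p > 0" using p by (simp add: prime_gt_0_nat)

lemma kappa_in: "\<kappa> b x \<in> S" using kappa_range by blast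

lemma in_S_E: assumes "y \<in> S" obtains b x where "y = \<kappa> b x"
  using assms kappa_range by blast

lemma inverse_mod: "\<not> int p dvd a \<Longrightarrow> \<exists>c. [a * c = 1] (mod int p)"
  using p by (metis cong_solve_coprime_int coprime_commute prime_imp_coprime prime_nat_int_transfer)

lemma mult_cong_cancel: "\<not> int p dvd a \<Longrightarrow> [a * x = a * y] (mod int p) \<longleftrightarrow> [x = y] (mod int p)"
  using p by (metis cong_mult_lcancel coprime_commute prime_imp_coprime prime_nat_int_transfer)

lemma finite_S: "finite S"
proof -
  have "S \<subseteq> (\<lambda>(b, n). \<kappa> b (int n)) ` (UNIV \<times> {..<p})"
  proof
    fix y assume "y \<in> S"
    then obtain b x where y: "y = \<kappa> b x" by (rule in_S_E)
    have "y = \<kappa> b (int (nat (x mod int p)))" using p0 y by (simp add: kappa_eq cong_def)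
    moreover have "nat (x mod int p) < p" using p0 by (simp add: nat_less_iff)
    ultimately show "y \<in> (\<lambda>(b, n). \<kappa> b (int n)) ` (UNIV \<times> {..<p})" by force
  qed
  then show ?thesis by (rule finite_subset) simp
qed

lemma aff_False: "aff \<kappa> s a u b v t \<Longrightarrow> t (\<kappa> False x) = \<kappa> s (a * x + u)"
  and aff_True: "aff \<kappa> s a u b v t \<Longrightarrow> t (\<kappa> True x) = \<kappa> (\<not> s) (b * x + v)"
  by (auto simp: aff_def)

lemma perm_eqI:
  assumes "t permutes S" "r permutes S" "\<And>b x. t (\<kappa> b x) = r (\<kappa> b x)" shows "t = r"
proof
  fix y
  show "t y = r y"
  proof (cases "y \<in> S")
    case True
    then show ?thesis using assms(3) by (metis in_S_E)
  next
    case False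
    then show ?thesis using assms(1,2) by (simp add: permutes_not_in)
  qed
qed

lemma aff_cong:
  assumes "aff \<kappa> s a u b v t" "[a = a'] (mod int p)" "[u = u'] (mod int p)" "[b = b'] (mod int p)" "[v = v'] (mod int p)"
  shows "aff \<kappa> s a' u' b' v' t"
  using assms by (auto simp: aff_def kappa_eq intro!: cong_add cong_mult)

lemma aff_eqI:
  assumes "t permutes S" "r permutes S" "aff \<kappa> s a u b v t" "aff \<kappa> s a u b v r" shows "t = r"
proof (rule perm_eqI[OF assms(1,2)])
  fix c x show "t (\<kappa> c x) = r (\<kappa> c x)" using assms(3,4) by (cases c) (simp_all add: aff_def)
qed

lemma aff_params:
  assumes "aff \<kappa> s a u b v t" "aff \<kappa> s' a' u' b' v' t"
  shows "s = s'" "[a = a'] (mod int p)" "[u = u'] (mod int p)" "[b = b'] (mod int p)" "[v = v'] (mod int p)"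
proof -
  have F: "\<kappa> s (a * x + u) = \<kappa> s' (a' * x + u')" for x using assms by (metis aff_def)
  have G: "\<kappa> (\<not> s) (b * x + v) = \<kappa> (\<not> s') (b' * x + v')" for x using assms by (metis aff_def)
  show "s = s'" using F[of 0] by (simp add: kappa_eq)
  show u: "[u = u'] (mod int p)" using F[of 0] kappa_eq by simp
  show v: "[v = v'] (mod int p)" using G[of 0] kappa_eq by simp
  have "[a + u = a' + u'] (mod int p)" using F[of 1] kappa_eq by simp
  then show "[a = a'] (mod int p)" using u by (rule cong_comb2[where k = 1 and l = "-1"]) simp
  have "[b + v = b' + v'] (mod int p)" using G[of 1] kappa_eq by simp
  then show "[b = b'] (mod int p)" using v by (rule cong_comb2[where k = 1 and l = "-1"]) simp
qed

text \<open>Coordinates of a point are unique only up to congruence; the hypothesis on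
  \<open>g\<close> makes the chosen representative irrelevant and the map injective, and finiteness
  makes it onto.\<close>

lemma ex_map:
  assumes g: "\<And>b x c y. g b x = g c y \<longleftrightarrow> b = c \<and> [x = y] (mod int p)" and gS: "\<And>b x. g b x \<in> S"
  obtains t where "t permutes S" "\<And>b x. t (\<kappa> b x) = g b x"
proof -
  define q where "q y = (SOME bx. \<kappa> (fst bx) (snd bx) = y)" for y
  define t where "t y = (if y \<in> S then g (fst (q y)) (snd (q y)) else y)" for y
  have q: "\<kappa> (fst (q (\<kappa> b x))) (snd (q (\<kappa> b x))) = \<kappa> b x" for b x
    unfolding q_def by (rule someI[of _ "(b, x)"]) simp
  have t: "t (\<kappa> b x) = g b x" for b x
    using q[of b x] by (simp add: t_def kappa_in kappa_eq g)
  have "inj_on t S"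
  proof (rule inj_onI)
    fix y y' assume yS: "y \<in> S" "y' \<in> S" and eq: "t y = t y'"
    obtain b x where y: "y = \<kappa> b x" by (rule in_S_E[OF yS(1)])
    obtain b' x' where y': "y' = \<kappa> b' x'" by (rule in_S_E[OF yS(2)])
    show "y = y'" using eq y y' by (simp add: t g kappa_eq)
  qed
  moreover have "t ` S \<subseteq> S" using gS by (auto simp: t_def)
  ultimately have "bij_betw t S S" using finite_S by (simp add: bij_betw_def endo_inj_surj)
  then have "t permutes S" by (rule bij_imp_permutes) (simp add: t_def)
  then show thesis using that t by blast
qed

lemma aff_exists:
  assumes "\<not> int p dvd a" "\<not> int p dvd b"
  obtains t where "t permutes S" "aff \<kappa> s a u b v t"
proof -
  define g where "g c x = (if c then \<kappa> (\<not> s) (b * x + v) else \<kappa> s (a * x + u))" for c x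
  have cc: "[k * x + u = k * y + u] (mod int p) \<longleftrightarrow> [x = y] (mod int p)" if "\<not> int p dvd k" for k x y u
    using mult_cong_cancel[OF that] by (simp add: cong_add_rcancel)
  obtain t where "t permutes S" "\<And>c x. t (\<kappa> c x) = g c x"
    by (rule ex_map[of g]) (auto simp: g_def kappa_eq kappa_in cc[OF assms(1)] cc[OF assms(2)])
  then show thesis using that by (auto simp: aff_def g_def)
qed

lemma aff_comp_False: 
  "aff \<kappa> s a u b v t \<Longrightarrow> aff \<kappa> False a' u' b' v' r \<Longrightarrow> aff \<kappa> s (a * a') (a * u' + u) (b * b') (b * v' + v) (t \<circ> r)"
  by (simp add: aff_def algebra_simps)

lemma aff_comp_True: 
  "aff \<kappa> s a u b v t \<Longrightarrow> aff \<kappa> True a' u' b' v' r \<Longrightarrow> aff \<kappa> (\<not> s) (b * a') (b * u' + v) (a * b') (a * v' + u) (t \<circ> r)"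
  by (simp add: aff_def algebra_simps)

lemma aff_eqI_cong:
  assumes "t permutes S" "r permutes S" "aff \<kappa> s a u b v t" "aff \<kappa> s a' u' b' v' r"
    "[a = a'] (mod int p)" "[u = u'] (mod int p)" "[b = b'] (mod int p)" "[v = v'] (mod int p)"
  shows "t = r"
  using aff_cong[OF assms(3,5-8)] aff_eqI[OF assms(1,2)] assms(4) by blast

lemma aff_conj_eq:
  assumes "t permutes S" "s permutes S" "r permutes S" "aff \<kappa> e a u b v (r \<circ> t)" "aff \<kappa> e a' u' b' v' (t \<circ> s)"
    "[a = a'] (mod int p)" "[u = u'] (mod int p)" "[b = b'] (mod int p)" "[v = v'] (mod int p)"
  shows "conj_by t s = r"
  using aff_eqI_cong[OF _ _ assms(4-)] assms(1-3) conj_by_eq_iff[OF assms(1)] permutes_compose by metis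

lemma one_ndvd: "\<not> int p dvd 1"
  using p by (metis int_dvd_int_iff not_prime_unit of_nat_1)

lemma aff_coprime:
  assumes "t permutes S" "aff \<kappa> s a u b v t"
  shows "\<not> int p dvd a" "\<not> int p dvd b"
proof -
  have ne: "\<kappa> c 0 \<noteq> \<kappa> c 1" for c using one_ndvd by (simp add: kappa_eq cong_iff_dvd_diff)
  then have ne': "t (\<kappa> c 0) \<noteq> t (\<kappa> c 1)" for c using permutes_inj[OF assms(1)] by (metis injD)
  show "\<not> int p dvd a" using ne'[of False] assms(2) by (auto simp: aff_def kappa_eq cong_iff_dvd_diff)
  show "\<not> int p dvd b" using ne'[of True] assms(2) by (auto simp: aff_def kappa_eq cong_iff_dvd_diff)
qed

text \<open>Here, and in the next two formulas, a candidate \<open>r\<close> is built with the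
  claimed parameters and \<open>r \<circ> s = s \<circ> t\<close> is compared, which avoids
  inverting affine maps.\<close>

lemma conj_shift_swap:
  assumes "s permutes S" "t permutes S" "aff \<kappa> False 1 i 1 j s" "aff \<kappa> True a u b v t"
  shows "aff \<kappa> True a (u + j - a * i) b (v + i - b * j) (conj_by s t)"
proof -
  obtain r where r: "r permutes S" "aff \<kappa> True a (u + j - a * i) b (v + i - b * j) r"
    using aff_exists aff_coprime[OF assms(2,4)] by metis
  have "conj_by s t = r"
    by (rule aff_conj_eq[OF assms(1,2) r(1) aff_comp_False[OF r(2) assms(3)] aff_comp_True[OF assms(3,4), simplified]])
      (simp_all add: add.commute)
  then show ?thesis using r by simp
qed

lemma conj_swap_shift:
  assumes "s permutes S" "t permutes S" "aff \<kappa> False 1 i 1 j s" "aff \<kappa> True a u b v t"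
  shows "aff \<kappa> False 1 (b * j) 1 (a * i) (conj_by t s)"
proof -
  obtain r where r: "r permutes S" "aff \<kappa> False 1 (b * j) 1 (a * i) r"
    using aff_exists one_ndvd by metis
  have "conj_by t s = r"
    by (rule aff_conj_eq[OF assms(2,1) r(1) aff_comp_True[OF r(2) assms(4), simplified] aff_comp_False[OF assms(4,3)]])
      (simp_all add: add.commute)
  then show ?thesis using r by simp
qed

lemma conj_swap_swap:
  assumes "s permutes S" "t permutes S" "aff \<kappa> True 1 v 1 y s" "aff \<kappa> True 1 u 1 w t"
  shows "aff \<kappa> True 1 (w - (y - v)) 1 (u + (y - v)) (conj_by s t)"
proof -
  obtain r where r: "r permutes S" "aff \<kappa> True 1 (w - (y - v)) 1 (u + (y - v)) r"
    using aff_exists one_ndvd by metis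
  have "conj_by s t = r"
    by (rule aff_conj_eq[OF assms(1,2) r(1) aff_comp_True[OF r(2) assms(3), simplified] aff_comp_True[OF assms(3,4), simplified]])
      simp_all
  then show ?thesis using r by simp
qed

text \<open>Block \<open>False\<close> is only translated, so the parameter \<open>i\<close> of a
  shift keeps its value; all scaling takes place in block \<open>True\<close>.\<close>

lemma coordinates_rescale:
  assumes "\<not> int p dvd c"
  shows "coordinates p S (\<lambda>b x. \<kappa> b (if b then c * x + e else x + f))"
proof
  show "prime p" by (rule p)
  show "(\<kappa> b (if b then c * x + e else x + f) = \<kappa> b' (if b' then c * y + e else y + f)) = (b = b' \<and> [x = y] (mod int p))" for b x b' y
    using mult_cong_cancel[OF assms, of x y] by (auto simp: kappa_eq cong_add_rcancel)
  obtain c' where c': "[c * c' = 1] (mod int p)" using inverse_mod[OF assms] by blast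
  have "y \<in> {\<kappa> b (if b then c * x + e else x + f) | b x. True}" if yS: "y \<in> S" for y
  proof -
    obtain b x where y: "y = \<kappa> b x" by (rule in_S_E[OF yS])
    define x' where "x' = (if b then c' * (x - e) else x - f)"
    have "[x = c * (c' * (x - e)) + e] (mod int p)"
      by (rule cong_comb[OF c', where k = "e - x"]) (simp add: algebra_simps)
    then have "y = \<kappa> b (if b then c * x' + e else x' + f)" using y by (simp add: kappa_eq x'_def)
    then show ?thesis by blast
  qed
  then show "S = {\<kappa> b (if b then c * x + e else x + f) | b x. True}" using kappa_in by blast
qed

text \<open>The summands \<open>+ 0\<close> keep \<open>\<kappa>'\<close> an instance of
  \<open>coordinates_rescale\<close>.\<close>

lemma aff_scale:
  fixes c c' :: int
  assumes "[c * c' = 1] (mod int p)"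
  defines "\<kappa>' \<equiv> (\<lambda>b x. \<kappa> b (if b then c * x + 0 else x + 0))"
  shows "aff \<kappa> False 1 i 1 j t \<Longrightarrow> aff \<kappa>' False 1 i 1 (c' * j) t"
    and "aff \<kappa> True a u b v t \<Longrightarrow> aff \<kappa>' True (c' * a) (c' * u) (b * c) v t"
proof -
  have *: "[y = c * (c' * y)] (mod int p)" for y
    by (rule cong_comb[OF assms(1), where k = "- y"]) (simp add: algebra_simps)
  show "aff \<kappa>' False 1 i 1 (c' * j) t" if "aff \<kappa> False 1 i 1 j t"
    using that *[of j] by (simp add: aff_def \<kappa>'_def kappa_eq distrib_left cong_add_lcancel)
  show "aff \<kappa>' True (c' * a) (c' * u) (b * c) v t" if "aff \<kappa> True a u b v t"
    using that *[of "a * x + u" for x] by (simp add: aff_def \<kappa>'_def kappa_eq algebra_simps)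
qed

lemma aff_shift:
  fixes f :: int
  defines "\<kappa>' \<equiv> (\<lambda>b x. \<kappa> b (if b then 1 * x + 0 else x + f))"
  shows "aff \<kappa> False 1 i 1 j t \<Longrightarrow> aff \<kappa>' False 1 i 1 j t"
    and "aff \<kappa> True a u b v t \<Longrightarrow> aff \<kappa>' True a (a * f + u) b (v - f) t"
  by (simp_all add: aff_def \<kappa>'_def algebra_simps)

end

section \<open>The two families\<close>

text \<open>For odd \<open>p\<close>, the value \<open>a = 1\<close> gives the regular cyclic group
  of order \<open>2 * p\<close>. The regular dihedral group occurs in \<open>TB\<close>, with
  negation as \<open>\<sigma>\<close> and \<open>d = 0\<close>.\<close>

definition TA :: "'a set \<Rightarrow> (bool \<Rightarrow> int \<Rightarrow> 'a) \<Rightarrow> int \<Rightarrow> ('a \<Rightarrow> 'a) set" where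
  "TA S \<kappa> a = {t. t permutes S \<and> ((\<exists>i. aff \<kappa> False 1 i 1 i t) \<or> (\<exists>u. aff \<kappa> True a u a u t))}"

definition TB :: "'a set \<Rightarrow> (bool \<Rightarrow> int \<Rightarrow> 'a) \<Rightarrow> (int \<Rightarrow> int) \<Rightarrow> int \<Rightarrow> ('a \<Rightarrow> 'a) set" where
  "TB S \<kappa> \<sigma> d = {t. t permutes S \<and> ((\<exists>i. aff \<kappa> False 1 i 1 (\<sigma> i) t) \<or> (\<exists>u. aff \<kappa> True 1 u 1 (d - u) t))}"

text \<open>Since \<open>\<sigma>\<close> acts on integers, respecting congruence is part of
  inducing a permutation of the residues.\<close>

definition invol0 :: "nat \<Rightarrow> (int \<Rightarrow> int) \<Rightarrow> bool" where
  "invol0 p \<sigma> \<longleftrightarrow> (\<forall>i j. [i = j] (mod int p) \<longrightarrow> [\<sigma> i = \<sigma> j] (mod int p)) \<and>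
     (\<forall>i. [\<sigma> (\<sigma> i) = i] (mod int p)) \<and> [\<sigma> 0 = 0] (mod int p)"

locale rcc_coords = rcc_set S T + coordinates p S \<kappa> for p S T \<kappa>
begin

text \<open>An element of a sharply transitive set is determined by the image of
  \<open>\<kappa> False 0\<close>, and the two hypotheses supply an element of the required form for
  every image.\<close>

lemma eq_family:
  assumes 0: "\<And>i. \<exists>t\<in>T. aff \<kappa> False 1 i 1 (f i) t" and swap: "\<And>u. \<exists>t\<in>T. aff \<kappa> True a u b (g u) t"
  shows "T = {t. t permutes S \<and> ((\<exists>i. aff \<kappa> False 1 i 1 (f i) t) \<or> (\<exists>u. aff \<kappa> True a u b (g u) t))}" (is "T = ?X")
proof (intro equalityI subsetI)
  fix t assume "t \<in> ?X"
  then have tp: "t permutes S" by simp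
  from \<open>t \<in> ?X\<close> consider i where "aff \<kappa> False 1 i 1 (f i) t" | u where "aff \<kappa> True a u b (g u) t"
    by blast
  then show "t \<in> T"
  proof cases
    case (1 i)
    obtain r where r: "r \<in> T" "aff \<kappa> False 1 i 1 (f i) r" using 0 by blast
    show ?thesis using aff_eqI[OF tp perm[OF r(1)] 1 r(2)] r(1) by simp
  next
    case (2 u)
    obtain r where r: "r \<in> T" "aff \<kappa> True a u b (g u) r" using swap by blast
    show ?thesis using aff_eqI[OF tp perm[OF r(1)] 2 r(2)] r(1) by simp
  qed
next
  fix t assume t: "t \<in> T"
  then have tp: "t permutes S" using perm by blast
  then have "t (\<kappa> False 0) \<in> S" using kappa_in by (simp add: permutes_in_image)
  then obtain c y where cy: "t (\<kappa> False 0) = \<kappa> c y" by (rule in_S_E)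
  show "t \<in> ?X"
  proof (cases c)
    case False
    obtain r where r: "r \<in> T" "aff \<kappa> False 1 y 1 (f y) r" using 0 by blast
    then have "r = t" using sharp[OF r(1) t kappa_in[of False 0]] cy False by (simp add: aff_def)
    then show ?thesis using r tp by blast
  next
    case True
    obtain r where r: "r \<in> T" "aff \<kappa> True a y b (g y) r" using swap by blast
    then have "r = t" using sharp[OF r(1) t kappa_in[of False 0]] cy True by (simp add: aff_def)
    then show ?thesis using r tp by blast
  qed
qed

lemma eq_TA:
  "(\<And>i. \<exists>t\<in>T. aff \<kappa> False 1 i 1 i t) \<Longrightarrow> (\<And>u. \<exists>t\<in>T. aff \<kappa> True a u a u t) \<Longrightarrow> T = TA S \<kappa> a"
  unfolding TA_def by (rule eq_family)

lemma eq_TB: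
  "(\<And>i. \<exists>t\<in>T. aff \<kappa> False 1 i 1 (\<sigma> i) t) \<Longrightarrow> (\<And>u. \<exists>t\<in>T. aff \<kappa> True 1 u 1 (d - u) t) \<Longrightarrow> T = TB S \<kappa> \<sigma> d"
  unfolding TB_def by (rule eq_family)

end

section \<open>Classification\<close>

lemma half_blockD: "half_block S T F \<Longrightarrow> t \<in> T \<Longrightarrow> t ` F = F \<or> t ` F = S - F"
  by (simp add: half_block_def)

text \<open>An element taking a point of the block into the block preserves it, so transitivity
  survives; restrictions that agree at a point come from the same element, so sharpness does.
  Extending by the identity outside \<open>F\<close> keeps the restrictions permutations.\<close>

lemma (in rcc_set) restrict_block:
  assumes F: "half_block S T F"
  shows "rcc_set F ((\<lambda>t x. if x \<in> F then t x else x) ` {t \<in> T. t ` F = F})" (is "rcc_set F (?r ` ?T)")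
proof
  have FS: "F \<subseteq> S" using F by (simp add: half_block_def)
  show "finite F" using FS fin finite_subset by blast
  show "t permutes F" if tT: "t \<in> ?r ` ?T" for t
  proof -
    obtain u where u: "u \<in> T" "u ` F = F" "t = ?r u" using tT by blast
    have "inj_on u F" using u perm permutes_inj_on by blast
    then have "bij_betw u F F" using u(2) by (simp add: bij_betw_def)
    then have "bij_betw t F F" using u(3) by (simp cong: bij_betw_cong)
    then show ?thesis by (rule bij_imp_permutes) (simp add: u(3))
  qed
  show "id \<in> ?r ` ?T" using id_in by (intro image_eqI[of _ _ id]) auto
  show "\<exists>t\<in>?r ` ?T. t x = y" if xy: "x \<in> F" "y \<in> F" for x y
  proof -
    obtain t where t: "t \<in> T" "t x = y" using transitive xy FS by blast
    then have "t ` F \<noteq> S - F" using xy by blast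
    then have "t ` F = F" using half_blockD[OF F t(1)] by blast
    then show ?thesis using t that by (intro bexI[of _ "?r t"]) auto
  qed
  show "s = t" if st: "s \<in> ?r ` ?T" "t \<in> ?r ` ?T" "x \<in> F" "s x = t x" for s t x
  proof -
    obtain s' t' where st': "s' \<in> T" "t' \<in> T" "s = ?r s'" "t = ?r t'" using st by blast
    then have "s' = t'" using sharp[of s' t' x] st(3,4) FS by auto
    then show ?thesis by (simp only: st')
  qed
  show "\<exists>r\<in>?r ` ?T. t \<circ> s = s \<circ> r" if st: "s \<in> ?r ` ?T" "t \<in> ?r ` ?T" for s t
  proof -
    obtain s' t' where st': "s' \<in> T" "s' ` F = F" "t' \<in> T" "t' ` F = F" "s = ?r s'" "t = ?r t'" using st by blast
    obtain r where r: "r \<in> T" "t' \<circ> s' = s' \<circ> r" using conj_closed st' by blast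
    have tsr: "t' (s' x) = s' (r x)" for x using r(2) by (metis comp_apply)
    have "inj s'" using st' perm permutes_inj by blast
    have "s' ` (r ` F) = t' ` s' ` F" using tsr by (simp add: image_image)
    then have "s' ` (r ` F) = s' ` F" using st' by simp
    then have rF: "r ` F = F" using \<open>inj s'\<close> by (simp add: inj_image_eq_iff)
    then have "t \<circ> s = s \<circ> ?r r" using st' tsr by (auto simp: fun_eq_iff)
    then show ?thesis using r rF by blast
  qed
qed

lemma (in rcc_set) half_block_complement:
  assumes "half_block S T F" shows "half_block S T (S - F)"
proof -
  have FS: "F \<subseteq> S" and c: "card S = 2 * card F" using assms by (auto simp: half_block_def)
  have "finite F" using FS fin finite_subset by blast
  then have c': "card S = 2 * card (S - F)" using FS c by (simp add: card_Diff_subset)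
  have "t ` (S - F) = S - F \<or> t ` (S - F) = S - (S - F)" if "t \<in> T" for t
  proof -
    have tp: "t permutes S" using that perm by blast
    then have "t ` (S - F) = S - t ` F" using permutes_image[OF tp] permutes_inj[OF tp] by (simp add: image_set_diff)
    moreover have "t ` F = F \<or> t ` F = S - F" using half_blockD[OF assms that] .
    ultimately show ?thesis by (elim disjE) simp_all
  qed
  then show ?thesis using c' by (simp add: half_block_def)
qed

text \<open>\<open>f\<close> follows the orbit of a translation by \<open>c\<close>, which is an
  arithmetic progression; the backward step cancels \<open>r\<close> by injectivity.\<close>

lemma (in coordinates) affine_progression:
  assumes r: "inj r" "\<And>y. r (\<kappa> b y) = \<kappa> b (y + c)" and f: "\<And>x. f (x + 1) = r (f x)" and 0: "f 0 = \<kappa> b u"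
  shows "f x = \<kappa> b (c * x + u)"
proof (induction x rule: int_induct[where k = 0])
  case base
  show ?case using 0 by simp
next
  case (step1 i)
  then show ?case using f[of i] r(2) by (simp add: algebra_simps)
next
  case (step2 i)
  have "r (f (i - 1)) = f i" using f[of "i - 1"] by simp
  also have "\<dots> = r (\<kappa> b (c * (i - 1) + u))" using step2.IH r(2) by (simp add: algebra_simps)
  finally show ?case using r(1) by (auto dest: injD)
qed

lemma (in rcc_set) ex_coordinates:
  assumes p: "prime p" and S: "card S = 2 * p"
  obtains \<kappa> where "coordinates p S \<kappa>"
    "\<And>t. t \<in> T \<Longrightarrow> (\<exists>i j. aff \<kappa> False 1 i 1 j t) \<or> (\<exists>a u b v. aff \<kappa> True a u b v t)"
proof -
  obtain F where F: "half_block S T F" using ex_half_block[OF p S] by blast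
  define R where "R G = (\<lambda>t x. if x \<in> G then t x else x) ` {t \<in> T. t ` G = G}" for G
  have FS: "F \<subseteq> S" and cF: "card F = p" using F S by (auto simp: half_block_def)
  have F': "half_block S T (S - F)" using half_block_complement[OF F] .
  have cG: "card (S - F) = p" using F' S by (auto simp: half_block_def)
  interpret F: rcc_set F "R F" unfolding R_def using restrict_block[OF F] .
  interpret G: rcc_set "S - F" "R (S - F)" unfolding R_def using restrict_block[OF F'] .
  obtain f where f: "\<And>i j. f i = f j \<longleftrightarrow> [i = j] (mod int p)" "range f = F"
    "\<And>t. t \<in> R F \<Longrightarrow> \<exists>i. \<forall>x. t (f x) = f (x + i)"
    using F.prime_degree[OF p cF] by blast
  obtain g where g: "\<And>i j. g i = g j \<longleftrightarrow> [i = j] (mod int p)" "range g = S - F"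
    "\<And>t. t \<in> R (S - F) \<Longrightarrow> \<exists>i. \<forall>x. t (g x) = g (x + i)"
    using G.prime_degree[OF p cG] by blast
  define \<kappa> where "\<kappa> b = (if b then g else f)" for b
  have kF: "\<kappa> False x \<in> F" and kG: "\<kappa> True x \<in> S - F" for x using f(2) g(2) by (auto simp: \<kappa>_def)
  interpret coordinates p S \<kappa>
  proof
    show "prime p" by (rule p)
    show "\<kappa> b x = \<kappa> c y \<longleftrightarrow> b = c \<and> [x = y] (mod int p)" for b x c y
    proof (cases "b = c")
      case True
      then show ?thesis by (simp add: \<kappa>_def f(1) g(1))
    next
      case False
      then show ?thesis using kF[of x] kF[of y] kG[of x] kG[of y] by (cases b; cases c) auto
    qed
    have S_eq: "S = range f \<union> range g" using f(2) g(2) FS by blast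
    show "S = {\<kappa> b x | b x. True}"
    proof (intro equalityI subsetI)
      fix y assume "y \<in> S"
      then consider "y \<in> range (\<kappa> False)" | "y \<in> range (\<kappa> True)"
        unfolding S_eq by (auto simp: \<kappa>_def)
      then show "y \<in> {\<kappa> b x | b x. True}"
      proof cases
        case 1
        then show ?thesis by blast
      next
        case 2
        then show ?thesis by blast
      qed
    next
      fix y assume "y \<in> {\<kappa> b x | b x. True}"
      then obtain b x where "y = \<kappa> b x" by blast
      then show "y \<in> S" using kF[of x] kG[of x] FS by (cases b) auto
    qed
  qed
  have swap_absurd: False if "s ` F = S - F" "s ` (S - F) = F" "s (\<kappa> b x) = \<kappa> b y" for s b x y
  proof (cases b)
    case True
    have "\<kappa> b x \<in> S - F" "\<kappa> b y \<notin> F" using kG[of x] kG[of y] True by simp_all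
    then show False using that(2,3) by (metis imageI)
  next
    case False
    have "\<kappa> b x \<in> F" "\<kappa> b y \<notin> S - F" using kF[of x] kF[of y] False by simp_all
    then show False using that(1,3) by (metis imageI)
  qed
  have stab: "\<exists>i j. aff \<kappa> False 1 i 1 j t" if t: "t \<in> T" "t ` F = F" for t
  proof -
    have tp: "t permutes S" using t perm by blast
    have "t ` (S - F) = S - F"
      using permutes_image[OF tp] permutes_inj[OF tp] t(2) by (simp add: image_set_diff)
    then have "(\<lambda>x. if x \<in> S - F then t x else x) \<in> R (S - F)" "(\<lambda>x. if x \<in> F then t x else x) \<in> R F"
      using t unfolding R_def by blast+
    then obtain i j where "\<forall>x. (if f x \<in> F then t (f x) else f x) = f (x + i)"
       "\<forall>x. (if g x \<in> S - F then t (g x) else g x) = g (x + j)" using f(3) g(3) by blast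
    moreover have "f x \<in> F" "g x \<in> S - F" for x using f(2) g(2) by auto
    ultimately show ?thesis by (auto simp: aff_def \<kappa>_def)
  qed
  have swap: "\<exists>a u b v. aff \<kappa> True a u b v t" if t: "t \<in> T" "t ` F = S - F" for t
  proof -
    have tp: "t permutes S" using t perm by blast
    have tG: "t ` (S - F) = F"
      using permutes_image[OF tp] permutes_inj[OF tp] t(2) FS by (simp add: image_set_diff) blast
    \<comment> \<open>Take \<open>s\<close> in \<open>T\<close> that translates block
      \<open>b\<close> by 1. Its conjugate by \<open>t\<close> lies in \<open>T\<close> and acts on
      the other block as a translation, so \<open>t\<close> carries one arithmetic progression to
      another and is affine.\<close>
    have one: "\<exists>c u. \<forall>x. t (\<kappa> b x) = \<kappa> (\<not> b) (c * x + u)" for b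
    proof -
      obtain s where s: "s \<in> T" "s (\<kappa> b 0) = \<kappa> b 1" using transitive kappa_in by blast
      have "s ` F = F"
      proof (rule ccontr)
        assume "s ` F \<noteq> F"
        then have sF: "s ` F = S - F" using half_blockD[OF F s(1)] by blast
        have sp: "s permutes S" using s perm by blast
        have "s ` (S - F) = F"
          using permutes_image[OF sp] permutes_inj[OF sp] sF FS by (simp add: image_set_diff) blast
        then show False using swap_absurd[OF sF _ s(2)] by blast
      qed
      then obtain i j where ij: "aff \<kappa> False 1 i 1 j s" using stab s(1) by blast
      have s1: "s (\<kappa> b x) = \<kappa> b (x + 1)" for x
      proof -
        define k where "k = (if b then j else i)"
        have sk: "s (\<kappa> b x) = \<kappa> b (x + k)" for x using ij by (cases b) (simp_all add: aff_def k_def)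
        have "[k = 1] (mod int p)" using sk[of 0] s(2) by (simp add: kappa_eq cong_sym_eq)
        then show ?thesis using sk[of x] by (simp add: kappa_eq cong_add_lcancel)
      qed
      have step: "conj_by t s (t (\<kappa> b x)) = t (\<kappa> b (x + 1))" for x
        using conj_by_apply[OF tp] s1 by metis
      have tb: "\<exists>y. t (\<kappa> b x) = \<kappa> (\<not> b) y" for x
      proof (cases b)
        case True
        then have "\<kappa> b x \<in> S - F" using kG[of x] by simp
        then have "t (\<kappa> b x) \<in> range f" unfolding f(2) using tG by (metis imageI)
        then show ?thesis using True by (auto simp: \<kappa>_def)
      next
        case False
        then have "\<kappa> b x \<in> F" using kF[of x] by simp
        then have "t (\<kappa> b x) \<in> range g" unfolding g(2) using t(2) by (metis imageI)
        then show ?thesis using False by (auto simp: \<kappa>_def)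
      qed
      have rT: "conj_by t s \<in> T" using in_normalizes[OF t(1)] s(1) by (auto simp: normalizes_def)
      have rp: "conj_by t s permutes S" using rT perm by blast
      obtain u u' where u: "t (\<kappa> b 0) = \<kappa> (\<not> b) u" and u': "t (\<kappa> b 1) = \<kappa> (\<not> b) u'" using tb by metis
      have ru: "conj_by t s (\<kappa> (\<not> b) u) = \<kappa> (\<not> b) u'" using step[of 0] u u' by simp
      have "conj_by t s ` F = F"
      proof (rule ccontr)
        assume "conj_by t s ` F \<noteq> F"
        then have sF: "conj_by t s ` F = S - F" using half_blockD[OF F rT] by blast
        have "conj_by t s ` (S - F) = F"
          using permutes_image[OF rp] permutes_inj[OF rp] sF FS by (simp add: image_set_diff) blast
        then show False using swap_absurd[OF sF _ ru] by blast
      qed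
      then obtain k l where kl: "aff \<kappa> False 1 k 1 l (conj_by t s)" using stab rT by blast
      define c where "c = (if b then k else l)"
      have "conj_by t s (\<kappa> (\<not> b) y) = \<kappa> (\<not> b) (y + c)" for y using kl by (cases b) (simp_all add: aff_def c_def)
      then have "t (\<kappa> b x) = \<kappa> (\<not> b) (c * x + u)" for x
        using affine_progression[OF permutes_inj[OF rp], of "\<not> b" c "\<lambda>x. t (\<kappa> b x)" u x] step u by simp
      then show ?thesis by blast
    qed
    obtain a u where "\<forall>x. t (\<kappa> False x) = \<kappa> True (a * x + u)" using one[of False] by auto
    moreover obtain b v where "\<forall>x. t (\<kappa> True x) = \<kappa> False (b * x + v)" using one[of True] by auto
    ultimately show ?thesis unfolding aff_def by auto
  qed
  have "(\<exists>i j. aff \<kappa> False 1 i 1 j t) \<or> (\<exists>a u b v. aff \<kappa> True a u b v t)" if "t \<in> T" for t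
    using stab[OF that] swap[OF that] half_blockD[OF F that] by blast
  then show thesis using that coordinates_axioms by blast
qed

context rcc_coords
begin

lemma conj_by_in_T: "s \<in> T \<Longrightarrow> t \<in> T \<Longrightarrow> conj_by s t \<in> T"
  using in_normalizes by (auto simp: normalizes_def)

lemma ex_aff_cong:
  assumes "\<exists>t\<in>T. aff \<kappa> s a u b v t"
    "[a = a'] (mod int p)" "[u = u'] (mod int p)" "[b = b'] (mod int p)" "[v = v'] (mod int p)"
  shows "\<exists>t\<in>T. aff \<kappa> s a' u' b' v' t"
  using assms aff_cong by blast

lemma ex_multiple: "\<not> int p dvd D \<Longrightarrow> \<exists>n. [c = u + int n * D] (mod int p)"
proof -
  assume "\<not> int p dvd D"
  then obtain D' where D': "[D * D' = 1] (mod int p)" using inverse_mod by blast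
  define n where "n = nat (((c - u) * D') mod int p)"
  have "[int n = (c - u) * D'] (mod int p)" using p0 by (simp add: n_def)
  then have "[c = u + int n * D] (mod int p)"
    using D' by (rule cong_comb2[where k = "- D" and l = "u - c"]) (simp add: algebra_simps)
  then show ?thesis by blast
qed

text \<open>Conjugation acts on a swap \<open>(u, v)\<close> by adding \<open>(D, E)\<close>; if \<open>D\<close> is invertible, the multiples of \<open>D\<close>
  exhaust the residues, and by sharp transitivity all swaps in \<open>T\<close> arise in this way.\<close>

lemma iterate_swap:
  assumes t: "\<exists>t\<in>T. aff \<kappa> True a u b v t"
    and step: "\<And>n. \<exists>t\<in>T. aff \<kappa> True a (u + int n * D) b (v + int n * E) t \<Longrightarrow>
                 \<exists>t\<in>T. aff \<kappa> True a (u + int n * D + D) b (v + int n * E + E) t"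
    and D: "\<not> int p dvd D" and E: "[E = \<rho> * D] (mod int p)"
  shows "\<exists>t\<in>T. aff \<kappa> True a w b (v + \<rho> * (w - u)) t"
proof -
  have all: "\<exists>t\<in>T. aff \<kappa> True a (u + int n * D) b (v + int n * E) t" for n
  proof (induction n)
    case (Suc n)
    then show ?case using step[of n] by (simp add: algebra_simps)
  qed (use t in simp)
  obtain n where n: "[w = u + int n * D] (mod int p)" using ex_multiple[OF D] by blast
  have "[v + int n * E = v + \<rho> * (w - u)] (mod int p)"
    by (rule cong_comb2[OF E n, where k = "int n" and l = "- \<rho>"]) (simp add: algebra_simps)
  then show ?thesis using n by (intro ex_aff_cong[OF all[of n]]) (simp_all add: cong_sym_eq)
qed

lemma rescaled:
  assumes "\<not> int p dvd c"
  shows "rcc_coords p S T (\<lambda>b x. \<kappa> b (if b then c * x + e else x + f))"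
  using coordinates_rescale[OF assms] rcc_set_axioms by (simp add: rcc_coords_def)

text \<open>Scaling block \<open>True\<close> by \<open>a\<close> multiplies both slopes by
  \<open>b\<close> or \<open>a\<close> to \<open>a * b\<close>, which is 1, and replaces
  \<open>\<sigma> i\<close> by \<open>b * \<sigma> i\<close>.\<close>

lemma TB_of_scale:
  assumes 0: "\<And>i. \<exists>t\<in>T. aff \<kappa> False 1 i 1 (\<sigma> i) t"
    and 1: "\<And>u. \<exists>t\<in>T. aff \<kappa> True a u b (v0 - b * u) t" and ab: "[a * b = 1] (mod int p)"
    and \<tau>: "invol0 p (\<lambda>i. b * \<sigma> i)"
  obtains \<kappa>' \<tau> d where "coordinates p S \<kappa>'" "invol0 p \<tau>" "T = TB S \<kappa>' \<tau> d"
proof -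
  have na: "\<not> int p dvd a"
  proof
    assume "int p dvd a"
    then have "int p dvd a * b" by simp
    then have "int p dvd 1" using ab by (simp add: cong_dvd_iff)
    then show False using one_ndvd by blast
  qed
  define \<kappa>' where "\<kappa>' = (\<lambda>c x. \<kappa> c (if c then a * x + 0 else x + 0))"
  interpret K: rcc_coords p S T \<kappa>' unfolding \<kappa>'_def by (rule rescaled[OF na])
  have "T = TB S \<kappa>' (\<lambda>i. b * \<sigma> i) v0"
  proof (rule K.eq_TB)
    show "\<exists>t\<in>T. aff \<kappa>' False 1 i 1 (b * \<sigma> i) t" for i
      using 0[of i] aff_scale(1)[OF ab] unfolding \<kappa>'_def by blast
    show "\<exists>t\<in>T. aff \<kappa>' True 1 w 1 (v0 - w) t" for w
    proof -
      obtain t where t: "t \<in> T" "aff \<kappa> True a (a * w) b (v0 - b * (a * w)) t" using 1 by blast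
      have "aff \<kappa>' True (b * a) (b * (a * w)) (b * a) (v0 - b * (a * w)) t"
        using aff_scale(2)[OF ab t(2)] unfolding \<kappa>'_def .
      moreover have "[b * (a * w) = w] (mod int p)"
        by (rule cong_comb[OF ab, where k = w]) (simp add: algebra_simps)
      moreover have "[v0 - b * (a * w) = v0 - w] (mod int p)"
        by (rule cong_comb[OF ab, where k = "- w"]) (simp add: algebra_simps)
      moreover have "[b * a = 1] (mod int p)" using ab by (simp add: mult.commute)
      ultimately show ?thesis using K.aff_cong t(1) by blast
    qed
  qed
  then show thesis using that \<tau> K.coordinates_axioms by blast
qed

text \<open>The two parameters of a swap differ by the constant \<open>v0\<close>. For
  \<open>a\<close> different from \<open>- 1\<close> a translation of block \<open>False\<close>
  removes it; for \<open>a = - 1\<close> reflecting block \<open>True\<close> makes the slopes 1 and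
  turns the identity on shifts into negation.\<close>

lemma TA_or_TB_of_id:
  assumes 0: "\<And>i. \<exists>t\<in>T. aff \<kappa> False 1 i 1 i t"
    and 1: "\<And>u. \<exists>t\<in>T. aff \<kappa> True a u a (v0 + u) t"
  shows "(\<exists>\<kappa>' a. coordinates p S \<kappa>' \<and> a \<in> {1..int p - 2} \<and> T = TA S \<kappa>' a) \<or>
    (\<exists>\<kappa>' \<tau> d. coordinates p S \<kappa>' \<and> invol0 p \<tau> \<and> T = TB S \<kappa>' \<tau> d)"
proof (cases "int p dvd a + 1")
  case True
  then have am: "[a = -1] (mod int p)" by (simp add: cong_iff_dvd_diff)
  have inv: "invol0 p (\<lambda>i. (-1) * i)" by (simp add: invol0_def cong_minus_minus_iff)
  have "\<exists>t\<in>T. aff \<kappa> True (-1) u (-1) (v0 - (-1) * u) t" for u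
    by (rule ex_aff_cong[OF 1[of u] am _ am]) simp_all
  from TB_of_scale[of "\<lambda>i. i" "-1" "-1" v0, OF 0 this _ inv] show ?thesis by auto
next
  case False
  then obtain c where c: "[(a + 1) * c = 1] (mod int p)" using inverse_mod by blast
  \<comment> \<open>Translating block \<open>False\<close> by \<open>f\<close> changes the
    difference of the swap parameters by \<open>- (a + 1) * f\<close>, so \<open>f\<close> has to
    solve \<open>(a + 1) * f = v0\<close>.\<close>
  define f where "f = v0 * c"
  define \<kappa>' where "\<kappa>' = (\<lambda>b x. \<kappa> b (if b then 1 * x + 0 else x + f))"
  interpret K: rcc_coords p S T \<kappa>' unfolding \<kappa>'_def by (rule rescaled[OF one_ndvd])
  define a' where "a' = a mod int p"
  have aa: "[a = a'] (mod int p)" by (simp add: a'_def)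
  obtain t0 where t0: "t0 \<in> T" "aff \<kappa> True a 0 a (v0 + 0) t0" using 1 by blast
  then have "\<not> int p dvd a" using aff_coprime perm by blast
  then have "a' \<noteq> 0" by (simp add: a'_def dvd_eq_mod_eq_0)
  moreover have "0 \<le> a'" "a' < int p" using p0 by (simp_all add: a'_def)
  moreover have "a' \<noteq> int p - 1"
  proof
    assume "a' = int p - 1"
    then have "[a = int p - 1] (mod int p)" using aa by simp
    then have "int p dvd (a + 1) - int p" by (simp add: cong_iff_dvd_diff algebra_simps)
    then show False using False by (simp add: dvd_diff_left_iff)
  qed
  ultimately have a': "a' \<in> {1..int p - 2}" by auto
  have "T = TA S \<kappa>' a'"
  proof (rule K.eq_TA)
    show "\<exists>t\<in>T. aff \<kappa>' False 1 i 1 i t" for i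
      using 0[of i] aff_shift(1) unfolding \<kappa>'_def by blast
    show "\<exists>t\<in>T. aff \<kappa>' True a' w a' w t" for w
    proof -
      obtain t where t: "t \<in> T" "aff \<kappa> True a (w - a * f) a (v0 + (w - a * f)) t" using 1 by blast
      have aff': "aff \<kappa>' True a (a * f + (w - a * f)) a (v0 + (w - a * f) - f) t"
        using aff_shift(2)[OF t(2)] unfolding \<kappa>'_def .
      moreover have "[v0 + (w - a * f) - f = w] (mod int p)"
        by (rule cong_comb[OF c, where k = "- v0"]) (simp add: f_def algebra_simps)
      ultimately have "aff \<kappa>' True a' w a' w t" by (intro K.aff_cong[OF aff' aa _ aa]) simp_all
      then show ?thesis using t(1) by blast
    qed
  qed
  then show ?thesis using a' K.coordinates_axioms by blast
qed

text \<open>With the same translation on both blocks, three cases remain. A slope other than 1 lets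
  shifts generate all swaps; if all slopes are 1 and the difference of parameters varies, products
  of two swaps do so; if it is constant, the swaps already have the required form.\<close>

lemma classify_id:
  assumes 0: "\<And>i. \<exists>t\<in>T. aff \<kappa> False 1 i 1 i t"
    and sw: "\<And>t u. t \<in> T \<Longrightarrow> t (\<kappa> False 0) = \<kappa> True u \<Longrightarrow> \<exists>a b v. aff \<kappa> True a u b v t"
  shows "(\<exists>\<kappa>' a. coordinates p S \<kappa>' \<and> a \<in> {1..int p - 2} \<and> T = TA S \<kappa>' a) \<or>
    (\<exists>\<kappa>' \<tau> d. coordinates p S \<kappa>' \<and> invol0 p \<tau> \<and> T = TB S \<kappa>' \<tau> d)"
    (is ?goal)
proof -
  have swap_ex: "\<exists>t\<in>T. \<exists>a b v. aff \<kappa> True a u b v t" for u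
  proof -
    obtain t where t: "t \<in> T" "t (\<kappa> False 0) = \<kappa> True u" using transitive kappa_in by blast
    show ?thesis using sw[OF t] t(1) by blast
  qed
  \<comment> \<open>Conjugating the shift by 1 with a swap gives the shift by \<open>(b, a)\<close>,
    and shifts have equal entries.\<close>
  have rel: "[b = a] (mod int p)" if t: "t \<in> T" "aff \<kappa> True a u b v t" for t a u b v
  proof -
    obtain s where s: "s \<in> T" "aff \<kappa> False 1 1 1 1 s" using 0 by blast
    obtain r where r: "r \<in> T" "aff \<kappa> False 1 (b * 1) 1 (b * 1) r" using 0 by blast
    have c: "conj_by t s \<in> T" "aff \<kappa> False 1 (b * 1) 1 (a * 1) (conj_by t s)"
      using conj_by_in_T[OF t(1) s(1)] conj_swap_shift[OF perm[OF s(1)] perm[OF t(1)] s(2) t(2)] by auto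
    have "r = conj_by t s"
      using sharp[OF r(1) c(1) kappa_in[of False 0]] aff_False[OF r(2)] aff_False[OF c(2)] by simp
    then show ?thesis using aff_params(5)[OF r(2)] c(2) by simp
  qed
  show ?goal
  proof (cases "\<exists>t\<in>T. \<exists>a u b v. aff \<kappa> True a u b v t \<and> \<not> [a = 1] (mod int p)")
    case True
    then obtain t a u b v where t: "t \<in> T" "aff \<kappa> True a u b v t" and a: "\<not> [a = 1] (mod int p)" by blast
    have ba: "[b = a] (mod int p)" using rel t by blast
    have ta: "aff \<kappa> True a u a v t" by (rule aff_cong[OF t(2) _ _ ba]) simp_all
    obtain s where s: "s \<in> T" "aff \<kappa> False 1 1 1 1 s" using 0 by blast
    \<comment> \<open>Conjugation by the shift \<open>s\<close> adds \<open>1 - a\<close> to both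
      parameters of a swap.\<close>
    have D: "\<not> int p dvd (1 - a)" using a by (simp add: cong_iff_dvd_diff dvd_diff_commute)
    have "\<exists>t\<in>T. aff \<kappa> True a w a (v + 1 * (w - u)) t" for w
    proof (rule iterate_swap[OF _ _ D])
      show "\<exists>t\<in>T. aff \<kappa> True a u a v t" using ta t(1) by blast
      show "[1 - a = 1 * (1 - a)] (mod int p)" by simp
      fix n :: nat
      assume "\<exists>t\<in>T. aff \<kappa> True a (u + int n * (1 - a)) a (v + int n * (1 - a)) t"
      then obtain r where r: "r \<in> T" "aff \<kappa> True a (u + int n * (1 - a)) a (v + int n * (1 - a)) r" by blast
      show "\<exists>t\<in>T. aff \<kappa> True a (u + int n * (1 - a) + (1 - a)) a (v + int n * (1 - a) + (1 - a)) t"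
        using conj_shift_swap[OF perm[OF s(1)] perm[OF r(1)] s(2) r(2)] conj_by_in_T[OF s(1) r(1)]
        by (intro bexI[of _ "conj_by s r"]) (simp_all add: add_diff_eq)
    qed
    moreover have "v + 1 * (w - u) = (v - u) + w" for w by simp
    ultimately have "\<exists>t\<in>T. aff \<kappa> True a w a ((v - u) + w) t" for w by metis
    then show ?thesis by (rule TA_or_TB_of_id[OF 0])
  next
    case False
    have "\<exists>w. \<exists>t\<in>T. aff \<kappa> True 1 u 1 w t" for u
    proof -
      obtain t a b v where t: "t \<in> T" "aff \<kappa> True a u b v t" using swap_ex by blast
      then have "[a = 1] (mod int p)" "[b = 1] (mod int p)" using False rel cong_trans by blast+
      then have "aff \<kappa> True 1 u 1 v t" using aff_cong[OF t(2)] by simp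
      then show ?thesis using t(1) by blast
    qed
    then obtain f where f: "\<And>u. \<exists>t\<in>T. aff \<kappa> True 1 u 1 (f u) t" by metis
    show ?thesis
    proof (cases "\<exists>u. \<not> [f u - u = f 0] (mod int p)")
      case True
      then obtain u where u: "\<not> [f u - u = f 0] (mod int p)" by blast
      define D where "D = f u - u - f 0"
      have D: "\<not> int p dvd D" using u by (simp add: D_def cong_iff_dvd_diff)
      obtain t1 where t1: "t1 \<in> T" "aff \<kappa> True 1 u 1 (f u) t1" using f by blast
      obtain t2 where t2: "t2 \<in> T" "aff \<kappa> True 1 0 1 (f 0) t2" using f by blast
      have "\<exists>t\<in>T. aff \<kappa> True 1 w 1 (f 0 + (-1) * (w - 0)) t" for w
      proof (rule iterate_swap[OF f _ D])
        show "[- D = - 1 * D] (mod int p)" by simp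
        fix n :: nat
        assume "\<exists>t\<in>T. aff \<kappa> True 1 (0 + int n * D) 1 (f 0 + int n * - D) t"
        then obtain r where r: "r \<in> T" "aff \<kappa> True 1 (0 + int n * D) 1 (f 0 + int n * - D) r" by blast
        \<comment> \<open>Conjugation by one swap exchanges the two parameters; a second one
          restores their order, and together they add \<open>(D, - D)\<close>.\<close>
        note c1 = conj_swap_swap[OF perm[OF t1(1)] perm[OF r(1)] t1(2) r(2)] conj_by_in_T[OF t1(1) r(1)]
        note c2 = conj_swap_swap[OF perm[OF t2(1)] perm[OF c1(2)] t2(2) c1(1)] conj_by_in_T[OF t2(1) c1(2)]
        show "\<exists>t\<in>T. aff \<kappa> True 1 (0 + int n * D + D) 1 (f 0 + int n * - D + - D) t"
          using c2 by (intro bexI[of _ "conj_by t2 (conj_by t1 r)"]) (simp_all add: D_def algebra_simps)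
      qed
      then have "\<exists>t\<in>T. aff \<kappa> True 1 w 1 (f 0 - w) t" for w by simp
      then have "T = TB S \<kappa> (\<lambda>i. i) (f 0)" by (rule eq_TB[OF 0])
      moreover have "invol0 p (\<lambda>i. i)" by (simp add: invol0_def)
      ultimately show ?thesis using coordinates_axioms by blast
    next
      case const: False
      have "\<exists>t\<in>T. aff \<kappa> True 1 u 1 (f 0 + u) t" for u
      proof -
        have "[f u - u = f 0] (mod int p)" using const by blast
        then have "[f u = f 0 + u] (mod int p)" by (rule cong_comb[where k = 1]) simp
        then show ?thesis by (intro ex_aff_cong[OF f[of u]]) simp_all
      qed
      then show ?thesis by (rule TA_or_TB_of_id[OF 0])
    qed
  qed
qed

text \<open>The function \<open>\<sigma>\<close> pairs the translations of the two blocks. If it is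
  linear, scaling one block turns it into the identity. If not, the shifts generate all swaps from
  one; comparing the results for different shifts would make \<open>\<sigma>\<close> linear unless
  the coefficients vanish, and this fixes \<open>\<rho> = - b\<close> and
  \<open>a * b = 1\<close>.\<close>

lemma classify:
  assumes sw: "\<And>t. t \<in> T \<Longrightarrow> (\<exists>i j. aff \<kappa> False 1 i 1 j t) \<or> (\<exists>a u b v. aff \<kappa> True a u b v t)"
  shows "(\<exists>\<kappa>' a. coordinates p S \<kappa>' \<and> a \<in> {1..int p - 2} \<and> T = TA S \<kappa>' a) \<or>
    (\<exists>\<kappa>' \<tau> d. coordinates p S \<kappa>' \<and> invol0 p \<tau> \<and> T = TB S \<kappa>' \<tau> d)"
    (is ?goal)
proof -
  have "\<exists>j. \<exists>t\<in>T. aff \<kappa> False 1 i 1 j t" for i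
  proof -
    obtain t where t: "t \<in> T" "t (\<kappa> False 0) = \<kappa> False i" using transitive kappa_in by blast
    have "\<not> aff \<kappa> True a u b v t" for a u b v using t(2) by (auto simp: aff_def kappa_eq)
    then obtain i' j where "aff \<kappa> False 1 i' 1 j t" using sw[OF t(1)] by blast
    moreover from this have "[i' = i] (mod int p)" using t(2) by (simp add: aff_def kappa_eq)
    ultimately have "aff \<kappa> False 1 i 1 j t" by (rule aff_cong[OF _ cong_refl _ cong_refl cong_refl])
    then show ?thesis using t(1) by blast
  qed
  then obtain \<sigma> where \<sigma>: "\<And>i. \<exists>t\<in>T. aff \<kappa> False 1 i 1 (\<sigma> i) t" by metis
  have \<sigma>_unique: "[j = \<sigma> i] (mod int p)" if "t \<in> T" "aff \<kappa> False 1 i 1 j t" for t i j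
  proof -
    obtain r where r: "r \<in> T" "aff \<kappa> False 1 i 1 (\<sigma> i) r" using \<sigma> by blast
    then have "r = t" using sharp[OF r(1) that(1) kappa_in[of False 0]] that(2) by (simp add: aff_def)
    then show ?thesis using aff_params(5) that r by blast
  qed
  have \<sigma>_cong: "[\<sigma> i = \<sigma> j] (mod int p)" if "[i = j] (mod int p)" for i j
  proof -
    obtain t where t: "t \<in> T" "aff \<kappa> False 1 i 1 (\<sigma> i) t" using \<sigma> by blast
    have "aff \<kappa> False 1 j 1 (\<sigma> i) t" by (rule aff_cong[OF t(2) _ that]) simp_all
    then show ?thesis using \<sigma>_unique t(1) by blast
  qed
  have \<sigma>0: "[\<sigma> 0 = 0] (mod int p)"
    using \<sigma>_unique[OF id_in, of 0 0] by (simp add: aff_def cong_sym_eq)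
  have swap_ex: "\<exists>t\<in>T. \<exists>a u b v. aff \<kappa> True a u b v t"
  proof -
    obtain t where t: "t \<in> T" "t (\<kappa> False 0) = \<kappa> True 0" using transitive kappa_in by blast
    have "\<not> aff \<kappa> False a u b v t" for a u b v using t(2) by (auto simp: aff_def kappa_eq)
    then show ?thesis using sw[OF t(1)] t(1) by blast
  qed
  have rel: "[\<sigma> (b * \<sigma> i) = a * i] (mod int p)" if "t \<in> T" "aff \<kappa> True a u b v t" for t a u b v i
  proof -
    obtain s where s: "s \<in> T" "aff \<kappa> False 1 i 1 (\<sigma> i) s" using \<sigma> by blast
    show ?thesis using \<sigma>_unique[OF conj_by_in_T[OF that(1) s(1)]]
        conj_swap_shift[OF perm[OF s(1)] perm[OF that(1)] s(2) that(2)] by (metis cong_sym)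
  qed
  have step: "\<exists>r\<in>T. aff \<kappa> True a (u + (\<sigma> i - a * i)) b (v + (i - b * \<sigma> i)) r"
    if ex: "\<exists>t\<in>T. aff \<kappa> True a u b v t" for a u b v i
  proof -
    obtain s where s: "s \<in> T" "aff \<kappa> False 1 i 1 (\<sigma> i) s" using \<sigma> by blast
    obtain t where t: "t \<in> T" "aff \<kappa> True a u b v t" using ex by blast
    show ?thesis using conj_shift_swap[OF perm[OF s(1)] perm[OF t(1)] s(2) t(2)]
        conj_by_in_T[OF s(1) t(1)] by (metis add_diff_eq)
  qed
  show ?goal
  proof (cases "\<exists>l. \<forall>i. [\<sigma> i = l * i] (mod int p)")
    case False
    obtain a u b v where t: "\<exists>t\<in>T. aff \<kappa> True a u b v t" using swap_ex by blast
    \<comment> \<open>Nonlinearity provides a shift whose conjugation really moves the first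
      parameter of the given swap.\<close>
    obtain i0 where i0: "\<not> [\<sigma> i0 = a * i0] (mod int p)" using False by blast
    define D where "D = \<sigma> i0 - a * i0"
    have D: "\<not> int p dvd D" using i0 by (simp add: D_def cong_iff_dvd_diff)
    obtain D' where D': "[D * D' = 1] (mod int p)" using inverse_mod[OF D] by blast
    define E where "E = i0 - b * \<sigma> i0"
    define \<rho> where "\<rho> = E * D'"
    have E: "[E = \<rho> * D] (mod int p)" by (rule cong_comb[OF D', where k = "- E"]) (simp add: \<rho>_def algebra_simps)
    have st: "\<exists>t\<in>T. aff \<kappa> True a w b (v + \<rho> * (w - u)) t" for w
      by (rule iterate_swap[OF t _ D E]) (use step[of a _ b _ i0] in \<open>simp add: D_def E_def\<close>)
    have uniq: "[y = v + \<rho> * (w - u)] (mod int p)" if "t \<in> T" "aff \<kappa> True a w b y t" for t w y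
    proof -
      obtain r where r: "r \<in> T" "aff \<kappa> True a w b (v + \<rho> * (w - u)) r" using st by blast
      then have "r = t" using sharp[OF r(1) that(1) kappa_in[of False 0]] that(2) by (simp add: aff_def)
      then show ?thesis using aff_params(5) that r by blast
    qed
    \<comment> \<open>Conjugating by the shift with any \<open>i\<close> must again land on the line
      \<open>v + \<rho> * (w - u)\<close>.\<close>
    have lin: "[(1 + \<rho> * a) * i = (\<rho> + b) * \<sigma> i] (mod int p)" for i
    proof -
      have "[v + (i - b * \<sigma> i) = v + \<rho> * (u + (\<sigma> i - a * i) - u)] (mod int p)"
        using step[OF t, of i] uniq by blast
      then show ?thesis by (rule cong_comb[where k = 1]) (simp add: algebra_simps)
    qed
    have \<rho>b: "int p dvd \<rho> + b"
    proof (rule ccontr)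
      assume "\<not> int p dvd \<rho> + b"
      then obtain c where c: "[(\<rho> + b) * c = 1] (mod int p)" using inverse_mod by blast
      have "[\<sigma> i = (c * (1 + \<rho> * a)) * i] (mod int p)" for i
        by (rule cong_comb2[OF lin[of i] c, where k = "- c" and l = "- \<sigma> i"]) (simp add: algebra_simps)
      then show False using False by blast
    qed
    then have \<rho>b': "[\<rho> = - b] (mod int p)" by (simp add: cong_iff_dvd_diff)
    have "[1 + \<rho> * a = (\<rho> + b) * \<sigma> 1] (mod int p)" using lin[of 1] by simp
    then have ab: "[a * b = 1] (mod int p)"
      using \<rho>b' by (rule cong_comb2[where k = "-1" and l = "a - \<sigma> 1"]) (simp add: algebra_simps)
    have 1: "\<exists>t\<in>T. aff \<kappa> True a w b ((v + b * u) - b * w) t" for w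
    proof -
      have "[v + \<rho> * (w - u) = (v + b * u) - b * w] (mod int p)"
        by (rule cong_comb[OF \<rho>b', where k = "w - u"]) (simp add: algebra_simps)
      then show ?thesis by (intro ex_aff_cong[OF st[of w]]) simp_all
    qed
    have "invol0 p (\<lambda>i. b * \<sigma> i)" unfolding invol0_def
    proof (intro conjI allI impI)
      show "[b * \<sigma> i = b * \<sigma> j] (mod int p)" if "[i = j] (mod int p)" for i j
        using \<sigma>_cong[OF that] by (rule cong_scalar_left)
      show "[b * \<sigma> 0 = 0] (mod int p)" using \<sigma>0 by (metis cong_scalar_left mult_zero_right)
      show "[b * \<sigma> (b * \<sigma> i) = i] (mod int p)" for i
      proof -
        obtain r where "r \<in> T" "aff \<kappa> True a u b v r" using t by blast
        then have "[\<sigma> (b * \<sigma> i) = a * i] (mod int p)" using rel by blast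
        then show ?thesis using ab by (rule cong_comb2[where k = b and l = i]) (simp add: algebra_simps)
      qed
    qed
    then obtain \<kappa>' \<tau> d where "coordinates p S \<kappa>'" "invol0 p \<tau>" "T = TB S \<kappa>' \<tau> d"
      by (rule TB_of_scale[OF \<sigma> 1 ab])
    then show ?thesis by (intro disjI2 exI conjI)
  next
    case True
    then obtain l where l: "\<And>i. [\<sigma> i = l * i] (mod int p)" by blast
    \<comment> \<open>If \<open>l\<close> vanished, the shifts with \<open>i = 1\<close> and
      \<open>i = 0\<close> would agree on block \<open>True\<close> but not on block
      \<open>False\<close>, against sharpness.\<close>
    have nl: "\<not> int p dvd l"
    proof
      assume "int p dvd l"
      then have "[l * 1 = 0] (mod int p)" by (simp add: cong_0_iff)
      then have s1: "[\<sigma> 1 = \<sigma> 0] (mod int p)" using l[of 1] \<sigma>0 by (metis cong_sym cong_trans)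
      obtain r where r: "r \<in> T" "aff \<kappa> False 1 1 1 (\<sigma> 1) r" using \<sigma> by blast
      obtain t where t: "t \<in> T" "aff \<kappa> False 1 0 1 (\<sigma> 0) t" using \<sigma> by blast
      have "r (\<kappa> True 0) = t (\<kappa> True 0)" using s1 r(2) t(2) by (simp add: aff_def kappa_eq)
      then have "r = t" using sharp[OF r(1) t(1) kappa_in] by blast
      then have "[1 = 0] (mod int p)" using aff_params(3) r(2) t(2) by blast
      then show False using one_ndvd by (simp add: cong_0_iff)
    qed
    obtain c where c: "[l * c = 1] (mod int p)" using inverse_mod[OF nl] by blast
    define \<kappa>' where "\<kappa>' = (\<lambda>b x. \<kappa> b (if b then l * x + 0 else x + 0))"
    interpret K: rcc_coords p S T \<kappa>' unfolding \<kappa>'_def by (rule rescaled[OF nl])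
    show ?thesis
    proof (rule K.classify_id)
      show "\<exists>t\<in>T. aff \<kappa>' False 1 i 1 i t" for i
      proof -
        obtain t where t: "t \<in> T" "aff \<kappa> False 1 i 1 (\<sigma> i) t" using \<sigma> by blast
        have aff': "aff \<kappa>' False 1 i 1 (c * \<sigma> i) t" using aff_scale(1)[OF c t(2)] unfolding \<kappa>'_def .
        moreover have "[c * \<sigma> i = i] (mod int p)"
          by (rule cong_comb2[OF l[of i] c, where k = c and l = i]) (simp add: algebra_simps)
        ultimately have "aff \<kappa>' False 1 i 1 i t" by (intro K.aff_cong[OF aff']) simp_all
        then show ?thesis using t(1) by blast
      qed
      show "\<exists>a b v. aff \<kappa>' True a u b v t" if t: "t \<in> T" "t (\<kappa>' False 0) = \<kappa>' True u" for t u
      proof -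
        have "\<not> aff \<kappa> False a u b v t" for a u b v using t(2) by (auto simp: aff_def kappa_eq \<kappa>'_def)
        then obtain a w b v where "aff \<kappa> True a w b v t" using sw[OF t(1)] by blast
        then have *: "aff \<kappa>' True (c * a) (c * w) (b * l) v t" using aff_scale(2)[OF c] unfolding \<kappa>'_def by blast
        then have "[c * w = u] (mod int p)" using t(2) by (simp add: aff_def K.kappa_eq)
        then have "aff \<kappa>' True (c * a) u (b * l) v t" using K.aff_cong[OF *] by simp
        then show ?thesis by blast
      qed
    qed
  qed
qed

end

theorem (in rcc_set) classification:
  assumes p: "prime p" and S: "card S = 2 * p"
  shows "(\<exists>\<kappa> a. coordinates p S \<kappa> \<and> a \<in> {1..int p - 2} \<and> T = TA S \<kappa> a) \<or>
    (\<exists>\<kappa> \<tau> d. coordinates p S \<kappa> \<and> invol0 p \<tau> \<and> T = TB S \<kappa> \<tau> d)"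
proof -
  obtain \<kappa> where \<kappa>: "coordinates p S \<kappa>"
    and sw: "\<And>t. t \<in> T \<Longrightarrow> (\<exists>i j. aff \<kappa> False 1 i 1 j t) \<or> (\<exists>a u b v. aff \<kappa> True a u b v t)"
    using ex_coordinates[OF p S] by blast
  interpret rcc_coords p S T \<kappa> using \<kappa> rcc_set_axioms by (simp add: rcc_coords_def)
  show ?thesis by (rule classify[OF sw])
qed

section \<open>The families consist of sharply transitive sets\<close>

context coordinates
begin

text \<open>\<open>c1\<close>, \<open>c2\<close> and \<open>c3\<close> are closure under conjugation
  written in parameters: of shifts by swaps, of swaps by shifts, and of swaps by swaps; shifts
  commute. The bijectivity of \<open>f\<close> and \<open>g\<close> gives sharp transitivity on
  block \<open>True\<close>.\<close>

lemma family_rcc: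
  assumes f: "\<And>i j. [f i = f j] (mod int p) \<longleftrightarrow> [i = j] (mod int p)" "\<And>y. \<exists>x. [f x = y] (mod int p)"
    and g: "\<And>i j. [g i = g j] (mod int p) \<longleftrightarrow> [i = j] (mod int p)" "\<And>y. \<exists>x. [g x = y] (mod int p)"
    and f0: "[f 0 = 0] (mod int p)" and ab: "\<not> int p dvd a" "\<not> int p dvd b"
    and c1: "\<And>i. \<exists>k. [a * k = f i] (mod int p) \<and> [b * f k = i] (mod int p)"
    and c2: "\<And>i u. [g (a * i + u - f i) = g u + b * f i - i] (mod int p)"
    and c3: "\<And>u v. \<exists>w. [b * w = b * v + g u - g v] (mod int p) \<and> [a * g w = a * g v + u - v] (mod int p)"
  shows "rcc_set S {t. t permutes S \<and> ((\<exists>i. aff \<kappa> False 1 i 1 (f i) t) \<or> (\<exists>u. aff \<kappa> True a u b (g u) t))}"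
    (is "rcc_set S ?X")
proof
  show "finite S" by (rule finite_S)
  show "t permutes S" if "t \<in> ?X" for t using that by blast
  have "aff \<kappa> False 1 0 1 (f 0) id" using f0 by (simp add: aff_def kappa_eq cong_iff_dvd_diff)
  then show "id \<in> ?X" using permutes_id by blast
  have exX: "\<exists>t\<in>?X. aff \<kappa> False 1 i 1 (f i) t" for i
  proof -
    obtain t where "t permutes S" "aff \<kappa> False 1 i 1 (f i) t" by (rule aff_exists[OF one_ndvd one_ndvd])
    then show ?thesis by (intro bexI[of _ t] CollectI conjI disjI1 exI)
  qed
  have exY: "\<exists>t\<in>?X. aff \<kappa> True a u b (g u) t" for u
  proof -
    obtain t where "t permutes S" "aff \<kappa> True a u b (g u) t" by (rule aff_exists[OF ab])
    then show ?thesis by (intro bexI[of _ t] CollectI conjI disjI2 exI)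
  qed
  show "\<exists>t\<in>?X. t x = y" if xS: "x \<in> S" and yS: "y \<in> S" for x y
  proof -
    obtain c i where x: "x = \<kappa> c i" by (rule in_S_E[OF xS])
    obtain e j where y: "y = \<kappa> e j" by (rule in_S_E[OF yS])
    show ?thesis
    proof (cases "c = e")
      case True
      show ?thesis
      proof (cases c)
        case c: True
        obtain k where k: "[f k = j - i] (mod int p)" using f(2) by blast
        then have "[i + f k = j] (mod int p)" by (rule cong_comb[where k = 1]) simp
        moreover obtain t where "t \<in> ?X" "aff \<kappa> False 1 k 1 (f k) t" using exX by blast
        ultimately show ?thesis using x y c True
          by (intro bexI[of _ t]) (simp_all add: aff_def kappa_eq)
      next
        case c: False
        obtain t where "t \<in> ?X" "aff \<kappa> False 1 (j - i) 1 (f (j - i)) t" using exX by blast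
        then show ?thesis using x y c True by (intro bexI[of _ t]) (simp_all add: aff_def)
      qed
    next
      case ne: False
      show ?thesis
      proof (cases c)
        case c: True
        obtain k where k: "[g k = j - b * i] (mod int p)" using g(2) by blast
        then have "[b * i + g k = j] (mod int p)" by (rule cong_comb[where k = 1]) simp
        moreover obtain t where "t \<in> ?X" "aff \<kappa> True a k b (g k) t" using exY by blast
        ultimately show ?thesis using x y c ne
          by (intro bexI[of _ t]) (simp_all add: aff_def kappa_eq)
      next
        case c: False
        obtain t where "t \<in> ?X" "aff \<kappa> True a (j - a * i) b (g (j - a * i)) t" using exY by blast
        then show ?thesis using x y c ne by (intro bexI[of _ t]) (simp_all add: aff_def)
      qed
    qed
  qed
  show "s = t" if st: "s \<in> ?X" "t \<in> ?X" and xS: "x \<in> S" and eq: "s x = t x" for s t x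
  proof -
    obtain c y where x: "x = \<kappa> c y" by (rule in_S_E[OF xS])
    have sp: "s permutes S" "t permutes S" using st by blast+
    from st(1) consider i where "aff \<kappa> False 1 i 1 (f i) s" | u where "aff \<kappa> True a u b (g u) s" by blast
    then show ?thesis
    proof cases
      case s: (1 i)
      from st(2) consider j where "aff \<kappa> False 1 j 1 (f j) t" | u where "aff \<kappa> True a u b (g u) t" by blast
      then show ?thesis
      proof cases
        case t: (1 j)
        have "[i = j] (mod int p)"
          using eq s t x f(1) by (cases c) (simp_all add: aff_def kappa_eq cong_add_lcancel)
        then show ?thesis using aff_eqI_cong[OF sp s t] f(1) by simp
      next
        case t: (2 u)
        then show ?thesis using eq s x by (cases c) (simp_all add: aff_def kappa_eq)
      qed
    next
      case s: (2 u)
      from st(2) consider j where "aff \<kappa> False 1 j 1 (f j) t" | u where "aff \<kappa> True a u b (g u) t" by blast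
      then show ?thesis
      proof cases
        case t: (1 j)
        then show ?thesis using eq s x by (cases c) (simp_all add: aff_def kappa_eq)
      next
        case t: (2 v)
        have "[u = v] (mod int p)"
          using eq s t x g(1) by (cases c) (simp_all add: aff_def kappa_eq cong_add_lcancel)
        then show ?thesis using aff_eqI_cong[OF sp s t] g(1) by simp
      qed
    qed
  qed
  show "\<exists>r\<in>?X. t \<circ> s = s \<circ> r" if st: "s \<in> ?X" "t \<in> ?X" for s t
  proof -
    have sp: "s permutes S" "t permutes S" using st by blast+
    have fin: "t \<circ> s = s \<circ> r"
      if "r permutes S" "aff \<kappa> e a1 u1 b1 v1 (t \<circ> s)" "aff \<kappa> e a1 u2 b1 v2 (s \<circ> r)"
        "[u1 = u2] (mod int p)" "[v1 = v2] (mod int p)" for r e a1 u1 b1 v1 u2 v2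
      by (rule aff_eqI_cong[OF _ _ that(2,3)]) (use that sp permutes_compose in auto)
    from st(1) consider i where "aff \<kappa> False 1 i 1 (f i) s" | v where "aff \<kappa> True a v b (g v) s" by blast
    then show ?thesis
    proof cases
      case s: (1 i)
      from st(2) consider j where "aff \<kappa> False 1 j 1 (f j) t" | u where "aff \<kappa> True a u b (g u) t" by blast
      then show ?thesis
      proof cases
        case t: (1 j)
        have "t \<circ> s = s \<circ> t"
          by (rule fin[OF sp(2) aff_comp_False[OF t s, simplified] aff_comp_False[OF s t, simplified]])
            (simp_all add: add.commute)
        then show ?thesis using st(2) by blast
      next
        case t: (2 u)
        obtain r where r: "r \<in> ?X" "aff \<kappa> True a (a * i + u - f i) b (g (a * i + u - f i)) r" using exY by blast
        then have rp: "r permutes S" by blast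
        have "[b * f i + g u = g (a * i + u - f i) + i] (mod int p)"
          using c2[of i u] by (rule cong_comb[where k = "-1"]) simp
        then have "t \<circ> s = s \<circ> r"
          using fin[OF rp aff_comp_False[OF t s, simplified] aff_comp_True[OF s r(2), simplified]] by simp
        then show ?thesis using r(1) by blast
      qed
    next
      case s: (2 v)
      from st(2) consider j where "aff \<kappa> False 1 j 1 (f j) t" | u where "aff \<kappa> True a u b (g u) t" by blast
      then show ?thesis
      proof cases
        case t: (1 j)
        obtain k where k: "[a * k = f j] (mod int p)" "[b * f k = j] (mod int p)" using c1 by blast
        obtain r where r: "r \<in> ?X" "aff \<kappa> False 1 k 1 (f k) r" using exX by blast
        then have rp: "r permutes S" by blast
        have "[v + f j = a * k + v] (mod int p)" using k(1) by (rule cong_comb[where k = "-1"]) simp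
        moreover have "[g v + j = b * f k + g v] (mod int p)" using k(2) by (rule cong_comb[where k = "-1"]) simp
        ultimately have "t \<circ> s = s \<circ> r"
          using fin[OF rp aff_comp_True[OF t s, simplified] aff_comp_False[OF s r(2), simplified]] by simp
        then show ?thesis using r(1) by blast
      next
        case t: (2 u)
        obtain w where w: "[b * w = b * v + g u - g v] (mod int p)" "[a * g w = a * g v + u - v] (mod int p)"
          using c3 by blast
        obtain r where r: "r \<in> ?X" "aff \<kappa> True a w b (g w) r" using exY by blast
        then have rp: "r permutes S" by blast
        have "[b * v + g u = b * w + g v] (mod int p)" using w(1) by (rule cong_comb[where k = "-1"]) simp
        moreover have "[a * g v + u = a * g w + v] (mod int p)" using w(2) by (rule cong_comb[where k = "-1"]) simp
        ultimately have "t \<circ> s = s \<circ> r"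
          using fin[OF rp aff_comp_True[OF t s] aff_comp_True[OF s r(2)]] by simp
        then show ?thesis using r(1) by blast
      qed
    qed
  qed
qed

lemma rcc_TA:
  assumes a: "\<not> int p dvd a" shows "rcc_set S (TA S \<kappa> a)"
proof -
  obtain c where c: "[a * c = 1] (mod int p)" using inverse_mod[OF a] by blast
  have sol: "[a * (c * y) = y] (mod int p)" for y
    by (rule cong_comb[OF c, where k = y]) (simp add: algebra_simps)
  show ?thesis unfolding TA_def
  proof (rule family_rcc[OF _ _ _ _ _ a a])
    show "\<exists>w. [a * w = a * v + u - v] (mod int p) \<and> [a * w = a * v + u - v] (mod int p)" for u v
      using sol by blast
    show "\<exists>k. [a * k = i] (mod int p) \<and> [a * k = i] (mod int p)" for i using sol by blast
    show "\<exists>x. [x = y] (mod int p)" for y by (rule exI[of _ y]) simp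
    then show "\<exists>x. [x = y] (mod int p)" for y .
  qed (simp_all add: algebra_simps)
qed

lemma invol0_iff: "invol0 p \<sigma> \<Longrightarrow> [\<sigma> i = \<sigma> j] (mod int p) \<longleftrightarrow> [i = j] (mod int p)"
  unfolding invol0_def by (metis cong_sym cong_trans)

lemma rcc_TB:
  assumes \<sigma>: "invol0 p \<sigma>" shows "rcc_set S (TB S \<kappa> \<sigma> d)"
  unfolding TB_def
proof (rule family_rcc[OF invol0_iff[OF \<sigma>] _ _ _ _ one_ndvd one_ndvd])
  show "\<exists>x. [\<sigma> x = y] (mod int p)" for y using \<sigma> unfolding invol0_def by blast
  show "[\<sigma> 0 = 0] (mod int p)" using \<sigma> unfolding invol0_def by blast
  show "\<exists>k. [1 * k = \<sigma> i] (mod int p) \<and> [1 * \<sigma> k = i] (mod int p)" for i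
    using \<sigma> unfolding invol0_def by (intro exI[of _ "\<sigma> i"]) simp
  show "\<exists>x. [d - x = y] (mod int p)" for y by (rule exI[of _ "d - y"]) simp
  \<comment> \<open>Conjugating the swap \<open>u\<close> by the swap \<open>v\<close> reflects the
    parameter, giving \<open>2 * v - u\<close>.\<close>
  show "\<exists>w. [1 * w = 1 * v + (d - u) - (d - v)] (mod int p) \<and> [1 * (d - w) = 1 * (d - v) + u - v] (mod int p)" for u v
    by (rule exI[of _ "2 * v - u"]) (simp add: algebra_simps)
  show "[d - i = d - j] (mod int p) \<longleftrightarrow> [i = j] (mod int p)" for i j
    by (auto simp: cong_iff_dvd_diff dvd_diff_commute)
qed (simp add: algebra_simps)

end

section \<open>Conjugacy of the families\<close>

definition conjugate :: "'a set \<Rightarrow> ('a \<Rightarrow> 'a) set \<Rightarrow> ('a \<Rightarrow> 'a) set \<Rightarrow> bool" where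
  "conjugate S T T' \<longleftrightarrow> (\<exists>\<phi>. \<phi> permutes S \<and> T' = conj_by \<phi> ` T)"

lemma conj_by_image_Collect:
  assumes "\<phi> permutes S"
  shows "conj_by \<phi> ` {t. t permutes S \<and> P t} = {t. t permutes S \<and> P (conj_by (inv \<phi>) t)}"
proof -
  have i: "inv \<phi> permutes S" using assms by (rule permutes_inv)
  have 1: "conj_by (inv \<phi>) (conj_by \<phi> t) = t" for t
    using conj_by_comp[OF i assms, of t] by (simp add: permutes_inv_o(2)[OF assms])
  have 2: "conj_by \<phi> (conj_by (inv \<phi>) t) = t" for t
    using conj_by_comp[OF assms i, of t] by (simp add: permutes_inv_o(1)[OF assms])
  show ?thesis
  proof (intro equalityI subsetI)
    fix t assume "t \<in> conj_by \<phi> ` {t. t permutes S \<and> P t}"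
    then show "t \<in> {t. t permutes S \<and> P (conj_by (inv \<phi>) t)}" using 1 conj_by_permutes[OF assms] by auto
  next
    fix t assume "t \<in> {t. t permutes S \<and> P (conj_by (inv \<phi>) t)}"
    then show "t \<in> conj_by \<phi> ` {t. t permutes S \<and> P t}"
      using 2[of t] conj_by_permutes[OF i] by (intro image_eqI[of _ _ "conj_by (inv \<phi>) t"]) auto
  qed
qed

text \<open>Conjugating by \<open>\<phi>\<close> amounts to transporting the coordinates along
  \<open>\<phi>\<close>. Conjugacy of two members of the families thereby becomes equality of sets
  written in two coordinate systems.\<close>

lemma aff_conj:
  assumes "\<phi> permutes S"
  shows "aff \<kappa> s a u b v (conj_by (inv \<phi>) t) \<longleftrightarrow> aff (\<lambda>b x. \<phi> (\<kappa> b x)) s a u b v t"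
proof -
  have "conj_by (inv \<phi>) t y = w \<longleftrightarrow> t (\<phi> y) = \<phi> w" for y w
  proof -
    have "conj_by (inv \<phi>) t y = inv \<phi> (t (\<phi> y))"
      using assms by (simp add: conj_by_def permutes_inv_inv)
    then show ?thesis by (metis assms permutes_inverses)
  qed
  then show ?thesis by (simp add: aff_def)
qed

lemma conj_by_TA:
  "\<phi> permutes S \<Longrightarrow> conj_by \<phi> ` TA S \<kappa> a = TA S (\<lambda>b x. \<phi> (\<kappa> b x)) a"
  unfolding TA_def by (simp add: conj_by_image_Collect aff_conj)

lemma conj_by_TB:
  "\<phi> permutes S \<Longrightarrow> conj_by \<phi> ` TB S \<kappa> \<sigma> d = TB S (\<lambda>b x. \<phi> (\<kappa> b x)) \<sigma> d"
  unfolding TB_def by (simp add: conj_by_image_Collect aff_conj)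

context coordinates
begin

lemma coordinates_perm:
  assumes "\<phi> permutes S" shows "coordinates p S (\<lambda>b x. \<phi> (\<kappa> b x))"
proof
  show "prime p" by (rule p)
  show "\<phi> (\<kappa> b x) = \<phi> (\<kappa> c y) \<longleftrightarrow> b = c \<and> [x = y] (mod int p)" for b x c y
    using permutes_inj[OF assms] kappa_eq by (metis injD)
  have "S = \<phi> ` S" using permutes_image[OF assms] by simp
  also have "\<dots> = {\<phi> (\<kappa> b x) | b x. True}" using kappa_range by blast
  finally show "S = {\<phi> (\<kappa> b x) | b x. True}" .
qed

lemma ex_perm:
  assumes "coordinates p S \<kappa>'"
  obtains \<phi> where "\<phi> permutes S" "\<And>b x. \<phi> (\<kappa> b x) = \<kappa>' b x"
proof -
  interpret K: coordinates p S \<kappa>' by (rule assms)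
  show thesis by (rule ex_map[of \<kappa>', OF K.kappa_eq K.kappa_in]) (rule that)
qed

lemma conjugate_families:
  assumes "coordinates p S \<kappa>'"
  shows "conjugate S (TA S \<kappa>' a) (TA S \<kappa> a)" "conjugate S (TB S \<kappa>' \<sigma> d) (TB S \<kappa> \<sigma> d)"
proof -
  obtain \<phi> where \<phi>: "\<phi> permutes S" "\<And>b x. \<phi> (\<kappa>' b x) = \<kappa> b x"
    using coordinates.ex_perm[OF assms coordinates_axioms] by blast
  then show "conjugate S (TA S \<kappa>' a) (TA S \<kappa> a)" "conjugate S (TB S \<kappa>' \<sigma> d) (TB S \<kappa> \<sigma> d)"
    unfolding conjugate_def using conj_by_TA[OF \<phi>(1), of \<kappa>'] conj_by_TB[OF \<phi>(1), of \<kappa>']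
    by (intro exI[of _ \<phi>]; simp)+
qed

end

text \<open>The second clause ties the coordinates to \<open>T\<close>: once the blocks are known,
  an element of \<open>T\<close> steps through each of them, which fixes the coordinates up to an
  affine change on each block.\<close>

definition adapted :: "(bool \<Rightarrow> int \<Rightarrow> 'a) \<Rightarrow> ('a \<Rightarrow> 'a) set \<Rightarrow> bool" where
  "adapted \<kappa> T \<longleftrightarrow> (\<forall>t\<in>T. (\<exists>i j. aff \<kappa> False 1 i 1 j t) \<or> (\<exists>a u b v. aff \<kappa> True a u b v t)) \<and>
     (\<forall>b. \<exists>t\<in>T. \<forall>x. t (\<kappa> b x) = \<kappa> b (x + 1))"

definition flip :: "(bool \<Rightarrow> int \<Rightarrow> 'a) \<Rightarrow> bool \<Rightarrow> int \<Rightarrow> 'a" where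
  "flip \<kappa> b = \<kappa> (\<not> b)"

lemma aff_flip: "aff (flip \<kappa>) s a u b v t \<longleftrightarrow> aff \<kappa> s b v a u t"
  unfolding aff_def flip_def by (cases s) auto

context coordinates
begin

lemma coordinates_flip: "coordinates p S (flip \<kappa>)"
proof
  show "prime p" by (rule p)
  show "flip \<kappa> b x = flip \<kappa> c y \<longleftrightarrow> b = c \<and> [x = y] (mod int p)" for b x c y
    by (auto simp: flip_def kappa_eq)
  show "S = {flip \<kappa> b x | b x. True}"
  proof (intro equalityI subsetI)
    fix y assume "y \<in> S"
    then obtain b x where "y = \<kappa> b x" by (rule in_S_E)
    then have "y = flip \<kappa> (\<not> b) x" by (simp add: flip_def)
    then show "y \<in> {flip \<kappa> b x | b x. True}" by blast
  qed (auto simp: flip_def kappa_in)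
qed

lemma TA_flip: "TA S (flip \<kappa>) a = TA S \<kappa> a"
  unfolding TA_def aff_flip by blast

text \<open>Exchanging the blocks replaces \<open>\<sigma>\<close> by its inverse and
  \<open>u\<close> by \<open>d - u\<close>; the first is harmless because \<open>\<sigma>\<close> is
  an involution on residues.\<close>

lemma TB_flip:
  assumes \<sigma>: "invol0 p \<sigma>" shows "TB S (flip \<kappa>) \<sigma> d = TB S \<kappa> \<sigma> d"
proof -
  have ss: "[\<sigma> (\<sigma> i) = i] (mod int p)" for i using \<sigma> by (simp add: invol0_def)
  have 1: "(\<exists>i. aff \<kappa> False 1 (\<sigma> i) 1 i t) \<longleftrightarrow> (\<exists>i. aff \<kappa> False 1 i 1 (\<sigma> i) t)" for t
  proof
    assume "\<exists>i. aff \<kappa> False 1 (\<sigma> i) 1 i t"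
    then obtain i where "aff \<kappa> False 1 (\<sigma> i) 1 i t" by blast
    then have "aff \<kappa> False 1 (\<sigma> i) 1 (\<sigma> (\<sigma> i)) t"
      by (rule aff_cong) (use ss[of i] in \<open>simp_all add: cong_sym_eq\<close>)
    then show "\<exists>i. aff \<kappa> False 1 i 1 (\<sigma> i) t" by blast
  next
    assume "\<exists>i. aff \<kappa> False 1 i 1 (\<sigma> i) t"
    then obtain i where "aff \<kappa> False 1 i 1 (\<sigma> i) t" by blast
    then have "aff \<kappa> False 1 (\<sigma> (\<sigma> i)) 1 (\<sigma> i) t"
      by (rule aff_cong) (use ss[of i] in \<open>simp_all add: cong_sym_eq\<close>)
    then show "\<exists>i. aff \<kappa> False 1 (\<sigma> i) 1 i t" by blast
  qed
  have 2: "(\<exists>u. aff \<kappa> True 1 (d - u) 1 u t) \<longleftrightarrow> (\<exists>u. aff \<kappa> True 1 u 1 (d - u) t)" for t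
  proof
    assume "\<exists>u. aff \<kappa> True 1 (d - u) 1 u t"
    then obtain u where "aff \<kappa> True 1 (d - u) 1 u t" by blast
    then show "\<exists>u. aff \<kappa> True 1 u 1 (d - u) t" by (intro exI[of _ "d - u"]) simp
  next
    assume "\<exists>u. aff \<kappa> True 1 u 1 (d - u) t"
    then obtain u where "aff \<kappa> True 1 u 1 (d - u) t" by blast
    then show "\<exists>u. aff \<kappa> True 1 (d - u) 1 u t" by (intro exI[of _ "d - u"]) simp
  qed
  show ?thesis unfolding TB_def aff_flip 1 2 ..
qed

lemma adapted_TA: "adapted \<kappa> (TA S \<kappa> a)"
  unfolding adapted_def
proof (intro conjI ballI allI)
  fix t assume "t \<in> TA S \<kappa> a"
  then show "(\<exists>i j. aff \<kappa> False 1 i 1 j t) \<or> (\<exists>a u b v. aff \<kappa> True a u b v t)" unfolding TA_def by blast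
next
  fix b
  obtain t where t: "t permutes S" "aff \<kappa> False 1 1 1 1 t" by (rule aff_exists[OF one_ndvd one_ndvd])
  then have "t \<in> TA S \<kappa> a" unfolding TA_def by blast
  then show "\<exists>t\<in>TA S \<kappa> a. \<forall>x. t (\<kappa> b x) = \<kappa> b (x + 1)" using t(2) by (cases b) (auto simp: aff_def)
qed

lemma adapted_TB:
  assumes \<sigma>: "invol0 p \<sigma>" shows "adapted \<kappa> (TB S \<kappa> \<sigma> d)"
  unfolding adapted_def
proof (intro conjI ballI allI)
  fix t assume "t \<in> TB S \<kappa> \<sigma> d"
  then show "(\<exists>i j. aff \<kappa> False 1 i 1 j t) \<or> (\<exists>a u b v. aff \<kappa> True a u b v t)" unfolding TB_def by blast
next
  fix b
  show "\<exists>t\<in>TB S \<kappa> \<sigma> d. \<forall>x. t (\<kappa> b x) = \<kappa> b (x + 1)"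
  proof (cases b)
    case True
    obtain t where t: "t permutes S" "aff \<kappa> False 1 (\<sigma> 1) 1 (\<sigma> (\<sigma> 1)) t" by (rule aff_exists[OF one_ndvd one_ndvd])
    then have tT: "t \<in> TB S \<kappa> \<sigma> d" unfolding TB_def by blast
    have "[\<sigma> (\<sigma> 1) = 1] (mod int p)" using \<sigma> by (simp add: invol0_def)
    then have "aff \<kappa> False 1 (\<sigma> 1) 1 1 t" by (intro aff_cong[OF t(2)]) simp_all
    then show ?thesis using True tT by (auto simp: aff_def)
  next
    case False
    obtain t where t: "t permutes S" "aff \<kappa> False 1 1 1 (\<sigma> 1) t" by (rule aff_exists[OF one_ndvd one_ndvd])
    then have tT: "t \<in> TB S \<kappa> \<sigma> d" unfolding TB_def by blast
    then show ?thesis using False t(2) by (auto simp: aff_def)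
  qed
qed

lemma card_block: "card (range (\<kappa> b)) = p"
proof -
  have "range (\<kappa> b) = (\<lambda>n. \<kappa> b (int n)) ` {..<p}"
  proof (intro equalityI subsetI)
    fix y assume "y \<in> range (\<kappa> b)"
    then obtain x where y: "y = \<kappa> b x" by blast
    have "y = \<kappa> b (int (nat (x mod int p)))" using p0 y by (simp add: kappa_eq cong_def)
    moreover have "nat (x mod int p) < p" using p0 by (simp add: nat_less_iff)
    ultimately show "y \<in> (\<lambda>n. \<kappa> b (int n)) ` {..<p}" by blast
  qed blast
  moreover have "inj_on (\<lambda>n. \<kappa> b (int n)) {..<p}"
    by (rule inj_onI) (simp add: kappa_eq cong_def flip: zmod_int)
  ultimately show ?thesis by (simp add: card_image)
qed

text \<open>If \<open>t\<close> fixes the blocks of one coordinate system and swaps those of the other, it matches the two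
  parts into which a block of the first is cut by the second, so \<open>p\<close> is even.\<close>

lemma same_blocks:
  assumes K: "coordinates p S \<kappa>'" and T: "rcc_set S T" and ad: "adapted \<kappa> T" "adapted \<kappa>' T" and p2: "odd p"
  obtains b where "range (\<kappa>' False) = range (\<kappa> b)"
proof -
  interpret K: coordinates p S \<kappa>' by (rule K)
  interpret rcc_set S T by (rule T)
  let ?F = "range (\<kappa>' False)"
  have fF: "finite ?F" by (rule card_ge_0_finite) (simp add: K.card_block p0)
  show thesis
  proof (cases "\<exists>b. ?F \<subseteq> range (\<kappa> b)")
    case True
    then obtain b where "?F \<subseteq> range (\<kappa> b)" by blast
    moreover have "finite (range (\<kappa> b))" by (rule card_ge_0_finite) (simp add: card_block p0)
    ultimately have "?F = range (\<kappa> b)" by (simp add: card_subset_eq card_block K.card_block)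
    then show ?thesis using that by blast
  next
    case False
    have split: "y \<in> range (\<kappa> False) \<or> y \<in> range (\<kappa> True)" if yS: "y \<in> ?F" for y
    proof -
      have "y \<in> S" using yS K.kappa_in by blast
      then obtain b x where "y = \<kappa> b x" by (rule in_S_E)
      then show ?thesis by (cases b) auto
    qed
    define A where "A b = ?F \<inter> range (\<kappa> b)" for b
    have FA: "?F = A False \<union> A True" using split by (auto simp: A_def)
    obtain i where i: "\<kappa>' False i \<in> range (\<kappa> False)" using False split by blast
    obtain j where j: "\<kappa>' False j \<in> range (\<kappa> True)" using False split by blast
    obtain t where t: "t \<in> T" "t (\<kappa>' False i) = \<kappa>' False j" using transitive K.kappa_in by blast
    obtain s a u b v where t1: "aff \<kappa> s a u b v t" using ad(1) t(1) unfolding adapted_def by blast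
    obtain s' a' u' b' v' where t2: "aff \<kappa>' s' a' u' b' v' t" using ad(2) t(1) unfolding adapted_def by blast
    have s': "\<not> s'" using t2 t(2) by (auto simp: aff_def K.kappa_eq)
    obtain x y where xy: "\<kappa>' False i = \<kappa> False x" "\<kappa>' False j = \<kappa> True y" using i j by blast
    have s: "s" using t1 t(2) unfolding xy by (auto simp: aff_def kappa_eq)
    have tF: "t ` ?F \<subseteq> ?F" using t2 s' by (auto simp: aff_def)
    have tb: "t ` range (\<kappa> b) \<subseteq> range (\<kappa> (\<not> b))" for b using t1 s by (cases b) (auto simp: aff_def)
    have tA: "t ` A b \<subseteq> A (\<not> b)" for b using tF tb[of b] unfolding A_def by blast
    have inj: "inj_on t X" for X using perm[OF t(1)] permutes_inj_on by blast
    have fA: "finite (A b)" for b using fF unfolding A_def by blast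
    have "card (A b) \<le> card (A (\<not> b))" for b using card_inj_on_le[OF inj tA fA] .
    from this[of False] this[of True] have "card (A False) = card (A True)" by simp
    moreover have "A False \<inter> A True = {}" using kappa_eq by (auto simp: A_def)
    ultimately have "card ?F = 2 * card (A True)" unfolding FA using fA by (simp add: card_Un_disjoint)
    then show ?thesis using K.card_block[of False] p2 by simp
  qed
qed

text \<open>The element of \<open>T\<close> that steps through the block in the coordinates
  \<open>\<kappa>'\<close> is a translation by some \<open>c\<close> in the coordinates
  \<open>\<kappa>\<close>, so the two differ by an affine map of slope \<open>c\<close>.\<close>

lemma relate_block:
  assumes K: "coordinates p S \<kappa>'" and T: "rcc_set S T" and ad: "adapted \<kappa> T" "adapted \<kappa>' T"
    and b: "range (\<kappa>' b) = range (\<kappa> b)"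
  obtains c e where "\<not> int p dvd c" "\<And>x. \<kappa>' b x = \<kappa> b (c * x + e)"
proof -
  interpret K: coordinates p S \<kappa>' by (rule K)
  interpret rcc_set S T by (rule T)
  obtain t where t: "t \<in> T" "\<And>x. t (\<kappa>' b x) = \<kappa>' b (x + 1)" using ad(2) unfolding adapted_def by metis
  have ex: "\<exists>y. \<kappa>' b x = \<kappa> b y" for x using b by blast
  obtain e where e: "\<kappa>' b 0 = \<kappa> b e" using ex by blast
  obtain w where w: "t (\<kappa> b e) = \<kappa> b w" using ex[of "0 + 1"] t(2)[of 0] e by metis
  have "\<not> aff \<kappa> True a u a' v t" for a u a' v using w by (cases b) (auto simp: aff_def kappa_eq)
  then obtain i j where ij: "aff \<kappa> False 1 i 1 j t" using ad(1) t(1) unfolding adapted_def by blast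
  define c where "c = (if b then j else i)"
  have tb: "t (\<kappa> b y) = \<kappa> b (y + c)" for y using ij by (cases b) (simp_all add: aff_def c_def)
  have inj: "inj t" using perm[OF t(1)] permutes_inj by blast
  have eq: "\<kappa>' b x = \<kappa> b (c * x + e)" for x
    by (rule affine_progression[OF inj tb]) (simp_all add: t(2) e)
  have "\<not> int p dvd c"
  proof
    assume "int p dvd c"
    then have "\<kappa>' b 1 = \<kappa>' b 0" by (simp add: eq kappa_eq cong_iff_dvd_diff)
    then have "[1 = 0] (mod int p)" by (simp only: K.kappa_eq)
    then show False using one_ndvd by (simp add: cong_0_iff)
  qed
  then show thesis using that eq by blast
qed

lemma block_compl: "range (\<kappa> (\<not> b)) = S - range (\<kappa> b)"
proof (intro equalityI subsetI)
  fix y assume "y \<in> range (\<kappa> (\<not> b))"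
  then show "y \<in> S - range (\<kappa> b)" using kappa_in by (auto simp: kappa_eq)
next
  fix y assume y: "y \<in> S - range (\<kappa> b)"
  then have "y \<in> S" by simp
  then obtain c x where cx: "y = \<kappa> c x" by (rule in_S_E)
  then have "c = (\<not> b)" using y by auto
  then show "y \<in> range (\<kappa> (\<not> b))" using cx by blast
qed

lemma change_of_coordinates:
  assumes K: "coordinates p S \<kappa>'" and T: "rcc_set S T" and ad: "adapted \<kappa> T" "adapted \<kappa>' T"
    and b: "range (\<kappa>' False) = range (\<kappa> False)"
  obtains c e where "\<And>b. \<not> int p dvd c b" "\<And>b x. \<kappa>' b x = \<kappa> b (c b * x + e b)"
proof -
  interpret K: coordinates p S \<kappa>' by (rule K)
  have "range (\<kappa>' b) = range (\<kappa> b)" for b 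
    using assms(5) block_compl[of False] K.block_compl[of False] by (cases b) simp_all
  then have "\<exists>c e. \<not> int p dvd c \<and> (\<forall>x. \<kappa>' b x = \<kappa> b (c * x + e))" for b
    using relate_block[OF K T ad] by metis
  then show thesis using that by metis
qed

text \<open>For swaps the parameters in the two systems are related by congruences, read off at
  \<open>x = 0\<close> and \<open>x = 1\<close>, rather than solved for; this avoids inverting
  \<open>c b\<close>.\<close>

lemma aff_change:
  assumes c: "\<And>b. \<not> int p dvd c b" "\<And>b x. \<kappa>' b x = \<kappa> b (c b * x + e b)"
  shows "aff \<kappa>' False 1 i 1 j t \<Longrightarrow> aff \<kappa> False 1 (c False * i) 1 (c True * j) t"
    and "aff \<kappa>' True a u b v t \<Longrightarrow> aff \<kappa> True a' u' b' v' t \<Longrightarrow>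
      [a' * c False = c True * a] (mod int p) \<and> [b' * c True = c False * b] (mod int p) \<and>
      [a' * e False + u' = c True * u + e True] (mod int p) \<and> [b' * e True + v' = c False * v + e False] (mod int p)"
proof -
  have inv: "\<exists>x. [y = c b * x + e b] (mod int p)" for b y
  proof -
    obtain d where d: "[c b * d = 1] (mod int p)" using inverse_mod[OF c(1)] by blast
    have "[y = c b * (d * (y - e b)) + e b] (mod int p)"
      by (rule cong_comb[OF d, where k = "e b - y"]) (simp add: algebra_simps)
    then show ?thesis by blast
  qed
  show "aff \<kappa> False 1 (c False * i) 1 (c True * j) t" if t: "aff \<kappa>' False 1 i 1 j t"
  proof -
    have "t (\<kappa> b y) = \<kappa> b (y + c b * (if b then j else i))" for b y
    proof -
      obtain x where x: "[y = c b * x + e b] (mod int p)" using inv by blast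
      then have "t (\<kappa> b y) = t (\<kappa>' b x)" by (simp add: c(2) kappa_eq[THEN iffD2])
      also have "\<dots> = \<kappa>' b (x + (if b then j else i))" using t by (cases b) (simp_all add: aff_def)
      also have "\<dots> = \<kappa> b (c b * x + e b + c b * (if b then j else i))" by (simp add: c(2) algebra_simps)
      also have "\<dots> = \<kappa> b (y + c b * (if b then j else i))"
        using x by (simp add: kappa_eq cong_add_rcancel cong_sym_eq)
      finally show ?thesis .
    qed
    from this[of False] this[of True] show ?thesis by (simp add: aff_def)
  qed
  assume t: "aff \<kappa>' True a u b v t" "aff \<kappa> True a' u' b' v' t"
  have F: "[a' * (c False * x + e False) + u' = c True * (a * x + u) + e True] (mod int p)" for x
    using t(1)[unfolded aff_def, THEN conjunct1, rule_format, of x] t(2) by (simp add: aff_def c(2) kappa_eq)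
  have G: "[b' * (c True * x + e True) + v' = c False * (b * x + v) + e False] (mod int p)" for x
    using t(1)[unfolded aff_def, THEN conjunct2, rule_format, of x] t(2) by (simp add: aff_def c(2) kappa_eq)
  have "[a' * c False = c True * a] (mod int p)"
    by (rule cong_comb2[OF F[of 1] F[of 0], where k = 1 and l = "-1"]) (simp add: algebra_simps)
  moreover have "[b' * c True = c False * b] (mod int p)"
    by (rule cong_comb2[OF G[of 1] G[of 0], where k = 1 and l = "-1"]) (simp add: algebra_simps)
  ultimately show "[a' * c False = c True * a] (mod int p) \<and> [b' * c True = c False * b] (mod int p) \<and>
      [a' * e False + u' = c True * u + e True] (mod int p) \<and> [b' * e True + v' = c False * v + e False] (mod int p)"
    using F[of 0] G[of 0] by simp
qed

section \<open>Invariants that tell the members of the two families apart\<close>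

lemma TA_shift:
  assumes t: "t \<in> TA S \<kappa> a" "aff \<kappa> False 1 i 1 j t" shows "[j = i] (mod int p)"
proof -
  have "\<not> aff \<kappa> True a u b v t" for a u b v using aff_params(1)[OF t(2), of True a u b v] by auto
  then obtain k where k: "aff \<kappa> False 1 k 1 k t" using t(1) unfolding TA_def by blast
  show ?thesis using aff_params(3)[OF k t(2)] aff_params(5)[OF k t(2)] by (metis cong_sym cong_trans)
qed

lemma TB_shift:
  assumes \<sigma>: "invol0 p \<sigma>" and t: "t \<in> TB S \<kappa> \<sigma> d" "aff \<kappa> False 1 i 1 j t"
  shows "[\<sigma> i = j] (mod int p)"
proof -
  have "\<not> aff \<kappa> True a u b v t" for a u b v using aff_params(1)[OF t(2), of True a u b v] by auto
  then obtain k where k: "aff \<kappa> False 1 k 1 (\<sigma> k) t" using t(1) unfolding TB_def by blast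
  have "[\<sigma> i = \<sigma> k] (mod int p)" using invol0_iff[OF \<sigma>] aff_params(3)[OF t(2) k] by blast
  then show ?thesis using aff_params(5)[OF k t(2)] by (rule cong_trans)
qed

lemma TA_swap: "t \<in> TA S \<kappa> a \<Longrightarrow> t (\<kappa> False x) = \<kappa> True y \<Longrightarrow> \<exists>u. aff \<kappa> True a u a u t"
  unfolding TA_def by (auto simp: aff_def kappa_eq)

lemma TB_swap: "t \<in> TB S \<kappa> \<sigma> d \<Longrightarrow> t (\<kappa> False x) = \<kappa> True y \<Longrightarrow> \<exists>u. aff \<kappa> True 1 u 1 (d - u) t"
  unfolding TB_def by (auto simp: aff_def kappa_eq)

text \<open>Both families are unchanged by \<open>flip\<close>, so in comparing two systems the
  first blocks may be taken to coincide.\<close>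

lemma orient:
  assumes K: "coordinates p S \<kappa>'" and T: "rcc_set S T" and ad: "adapted \<kappa> T" "adapted \<kappa>' T" and p2: "odd p"
  shows "range (\<kappa>' False) = range (\<kappa> False) \<or> range (flip \<kappa>' False) = range (\<kappa> False)"
proof -
  interpret K: coordinates p S \<kappa>' by (rule K)
  obtain b where b: "range (\<kappa>' False) = range (\<kappa> b)" using same_blocks[OF assms] .
  show ?thesis
  proof (cases b)
    case True
    then have "range (\<kappa>' True) = range (\<kappa> False)"
      using b block_compl[of True] K.block_compl[of False] by simp
    then show ?thesis by (simp add: flip_def [abs_def])
  qed (use b in simp)
qed

text \<open>Shifts have equal entries in both systems, so both blocks are scaled by the same factor,
  and such a change preserves slopes.\<close>

lemma TA_eq_TA:
  assumes K: "coordinates p S \<kappa>'" and p2: "odd p" and a: "\<not> int p dvd a"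
    and eq: "TA S \<kappa> a = TA S \<kappa>' a'"
  shows "[a = a'] (mod int p)"
proof -
  interpret K: coordinates p S \<kappa>' by (rule K)
  have T: "rcc_set S (TA S \<kappa> a)" using rcc_TA[OF a] .
  have ad: "adapted \<kappa> (TA S \<kappa> a)" by (rule adapted_TA)
  have ad': "adapted \<kappa>' (TA S \<kappa> a)" unfolding eq by (rule K.adapted_TA)
  obtain L where L: "coordinates p S L" "TA S \<kappa> a = TA S L a'" "range (L False) = range (\<kappa> False)"
    using orient[OF K T ad ad' p2] K K.coordinates_flip K.TA_flip eq by metis
  interpret L: coordinates p S L by (rule L(1))
  have adL: "adapted L (TA S \<kappa> a)" using L.adapted_TA unfolding L(2) .
  obtain c e where c: "\<And>b. \<not> int p dvd c b" "\<And>b x. L b x = \<kappa> b (c b * x + e b)"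
    using change_of_coordinates[OF L(1) T ad adL L(3)] by blast
  obtain t where t: "t permutes S" "aff L False 1 1 1 1 t" by (rule L.aff_exists[OF one_ndvd one_ndvd])
  then have "t \<in> TA S \<kappa> a" unfolding L(2) unfolding TA_def by blast
  then have cc: "[c True = c False] (mod int p)" using TA_shift aff_change(1)[of c L e, OF c t(2)] by fastforce
  have "adapted L (TA S L a')" by (rule L.adapted_TA)
  obtain t where t: "t \<in> TA S \<kappa> a" "t (L False 0) = L True 0"
    using rcc_set.transitive[OF T] L.kappa_in by blast
  obtain u where u: "aff L True a' u a' u t" using L.TA_swap t L(2) by metis
  obtain w where w: "aff \<kappa> True a w a w t" using TA_swap t c(2) by metis
  have "[a * c False = c True * a'] (mod int p)" using aff_change(2)[of c L e, OF c u w] by blast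
  then have "[c False * a = c False * a'] (mod int p)"
    using cc by (rule cong_comb2[where k = 1 and l = a']) (simp add: algebra_simps)
  then show ?thesis using mult_cong_cancel[OF c(1)] by blast
qed

text \<open>Raising \<open>u\<close> by 1 changes the swap parameters by \<open>(1, - 1)\<close> in
  \<open>TB\<close> and by equal amounts in \<open>TA\<close>, which forces
  \<open>c True = - c False\<close>; the slopes force \<open>c True = a * c False\<close>. Together
  they give \<open>a = - 1\<close>.\<close>

lemma TA_neq_TB:
  assumes K: "coordinates p S \<kappa>'" and p2: "odd p" and a: "\<not> int p dvd a" "\<not> int p dvd a + 1"
    and \<sigma>: "invol0 p \<sigma>"
  shows "TA S \<kappa> a \<noteq> TB S \<kappa>' \<sigma> d"
proof
  assume eq: "TA S \<kappa> a = TB S \<kappa>' \<sigma> d"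
  interpret K: coordinates p S \<kappa>' by (rule K)
  have T: "rcc_set S (TA S \<kappa> a)" using rcc_TA[OF a(1)] .
  have ad: "adapted \<kappa> (TA S \<kappa> a)" by (rule adapted_TA)
  have ad': "adapted \<kappa>' (TA S \<kappa> a)" unfolding eq by (rule K.adapted_TB[OF \<sigma>])
  obtain L where L: "coordinates p S L" "TA S \<kappa> a = TB S L \<sigma> d" "range (L False) = range (\<kappa> False)"
    using orient[OF K T ad ad' p2] K K.coordinates_flip K.TB_flip[OF \<sigma>] eq by metis
  interpret L: coordinates p S L by (rule L(1))
  have adL: "adapted L (TA S \<kappa> a)" using L.adapted_TB[OF \<sigma>] unfolding L(2) .
  obtain c e where c: "\<And>b. \<not> int p dvd c b" "\<And>b x. L b x = \<kappa> b (c b * x + e b)"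
    using change_of_coordinates[OF L(1) T ad adL L(3)] by blast
  have 2: "\<not> int p dvd 2"
    using p2 p by (metis int_dvd_int_iff of_nat_numeral primes_dvd_imp_eq two_is_prime_nat dvd_refl)
  have rel: "[a * c False = c True] (mod int p) \<and> [a * c True = c False] (mod int p) \<and>
      [a * e False + w = c True * u + e True] (mod int p) \<and> [a * e True + w = c False * (d - u) + e False] (mod int p)"
    if "t \<in> TA S \<kappa> a" "aff L True 1 u 1 (d - u) t" "aff \<kappa> True a w a w t" for t u w
    using aff_change(2)[of c L e, OF c that(2,3)] by simp
  have ex: "\<exists>w. [a * c False = c True] (mod int p) \<and> [a * c True = c False] (mod int p) \<and>
      [a * e False + w = c True * u + e True] (mod int p) \<and> [a * e True + w = c False * (d - u) + e False] (mod int p)" for u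
  proof -
    obtain t where t: "t permutes S" "aff L True 1 u 1 (d - u) t" by (rule L.aff_exists[OF one_ndvd one_ndvd])
    then have tT: "t \<in> TA S \<kappa> a" unfolding L(2) unfolding TB_def by blast
    have "t (\<kappa> False (c False * 0 + e False)) = \<kappa> True (c True * (1 * 0 + u) + e True)"
      using t(2) unfolding aff_def c(2) [symmetric] by simp
    then obtain w where "aff \<kappa> True a w a w t" using TA_swap[OF tT] by blast
    then show ?thesis using rel[OF tT t(2)] by blast
  qed
  obtain w0 where w0: "[a * c False = c True] (mod int p)" "[a * c True = c False] (mod int p)"
      "[a * e False + w0 = c True * 0 + e True] (mod int p)" "[a * e True + w0 = c False * (d - 0) + e False] (mod int p)"
    using ex[of 0] by blast
  obtain w1 where w1: "[a * e False + w1 = c True * 1 + e True] (mod int p)" "[a * e True + w1 = c False * (d - 1) + e False] (mod int p)"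
    using ex[of 1] by blast
  have x: "[w1 - w0 = c True] (mod int p)"
    by (rule cong_comb2[OF w1(1) w0(3), where k = 1 and l = "-1"]) (simp add: algebra_simps)
  have y: "[w1 - w0 = - c False] (mod int p)"
    by (rule cong_comb2[OF w1(2) w0(4), where k = 1 and l = "-1"]) (simp add: algebra_simps)
  have "[c True = - c False] (mod int p)" using x y by (metis cong_sym cong_trans)
  then have "[(a + 1) * c False = 0] (mod int p)"
    using w0(1) by (rule cong_comb2[where k = 1 and l = 1]) (simp add: algebra_simps)
  then have "int p dvd (a + 1) * c False" by (simp add: cong_0_iff)
  then show False using a(2) c(1) p by (metis prime_dvd_mult_iff prime_nat_int_transfer)
qed

text \<open>Slopes 1 in both systems force a common scaling factor \<open>c\<close> of the blocks.
  Shifts then give the relation between \<open>\<sigma>\<close> and \<open>\<sigma>'\<close>, and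
  the sum of the two parameters of a swap, in which the translations \<open>e\<close> cancel, gives
  the one between \<open>d\<close> and \<open>d'\<close>.\<close>

lemma TB_eq_TB:
  assumes K: "coordinates p S \<kappa>'" and p2: "odd p" and \<sigma>: "invol0 p \<sigma>" "invol0 p \<sigma>'"
    and eq: "TB S \<kappa> \<sigma> d = TB S \<kappa>' \<sigma>' d'"
  shows "\<exists>c. \<not> int p dvd c \<and> (\<forall>i. [\<sigma> (c * i) = c * \<sigma>' i] (mod int p)) \<and> [d = c * d'] (mod int p)"
proof -
  interpret K: coordinates p S \<kappa>' by (rule K)
  have T: "rcc_set S (TB S \<kappa> \<sigma> d)" using rcc_TB[OF \<sigma>(1)] .
  have ad: "adapted \<kappa> (TB S \<kappa> \<sigma> d)" by (rule adapted_TB[OF \<sigma>(1)])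
  have ad': "adapted \<kappa>' (TB S \<kappa> \<sigma> d)" unfolding eq by (rule K.adapted_TB[OF \<sigma>(2)])
  obtain L where L: "coordinates p S L" "TB S \<kappa> \<sigma> d = TB S L \<sigma>' d'" "range (L False) = range (\<kappa> False)"
    using orient[OF K T ad ad' p2] K K.coordinates_flip K.TB_flip[OF \<sigma>(2)] eq by metis
  interpret L: coordinates p S L by (rule L(1))
  have adL: "adapted L (TB S \<kappa> \<sigma> d)" using L.adapted_TB[OF \<sigma>(2)] unfolding L(2) .
  obtain c e where c: "\<And>b. \<not> int p dvd c b" "\<And>b x. L b x = \<kappa> b (c b * x + e b)"
    using change_of_coordinates[OF L(1) T ad adL L(3)] by blast
  obtain t where t: "t permutes S" "aff L True 1 0 1 (d' - 0) t" by (rule L.aff_exists[OF one_ndvd one_ndvd])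
  then have tT: "t \<in> TB S \<kappa> \<sigma> d" unfolding L(2) unfolding TB_def by blast
  have "t (\<kappa> False (c False * 0 + e False)) = \<kappa> True (c True * (1 * 0 + 0) + e True)"
    using t(2) unfolding aff_def c(2) [symmetric] by simp
  then obtain u where "aff \<kappa> True 1 u 1 (d - u) t" using TB_swap[OF tT] by blast
  from aff_change(2)[of c L e, OF c t(2) this]
  have cc: "[c False = c True] (mod int p)"
    and uv: "[e False + u = e True] (mod int p)" "[e True + (d - u) = c False * d' + e False] (mod int p)" by simp_all
  have "[d = c False * d'] (mod int p)"
    by (rule cong_comb2[OF uv, where k = 1 and l = 1]) (simp add: algebra_simps)
  moreover have "[\<sigma> (c False * i) = c False * \<sigma>' i] (mod int p)" for i
  proof -
    obtain t where t: "t permutes S" "aff L False 1 i 1 (\<sigma>' i) t" by (rule L.aff_exists[OF one_ndvd one_ndvd])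
    then have "t \<in> TB S \<kappa> \<sigma> d" unfolding L(2) unfolding TB_def by blast
    then have "[\<sigma> (c False * i) = c True * \<sigma>' i] (mod int p)"
      using TB_shift[OF \<sigma>(1)] aff_change(1)[of c L e, OF c t(2)] by blast
    then show ?thesis using cc by (rule cong_comb2[where k = 1 and l = "- \<sigma>' i"]) (simp add: algebra_simps)
  qed
  ultimately show ?thesis using c(1) by blast
qed

text \<open>The converse of \<open>TB_eq_TB\<close>, by scaling both blocks with
  \<open>c\<close>.\<close>

lemma TB_scale:
  assumes c: "\<not> int p dvd c" and \<sigma>: "invol0 p \<sigma>" "\<And>i. [\<sigma> (c * i) = c * \<sigma>' i] (mod int p)"
    and d: "[d = c * d'] (mod int p)"
  obtains \<kappa>' where "coordinates p S \<kappa>'" "TB S \<kappa> \<sigma> d = TB S \<kappa>' \<sigma>' d'"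
proof -
  define L where "L b x = \<kappa> b (c * x)" for b x
  have "coordinates p S L"
  proof
    show "prime p" by (rule p)
    show "L b x = L b' y \<longleftrightarrow> b = b' \<and> [x = y] (mod int p)" for b x b' y
      by (simp add: L_def kappa_eq mult_cong_cancel[OF c])
    obtain c' where c': "[c * c' = 1] (mod int p)" using inverse_mod[OF c] by blast
    have "\<exists>b x. y = L b x" if yS: "y \<in> S" for y
    proof -
      obtain b x where y: "y = \<kappa> b x" by (rule in_S_E[OF yS])
      have "[x = c * (c' * x)] (mod int p)"
        by (rule cong_comb[OF c', where k = "- x"]) (simp add: algebra_simps)
      then have "y = L b (c' * x)" using y by (simp add: L_def kappa_eq)
      then show ?thesis by blast
    qed
    then show "S = {L b x | b x. True}" using kappa_in unfolding L_def by blast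
  qed
  interpret L: coordinates p S L by fact
  have T: "rcc_set S (TB S \<kappa> \<sigma> d)" using rcc_TB[OF \<sigma>(1)] .
  interpret R: rcc_coords p S "TB S \<kappa> \<sigma> d" L using T L.coordinates_axioms by (simp add: rcc_coords_def)
  have L_aff: "aff L s a u b v t" if "aff \<kappa> s a (c * u) b (c * v) t" for s a u b v t
    using that unfolding aff_def L_def by (simp add: algebra_simps)
  have "TB S \<kappa> \<sigma> d = TB S L \<sigma>' d'"
  proof (rule R.eq_TB)
    show "\<exists>t\<in>TB S \<kappa> \<sigma> d. aff L False 1 i 1 (\<sigma>' i) t" for i
    proof -
      obtain t where t: "t permutes S" "aff \<kappa> False 1 (c * i) 1 (\<sigma> (c * i)) t" by (rule aff_exists[OF one_ndvd one_ndvd])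
      then have tT: "t \<in> TB S \<kappa> \<sigma> d" unfolding TB_def by blast
      have "aff \<kappa> False 1 (c * i) 1 (c * \<sigma>' i) t" by (intro aff_cong[OF t(2)]) (simp_all add: \<sigma>(2))
      then show ?thesis using L_aff tT by blast
    qed
    show "\<exists>t\<in>TB S \<kappa> \<sigma> d. aff L True 1 u 1 (d' - u) t" for u
    proof -
      obtain t where t: "t permutes S" "aff \<kappa> True 1 (c * u) 1 (d - c * u) t" by (rule aff_exists[OF one_ndvd one_ndvd])
      then have tT: "t \<in> TB S \<kappa> \<sigma> d" unfolding TB_def by blast
      have "[d - c * u = c * (d' - u)] (mod int p)" using d by (rule cong_comb[where k = 1]) (simp add: algebra_simps)
      then have "aff \<kappa> True 1 (c * u) 1 (c * (d' - u)) t" by (intro aff_cong[OF t(2)]) simp_all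
      then show ?thesis using L_aff tT by blast
    qed
  qed
  then show thesis using that L.coordinates_axioms by blast
qed

text \<open>For \<open>p = 2\<close> the blocks are not determined by the set, but squares tell the two groups of order 4 apart.\<close>

lemma TB_eq_TB_2:
  assumes K: "coordinates p S \<kappa>'" and p2: "p = 2" and \<sigma>: "invol0 p \<sigma>" "invol0 p \<sigma>'"
    and eq: "TB S \<kappa> \<sigma> d = TB S \<kappa>' \<sigma>' d'"
  shows "[d = d'] (mod int p)"
proof -
  \<comment> \<open>The square of every swap is the shift by \<open>d\<close> on both blocks, and
    shifts square to the identity because \<open>p = 2\<close>.\<close>
  have sq: "(\<forall>t\<in>TB S L \<sigma> d. t \<circ> t = id) \<longleftrightarrow> int p dvd d"
    if L: "coordinates p S L" for L :: "bool \<Rightarrow> int \<Rightarrow> 'a" and \<sigma> d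
  proof -
    interpret L: coordinates p S L by (rule L)
    have id_iff: "r = id \<longleftrightarrow> [i = 0] (mod int p) \<and> [j = 0] (mod int p)"
      if "r permutes S" "aff L False 1 i 1 j r" for r i j
    proof
      have id0: "aff L False 1 0 1 0 id" by (simp add: aff_def)
      show "[i = 0] (mod int p) \<and> [j = 0] (mod int p)" if "r = id"
        using L.aff_params(3,5)[OF \<open>aff L False 1 i 1 j r\<close>, of False 1 0 1 0] id0 that by simp
      show "r = id" if "[i = 0] (mod int p) \<and> [j = 0] (mod int p)"
        by (rule L.aff_eqI_cong[OF \<open>r permutes S\<close> permutes_id \<open>aff L False 1 i 1 j r\<close> id0]) (use that in simp_all)
    qed
    show ?thesis
    proof
      assume *: "\<forall>t\<in>TB S L \<sigma> d. t \<circ> t = id"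
      obtain t where t: "t permutes S" "aff L True 1 0 1 (d - 0) t" by (rule L.aff_exists[OF one_ndvd one_ndvd])
      then have "t \<in> TB S L \<sigma> d" unfolding TB_def by blast
      then have "t \<circ> t = id" using * by blast
      moreover have "aff L False 1 d 1 d (t \<circ> t)" using L.aff_comp_True[OF t(2) t(2)] by simp
      ultimately have "[d = 0] (mod int p)" using id_iff[of "t \<circ> t" d d] by simp
      then show "int p dvd d" by (simp add: cong_0_iff)
    next
      assume d: "int p dvd d"
      show "\<forall>t\<in>TB S L \<sigma> d. t \<circ> t = id"
      proof
        fix t assume t: "t \<in> TB S L \<sigma> d"
        then have tp: "t \<circ> t permutes S" unfolding TB_def using permutes_compose by blast
        from t consider i where "aff L False 1 i 1 (\<sigma> i) t" | u where "aff L True 1 u 1 (d - u) t"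
          unfolding TB_def by blast
        then show "t \<circ> t = id"
        proof cases
          case (1 i)
          have "aff L False 1 (i + i) 1 (\<sigma> i + \<sigma> i) (t \<circ> t)" using L.aff_comp_False[OF 1 1] by simp
          moreover have "[i + i = 0] (mod int p)" "[\<sigma> i + \<sigma> i = 0] (mod int p)" using p2 by (simp_all add: cong_0_iff)
          ultimately show ?thesis using id_iff[OF tp] by blast
        next
          case (2 u)
          have "aff L False 1 d 1 d (t \<circ> t)" using L.aff_comp_True[OF 2 2] by simp
          then show ?thesis using id_iff[OF tp] d by (simp add: cong_0_iff)
        qed
      qed
    qed
  qed
  have "int p dvd d \<longleftrightarrow> int p dvd d'" using sq[OF coordinates_axioms, of \<sigma> d] sq[OF K, of \<sigma>' d'] eq by simp
  then show ?thesis using p2 by (simp add: cong_iff_dvd_diff)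
qed

end

section \<open>Loops and their right multiplications\<close>

text \<open>Extended by the identity, a right multiplication becomes a permutation in the sense of
  \<open>permutes\<close>, and for \<open>a < n\<close> it does not see the values of
  \<open>m\<close> outside the carrier.\<close>

definition rmul :: "nat \<Rightarrow> (nat \<Rightarrow> nat \<Rightarrow> nat) \<Rightarrow> nat \<Rightarrow> nat \<Rightarrow> nat" where
  "rmul n m a x = (if x < n then m x a else x)"

definition right_mults :: "nat \<Rightarrow> (nat \<Rightarrow> nat \<Rightarrow> nat) \<Rightarrow> (nat \<Rightarrow> nat) set" where
  "right_mults n m = rmul n m ` {0..<n}"

lemma rmul_apply [simp]: "x < n \<Longrightarrow> rmul n m a x = m x a"
  by (simp add: rmul_def)

lemma in_right_mults: "t \<in> right_mults n m \<longleftrightarrow> (\<exists>a<n. t = rmul n m a)"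
  unfolding right_mults_def by auto

lemma is_loopD:
  assumes "is_loop n m"
  shows "x < n \<Longrightarrow> y < n \<Longrightarrow> m x y < n" "\<exists>e<n. \<forall>x<n. m e x = x \<and> m x e = x"
    "a < n \<Longrightarrow> b < n \<Longrightarrow> \<exists>!x. x < n \<and> m a x = b" "a < n \<Longrightarrow> b < n \<Longrightarrow> \<exists>!y. y < n \<and> m y a = b"
proof -
  have *: "(\<forall>x<n. \<forall>y<n. m x y < n) \<and> (\<exists>e<n. \<forall>x<n. m e x = x \<and> m x e = x) \<and>
     (\<forall>a<n. \<forall>b<n. (\<exists>!x. x < n \<and> m a x = b) \<and> (\<exists>!y. y < n \<and> m y a = b))"
    using assms unfolding is_loop_def .
  show "x < n \<Longrightarrow> y < n \<Longrightarrow> m x y < n" using * by simp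
  show "\<exists>e<n. \<forall>x<n. m e x = x \<and> m x e = x" using * by (elim conjE)
  show "a < n \<Longrightarrow> b < n \<Longrightarrow> \<exists>!x. x < n \<and> m a x = b" "a < n \<Longrightarrow> b < n \<Longrightarrow> \<exists>!y. y < n \<and> m y a = b"
    by (rule *[THEN conjunct2, THEN conjunct2, rule_format, THEN conjunct1]
        *[THEN conjunct2, THEN conjunct2, rule_format, THEN conjunct2]; assumption)+
qed

lemma rmul_permutes:
  assumes "is_loop n m" "a < n" shows "rmul n m a permutes {0..<n}"
proof -
  have "inj_on (rmul n m a) {0..<n}"
  proof (rule inj_onI)
    fix x y assume "x \<in> {0..<n}" "y \<in> {0..<n}" "rmul n m a x = rmul n m a y"
    then have xy: "x < n" "y < n" "m x a = m y a" by simp_all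
    have "m y a < n" using is_loopD(1)[OF assms(1) xy(2) assms(2)] .
    then show "x = y" using is_loopD(4)[OF assms(1,2), of "m y a"] xy by blast
  qed
  moreover have "rmul n m a ` {0..<n} \<subseteq> {0..<n}" using is_loopD(1)[OF assms(1) _ assms(2)] by auto
  ultimately have "rmul n m a ` {0..<n} = {0..<n}" by (intro endo_inj_surj) simp_all
  then have "bij_betw (rmul n m a) {0..<n} {0..<n}"
    using \<open>inj_on (rmul n m a) {0..<n}\<close> unfolding bij_betw_def by blast
  then show ?thesis by (rule bij_imp_permutes) (simp add: rmul_def)
qed

text \<open>Unique solvability for the right factor is sharp transitivity, unique solvability for
  the left factor makes the maps bijective, and the neutral element gives \<open>id\<close>.\<close>

lemma rcc_set_right_mults:
  assumes l: "is_loop n m" and r: "is_rcc n m"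
  shows "rcc_set {0..<n} (right_mults n m)"
proof
  obtain e where e: "e < n" "\<forall>x<n. m e x = x \<and> m x e = x" using is_loopD(2)[OF l] by blast
  show "finite {0..<n}" by simp
  show "t permutes {0..<n}" if "t \<in> right_mults n m" for t
    using that rmul_permutes[OF l] unfolding in_right_mults by blast
  have "id = rmul n m e" using e by (auto simp: rmul_def)
  then show "id \<in> right_mults n m" using e(1) unfolding in_right_mults by blast
  show "\<exists>t\<in>right_mults n m. t x = y" if "x \<in> {0..<n}" "y \<in> {0..<n}" for x y
  proof -
    have xy: "x < n" "y < n" using that by simp_all
    obtain a where "a < n" "m x a = y" using is_loopD(3)[OF l xy] by blast
    then show ?thesis using xy in_right_mults by (intro bexI[of _ "rmul n m a"]) auto
  qed
  show "s = t" if st: "s \<in> right_mults n m" "t \<in> right_mults n m" and x: "x \<in> {0..<n}" "s x = t x" for s t x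
  proof -
    obtain a where a: "a < n" "s = rmul n m a" using st(1) unfolding in_right_mults by blast
    obtain b where b: "b < n" "t = rmul n m b" using st(2) unfolding in_right_mults by blast
    have x': "m x a = m x b" "x < n" using x a b by simp_all
    moreover have "m x b < n" using is_loopD(1)[OF l x'(2) b(1)] .
    ultimately have "a = b" using is_loopD(3)[OF l, of x "m x b"] a b by blast
    then show ?thesis by (simp only: a b)
  qed
  show "\<exists>r\<in>right_mults n m. t \<circ> s = s \<circ> r" if st: "s \<in> right_mults n m" "t \<in> right_mults n m" for s t
  proof -
    obtain a where a: "a < n" "s = rmul n m a" using st(1) unfolding in_right_mults by blast
    obtain b where b: "b < n" "t = rmul n m b" using st(2) unfolding in_right_mults by blast
    obtain c where c: "c < n" "\<forall>x<n.
        inv_into {0..<n} (right_mult m a) (right_mult m b (right_mult m a x)) = right_mult m c x"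
      using r a(1) b(1) unfolding is_rcc_def by blast
    have "(t \<circ> s) x = (s \<circ> rmul n m c) x" for x
    proof (cases "x < n")
      case True
      have lt: "m x a < n" "m (m x a) b < n" "m x c < n" using is_loopD(1)[OF l] True a(1) b(1) c(1) by simp_all
      obtain y where y: "y < n" "m y a = m (m x a) b" using is_loopD(4)[OF l a(1) lt(2)] by blast
      have "m (m x a) b \<in> right_mult m a ` {0..<n}"
        using y by (intro image_eqI[of _ _ y]) (simp_all add: right_mult_def)
      from f_inv_into_f[OF this] have "m (m x c) a = m (m x a) b"
        using c(2) True by (simp add: right_mult_def)
      then show ?thesis using True lt a b by simp
    qed (simp add: a b rmul_def)
    then have "t \<circ> s = s \<circ> rmul n m c" by (rule ext)
    then show ?thesis using c(1) in_right_mults by blast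
  qed
qed

lemma conjugate_sym: 
  assumes "conjugate S T T'" shows "conjugate S T' T"
proof -
  obtain \<phi> where \<phi>: "\<phi> permutes S" "T' = conj_by \<phi> ` T" using assms by (auto simp: conjugate_def)
  have "conj_by (inv \<phi>) (conj_by \<phi> t) = t" for t
    using conj_by_comp[OF permutes_inv[OF \<phi>(1)] \<phi>(1), of t] by (simp add: permutes_inv_o(2)[OF \<phi>(1)])
  then have "T = conj_by (inv \<phi>) ` T'" using \<phi>(2) by (simp add: image_image)
  then show ?thesis using permutes_inv[OF \<phi>(1)] by (auto simp: conjugate_def)
qed

lemma conjugate_trans: 
  assumes "conjugate S T T'" "conjugate S T' T''" shows "conjugate S T T''"
proof -
  obtain \<phi> where \<phi>: "\<phi> permutes S" "T' = conj_by \<phi> ` T" using assms by (auto simp: conjugate_def)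
  obtain \<psi> where \<psi>: "\<psi> permutes S" "T'' = conj_by \<psi> ` T'" using assms by (auto simp: conjugate_def)
  have "T'' = conj_by (\<psi> \<circ> \<phi>) ` T" using \<phi> \<psi> by (simp add: image_image conj_by_comp)
  then show ?thesis using permutes_compose[OF \<phi>(1) \<psi>(1)] by (auto simp: conjugate_def)
qed

text \<open>No base point is needed: conjugating by an element of the second set moves the image of the
  neutral element to the neutral element.\<close>

lemma loop_iso_iff_conjugate:
  assumes l: "is_loop n m" "is_rcc n m" and l': "is_loop n m'" "is_rcc n m'"
  shows "loop_iso n m m' \<longleftrightarrow> conjugate {0..<n} (right_mults n m) (right_mults n m')"
proof
  assume "loop_iso n m m'"
  then obtain f where f: "bij_betw f {0..<n} {0..<n}" "\<And>x y. x < n \<Longrightarrow> y < n \<Longrightarrow> f (m x y) = m' (f x) (f y)"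
    by (auto simp: loop_iso_def)
  define \<phi> where "\<phi> x = (if x < n then f x else x)" for x
  have "bij_betw \<phi> {0..<n} {0..<n}" 
    using f(1) bij_betw_cong[of "{0..<n}" \<phi> f] by (simp add: \<phi>_def)
  then have \<phi>: "\<phi> permutes {0..<n}" by (rule bij_imp_permutes) (simp add: \<phi>_def)
  have fn: "f x < n" if "x < n" for x using f(1) that by (auto simp: bij_betw_def)
  have "conj_by \<phi> (rmul n m a) = rmul n m' (f a)" if a: "a < n" for a
  proof -
    have "(\<phi> \<circ> rmul n m a) x = (rmul n m' (f a) \<circ> \<phi>) x" for x
      using f(2)[of x a] is_loopD(1)[OF l(1), of x a] fn[of x] a by (simp add: \<phi>_def rmul_def)
    then show ?thesis using conj_by_eq_iff[OF \<phi>] by blast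
  qed
  then have "conj_by \<phi> ` right_mults n m = (\<lambda>a. rmul n m' (f a)) ` {0..<n}"
    unfolding right_mults_def image_image by (intro image_cong) auto
  also have "\<dots> = rmul n m' ` f ` {0..<n}" by (simp only: image_image)
  also have "f ` {0..<n} = {0..<n}" using f(1) by (simp add: bij_betw_def)
  finally show "conjugate {0..<n} (right_mults n m) (right_mults n m')"
    using \<phi> unfolding conjugate_def right_mults_def by blast
next
  assume "conjugate {0..<n} (right_mults n m) (right_mults n m')"
  then obtain \<phi> where \<phi>: "\<phi> permutes {0..<n}" "right_mults n m' = conj_by \<phi> ` right_mults n m"
    by (auto simp: conjugate_def)
  interpret M': rcc_set "{0..<n}" "right_mults n m'" by (rule rcc_set_right_mults[OF l'])
  obtain e where e: "e < n" "\<And>x. x < n \<Longrightarrow> m e x = x" using is_loopD(2)[OF l(1)] by blast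
  obtain e' where e': "e' < n" "\<And>x. x < n \<Longrightarrow> m' e' x = x" using is_loopD(2)[OF l'(1)] by blast
  have "\<phi> e \<in> {0..<n}" "e' \<in> {0..<n}" using e e' permutes_in_image[OF \<phi>(1)] by simp_all
  then obtain t where t: "t \<in> right_mults n m'" "t (\<phi> e) = e'" using M'.transitive by blast
  have tp: "t permutes {0..<n}" using M'.perm t by blast
  define \<psi> where "\<psi> = t \<circ> \<phi>"
  have \<psi>: "\<psi> permutes {0..<n}" unfolding \<psi>_def using permutes_compose[OF \<phi>(1) tp] .
  have \<psi>n: "\<psi> x < n" if "x < n" for x using permutes_in_image[OF \<psi>, of x] that by simp
  have \<psi>T: "conj_by \<psi> r \<in> right_mults n m'" if "r \<in> right_mults n m" for r
  proof -
    have "conj_by \<phi> r \<in> right_mults n m'" using that \<phi>(2) by blast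
    then have "conj_by t (conj_by \<phi> r) \<in> right_mults n m'"
      using M'.in_normalizes[OF t(1)] by (auto simp: normalizes_def)
    then show ?thesis using conj_by_comp[OF tp \<phi>(1)] by (simp add: \<psi>_def)
  qed
  have "\<psi> (m x y) = m' (\<psi> x) (\<psi> y)" if xy: "x < n" "y < n" for x y
  proof -
    have "rmul n m y \<in> right_mults n m" using xy in_right_mults by blast
    then have c: "conj_by \<psi> (rmul n m y) \<in> right_mults n m'" by (rule \<psi>T)
    have R': "rmul n m' (\<psi> y) \<in> right_mults n m'" using \<psi>n[OF xy(2)] in_right_mults by blast
    have "\<psi> e = e'" using t by (simp add: \<psi>_def)
    then have "conj_by \<psi> (rmul n m y) e' = \<psi> y"
      using conj_by_apply[OF \<psi>, of "rmul n m y" e] e xy by simp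
    moreover have "rmul n m' (\<psi> y) e' = \<psi> y" using e' \<psi>n[OF xy(2)] by simp
    ultimately have "conj_by \<psi> (rmul n m y) = rmul n m' (\<psi> y)" using M'.sharp[OF c R'] e'(1) by simp
    then have "\<psi> (rmul n m y x) = rmul n m' (\<psi> y) (\<psi> x)" using conj_by_apply[OF \<psi>, of "rmul n m y" x] by simp
    then show ?thesis using xy \<psi>n by simp
  qed
  moreover have "bij_betw \<psi> {0..<n} {0..<n}" using \<psi> by (rule permutes_imp_bij)
  ultimately show "loop_iso n m m'" unfolding loop_iso_def by blast
qed

text \<open>The point 0 is made neutral: right multiplication by \<open>y\<close> is the element of
  \<open>T\<close> that takes 0 to \<open>y\<close>.\<close>

lemma ex_loop_of_rcc_set:
  assumes n: "n > 0" and T: "rcc_set {0..<n} T"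
  obtains m where "is_loop n m" "is_rcc n m" "right_mults n m = T"
proof -
  interpret rcc_set "{0..<n}" T by (rule T)
  define el where "el y = (SOME t. t \<in> T \<and> t 0 = y)" for y
  have el: "el y \<in> T \<and> el y 0 = y" if "y < n" for y
  proof -
    have "\<exists>t. t \<in> T \<and> t 0 = y" using transitive[of 0 y] that n by auto
    then show ?thesis unfolding el_def by (rule someI_ex)
  qed
  have lt: "t x < n \<longleftrightarrow> x < n" if "t \<in> T" for t x using permutes_in_image[OF perm[OF that], of x] by simp
  have el_eq: "el (t 0) = t" if "t \<in> T" for t
    using sharp[of "el (t 0)" t 0] el[of "t 0"] lt[OF that] that n by simp
  define m where "m x y = el y x" for x y
  have "is_loop n m" unfolding is_loop_def
  proof (intro conjI allI impI)
    show "m x y < n" if "x < n" "y < n" for x y using that el lt by (simp add: m_def)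
    have "el 0 = id" using el_eq[OF id_in] by simp
    then show "\<exists>e<n. \<forall>x<n. m e x = x \<and> m x e = x" using n el by (intro exI[of _ 0]) (simp add: m_def)
    show "\<exists>!x. x < n \<and> m a x = b" if ab: "a < n" "b < n" for a b
    proof -
      obtain t where t: "t \<in> T" "t a = b" using transitive[of a b] ab by auto
      show ?thesis
      proof (rule ex1I[of _ "t 0"])
        show "t 0 < n \<and> m a (t 0) = b" using t lt n el_eq by (simp add: m_def)
        fix x assume x: "x < n \<and> m a x = b"
        then have "el x = t" using sharp[of "el x" t a] el t ab by (simp add: m_def)
        then show "x = t 0" using el x by metis
      qed
    qed
    show "\<exists>!y. y < n \<and> m y a = b" if ab: "a < n" "b < n" for a b
    proof -
      have p: "el a permutes {0..<n}" using el perm ab by blast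
      then obtain y where y: "el a y = b" by (metis permutes_surj surjD)
      then have "y < n" using lt el ab by metis
      then show ?thesis using y permutes_inj[OF p] by (intro ex1I[of _ y]) (auto simp: m_def dest: injD)
    qed
  qed
  moreover have "is_rcc n m" unfolding is_rcc_def
  proof (intro allI impI)
    fix a b assume ab: "a < n" "b < n"
    have rm: "right_mult m = el" by (simp add: right_mult_def m_def fun_eq_iff)
    obtain r where r: "r \<in> T" "el b \<circ> el a = el a \<circ> r" using conj_closed el ab by blast
    have inj: "inj_on (el a) {0..<n}" using el perm permutes_inj_on ab by blast
    have "inv_into {0..<n} (el a) (el b (el a x)) = r x" if "x < n" for x
    proof -
      have "el b (el a x) = el a (r x)" using r(2) by (metis comp_apply)
      then show ?thesis using inv_into_f_f[OF inj, of "r x"] lt[OF r(1)] that by simp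
    qed
    then show "\<exists>c<n. \<forall>x<n. inv_into {0..<n} (right_mult m a) (right_mult m b (right_mult m a x)) = right_mult m c x"
      unfolding rm using el_eq[OF r(1)] lt[OF r(1)] n by (intro exI[of _ "r 0"]) simp
  qed
  moreover have "right_mults n m = T"
  proof -
    have "rmul n m a = el a" if "a < n" for a
    proof
      fix x
      have "x \<notin> {0..<n} \<Longrightarrow> el a x = x" using permutes_not_in[OF perm] el[OF that] by blast
      then show "rmul n m a x = el a x" by (auto simp: rmul_def m_def)
    qed
    then have "right_mults n m = el ` {0..<n}" unfolding right_mults_def by (intro image_cong) auto
    also have "\<dots> = T"
    proof (intro equalityI subsetI)
      fix t assume "t \<in> T"
      then show "t \<in> el ` {0..<n}" using el_eq lt n by (intro image_eqI[of _ _ "t 0"]) simp_all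
    qed (use el in auto)
    finally show ?thesis .
  qed
  ultimately show thesis using that by blast
qed

section \<open>From isomorphism types of loops to conjugacy classes in an indexed family\<close>

lemma card_image_eq:
  assumes "\<And>x y. x \<in> J \<Longrightarrow> y \<in> J \<Longrightarrow> f x = f y \<longleftrightarrow> g x = g y"
  shows "card (f ` J) = card (g ` J)"
proof -
  have "bij_betw (\<lambda>c. g (inv_into J f c)) (f ` J) (g ` J)"
    unfolding bij_betw_def
  proof
    have i: "inv_into J f (f x) \<in> J" "f (inv_into J f (f x)) = f x" if "x \<in> J" for x
      using that by (simp_all add: inv_into_into f_inv_into_f)
    have gi: "g (inv_into J f (f x)) = g x" if "x \<in> J" for x
      using assms[OF i(1)[OF that] that] i(2)[OF that] by simp
    show "inj_on (\<lambda>c. g (inv_into J f c)) (f ` J)" using gi assms by (auto simp: inj_on_def)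
    show "(\<lambda>c. g (inv_into J f c)) ` f ` J = g ` J" using gi by (auto simp: image_image cong: image_cong_simp)
  qed
  then show ?thesis by (rule bij_betw_same_card)
qed

lemma loop_iso_refl: "loop_iso n m m"
  unfolding loop_iso_def by (intro exI[of _ id]) simp

lemma loop_iso_trans:
  assumes "loop_iso n m1 m2" "loop_iso n m2 m3" shows "loop_iso n m1 m3"
proof -
  obtain f where f: "bij_betw f {0..<n} {0..<n}" "\<And>x y. x < n \<Longrightarrow> y < n \<Longrightarrow> f (m1 x y) = m2 (f x) (f y)"
    using assms(1) by (auto simp: loop_iso_def)
  obtain g where g: "bij_betw g {0..<n} {0..<n}" "\<And>x y. x < n \<Longrightarrow> y < n \<Longrightarrow> g (m2 x y) = m3 (g x) (g y)"
    using assms(2) by (auto simp: loop_iso_def)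
  have "f x < n" if "x < n" for x using f(1) that by (auto simp: bij_betw_def)
  then show ?thesis unfolding loop_iso_def
    using bij_betw_trans[OF f(1) g(1)] f(2) g(2) by (intro exI[of _ "g \<circ> f"]) simp
qed

lemma loop_iso_sym: 
  assumes l: "is_loop n m1" and i: "loop_iso n m1 m2" shows "loop_iso n m2 m1"
proof -
  obtain f where f: "bij_betw f {0..<n} {0..<n}" "\<And>x y. x < n \<Longrightarrow> y < n \<Longrightarrow> f (m1 x y) = m2 (f x) (f y)"
    using i by (auto simp: loop_iso_def)
  let ?g = "inv_into {0..<n} f"
  have g: "bij_betw ?g {0..<n} {0..<n}" using f(1) by (rule bij_betw_inv_into)
  have gf: "?g (f x) = x" if "x < n" for x using f(1) that by (simp add: bij_betw_inv_into_left)
  have fg: "f (?g x) = x" "?g x < n" if "x < n" for x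
    using f(1) g that by (auto simp: bij_betw_inv_into_right bij_betw_def)
  have "?g (m2 x y) = m1 (?g x) (?g y)" if xy: "x < n" "y < n" for x y
  proof -
    have "f (m1 (?g x) (?g y)) = m2 x y" using f(2) fg xy by simp
    moreover have "m1 (?g x) (?g y) < n" using is_loopD(1)[OF l] fg xy by simp
    ultimately show ?thesis using gf by metis
  qed
  then show ?thesis unfolding loop_iso_def using g by blast
qed

text \<open>Replaces tables, which are infinitely many because of their values outside the carrier,
  by parameters: every class of loops contains one built from some \<open>h j\<close>, and two of
  these are isomorphic iff the sets are conjugate.\<close>

theorem num_rcc_loops_eq:
  assumes n: "n > 0" and h: "\<And>j. j \<in> J \<Longrightarrow> rcc_set {0..<n} (h j)"
    and ex: "\<And>T. rcc_set {0..<n} T \<Longrightarrow> \<exists>j\<in>J. conjugate {0..<n} (h j) T"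
  shows "num_rcc_loops n = card ((\<lambda>j. {i \<in> J. conjugate {0..<n} (h j) (h i)}) ` J)"
proof -
  let ?A = "{m. is_loop n m \<and> is_rcc n m}" and ?R = "{(m, m'). loop_iso n m m'}"
  have "\<exists>m. is_loop n m \<and> is_rcc n m \<and> right_mults n m = h j" if "j \<in> J" for j
    using ex_loop_of_rcc_set[OF n h[OF that]] by metis
  then obtain g where g: "\<And>j. j \<in> J \<Longrightarrow> is_loop n (g j) \<and> is_rcc n (g j) \<and> right_mults n (g j) = h j"
    by metis
  \<comment> \<open>\<open>?R\<close> relates arbitrary tables and need not be symmetric among them;
    symmetry is available for pairs whose first table is a loop.\<close>
  have eq: "?R `` {m} = ?R `` {m'} \<longleftrightarrow> loop_iso n m m'" if "m \<in> ?A" for m m'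
  proof
    assume "?R `` {m} = ?R `` {m'}"
    then have "m' \<in> ?R `` {m}" using loop_iso_refl[of n m'] by blast
    then show "loop_iso n m m'" by simp
  next
    assume "loop_iso n m m'"
    then show "?R `` {m} = ?R `` {m'}" using loop_iso_sym loop_iso_trans that by blast
  qed
  have "?A // ?R = (\<lambda>j. ?R `` {g j}) ` J"
  proof (intro equalityI subsetI)
    fix C assume "C \<in> ?A // ?R"
    then obtain m where m: "m \<in> ?A" "C = ?R `` {m}" by (auto elim: quotientE)
    then obtain j where j: "j \<in> J" "conjugate {0..<n} (h j) (right_mults n m)"
      using ex rcc_set_right_mults by blast
    then have "loop_iso n (g j) m" using loop_iso_iff_conjugate g m by auto
    then have "C = ?R `` {g j}" using eq[of "g j" m] g[OF j(1)] m by simp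
    then show "C \<in> (\<lambda>j. ?R `` {g j}) ` J" using j by blast
  next
    fix C assume "C \<in> (\<lambda>j. ?R `` {g j}) ` J"
    then obtain j where j: "j \<in> J" "C = ?R `` {g j}" by (elim imageE)
    then have "g j \<in> ?A" using g by simp
    then show "C \<in> ?A // ?R" unfolding j(2) by (rule quotientI)
  qed
  moreover have "card ((\<lambda>j. ?R `` {g j}) ` J) = card ((\<lambda>j. {i \<in> J. conjugate {0..<n} (h j) (h i)}) ` J)"
  proof (rule card_image_eq)
    fix i j assume ij: "i \<in> J" "j \<in> J"
    have "?R `` {g i} = ?R `` {g j} \<longleftrightarrow> loop_iso n (g i) (g j)" using eq[of "g i"] g ij by simp
    also have "\<dots> \<longleftrightarrow> conjugate {0..<n} (h i) (h j)" using loop_iso_iff_conjugate g ij by metis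
    also have "\<dots> \<longleftrightarrow> {k \<in> J. conjugate {0..<n} (h i) (h k)} = {k \<in> J. conjugate {0..<n} (h j) (h k)}"
    proof
      assume "conjugate {0..<n} (h i) (h j)"
      then show "{k \<in> J. conjugate {0..<n} (h i) (h k)} = {k \<in> J. conjugate {0..<n} (h j) (h k)}"
        using conjugate_sym conjugate_trans by blast
    next
      assume *: "{k \<in> J. conjugate {0..<n} (h i) (h k)} = {k \<in> J. conjugate {0..<n} (h j) (h k)}"
      have "conjugate {0..<n} (h j) (h j)" using loop_iso_iff_conjugate g ij(2) loop_iso_refl by metis
      then show "conjugate {0..<n} (h i) (h j)" using * ij by blast
    qed
    finally show "?R `` {g i} = ?R `` {g j} \<longleftrightarrow>
      {k \<in> J. conjugate {0..<n} (h i) (h k)} = {k \<in> J. conjugate {0..<n} (h j) (h k)}" .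
  qed
  ultimately show ?thesis unfolding num_rcc_loops_def by simp
qed

section \<open>Burnside's lemma for a cyclic group\<close>

text \<open>Pairs of an exponent \<open>k\<close> and a point fixed by \<open>A ^^ k\<close> are
  counted in two ways; within one orbit the stabilisers of the points contribute \<open>q\<close> in
  total.\<close>

lemma burnside_cyclic:
  assumes fin: "finite Y" and q: "q > 0" and A: "\<And>y. y \<in> Y \<Longrightarrow> A y \<in> Y" "\<And>y. y \<in> Y \<Longrightarrow> (A ^^ q) y = y"
  shows "q * card ((\<lambda>y. {x \<in> Y. \<exists>k. x = (A ^^ k) y}) ` Y) = (\<Sum>k = 1..q. card {y \<in> Y. (A ^^ k) y = y})"
proof -
  define orb where "orb y = {x \<in> Y. \<exists>k. x = (A ^^ k) y}" for y
  have AkY: "(A ^^ k) y \<in> Y" if "y \<in> Y" for k y using that A(1) by (induction k) auto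
  have red: "(A ^^ (k mod q)) y = (A ^^ k) y" if "y \<in> Y" for k y using funpow_mod_eq[OF A(2)[OF that]] .
  have inv: "\<exists>l. (A ^^ l) ((A ^^ k) y) = y" if "y \<in> Y" for k y
  proof -
    \<comment> \<open>The exponent completes \<open>k\<close> to a multiple of \<open>q\<close>,
      where the iterate is the identity.\<close>
    have "(A ^^ (q * k - k)) ((A ^^ k) y) = (A ^^ (q * k - k + k)) y" by (simp add: funpow_add)
    also have "q * k - k + k = q * k" using q by (cases q) simp_all
    also have "(A ^^ (q * k)) y = y" using red[OF that, of "q * k"] by simp
    finally show ?thesis by blast
  qed
  have orb_eq: "orb x = orb y" if "y \<in> Y" "x \<in> orb y" for x y
  proof -
    obtain k where k: "x = (A ^^ k) y" using \<open>x \<in> orb y\<close> by (auto simp: orb_def)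
    obtain l where l: "(A ^^ l) x = y" using inv[OF \<open>y \<in> Y\<close>] k by blast
    have "(\<exists>m. w = (A ^^ m) x) \<longleftrightarrow> (\<exists>m. w = (A ^^ m) y)" for w
      using k l by (metis comp_apply funpow_add)
    then show ?thesis by (simp add: orb_def)
  qed
  have self: "y \<in> orb y" if "y \<in> Y" for y using that by (auto simp: orb_def intro: exI[of _ 0])
  \<comment> \<open>The number of exponents below \<open>q\<close> that take \<open>y\<close> to
    \<open>x\<close>. It does not decrease along the orbit, hence is constant on it, so the
    stabiliser size \<open>N x x\<close> may be replaced by \<open>N y x\<close>; these sum to
    \<open>q\<close> because each exponent has one target.\<close>
  define N where "N y x = card {k \<in> {..<q}. (A ^^ k) y = x}" for y x
  have N_le: "N y x \<le> N y (( A ^^ m) x)" if y: "y \<in> Y" for x y m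
    unfolding N_def
  proof (rule card_inj_on_le)
    show "inj_on (\<lambda>k. (k + m) mod q) {k \<in> {..<q}. (A ^^ k) y = x}"
    proof (rule inj_onI)
      fix a b assume "a \<in> {k \<in> {..<q}. (A ^^ k) y = x}" "b \<in> {k \<in> {..<q}. (A ^^ k) y = x}" "(a + m) mod q = (b + m) mod q"
      then have "[a + m = b + m] (mod q)" "a < q" "b < q" by (simp_all add: cong_def)
      then show "a = b" by (simp add: cong_add_rcancel_nat cong_less_modulus_unique_nat)
    qed
    show "(\<lambda>k. (k + m) mod q) ` {k \<in> {..<q}. (A ^^ k) y = x} \<subseteq> {k \<in> {..<q}. (A ^^ k) y = (A ^^ m) x}"
    proof (rule image_subsetI)
      fix k assume "k \<in> {k \<in> {..<q}. (A ^^ k) y = x}"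
      then have "(A ^^ k) y = x" by simp
      moreover have "(A ^^ ((k + m) mod q)) y = (A ^^ m) ((A ^^ k) y)"
        using red[OF y, of "m + k"] by (simp add: funpow_add add.commute[of k m])
      ultimately show "(k + m) mod q \<in> {k \<in> {..<q}. (A ^^ k) y = (A ^^ m) x}" using q by simp
    qed
  qed simp
  have N_self: "N x x = N y x" if y: "y \<in> Y" and x: "x \<in> orb y" for x y
  proof -
    obtain k where k: "x = (A ^^ k) y" using x by (auto simp: orb_def)
    obtain l where l: "(A ^^ l) x = y" using inv[OF y] k by blast
    have "N y y = N y x"
      using N_le[OF y, of y k] N_le[OF y, of x l] k l by simp
    moreover have "(A ^^ m) y = y \<longleftrightarrow> (A ^^ m) x = x" for m
      using k l by (metis add.commute comp_apply funpow_add)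
    then have "N y y = N x x" by (simp add: N_def)
    ultimately show ?thesis by simp
  qed
  have total: "(\<Sum>x\<in>orb y. N y x) = q" if y: "y \<in> Y" for y
  proof -
    have "(\<Sum>x\<in>orb y. N y x) = card (\<Union>x\<in>orb y. {k \<in> {..<q}. (A ^^ k) y = x})"
      unfolding N_def using fin by (intro card_UN_disjoint [symmetric]) (auto simp: orb_def)
    also have "(\<Union>x\<in>orb y. {k \<in> {..<q}. (A ^^ k) y = x}) = {..<q}"
      using AkY[OF y] by (auto simp: orb_def)
    finally show ?thesis by simp
  qed
  \<comment> \<open>The exponents start at 1 to match the sum in the final formula; \<open>q\<close>
    takes the place of 0.\<close>
  have "(\<Sum>k = 1..q. card {y \<in> Y. (A ^^ k) y = y}) = (\<Sum>k<q. card {y \<in> Y. (A ^^ k) y = y})"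
  proof -
    have "{y \<in> Y. (A ^^ q) y = y} = {y \<in> Y. (A ^^ 0) y = y}" using A(2) by auto
    moreover have "{1..q} = insert q {1..<q}" "{..<q} = insert 0 {1..<q}" using q by auto
    ultimately show ?thesis by simp
  qed
  also have "\<dots> = (\<Sum>k<q. \<Sum>y\<in>Y. if (A ^^ k) y = y then 1 else 0)"
    using fin by (simp add: sum.If_cases Int_def)
  also have "\<dots> = (\<Sum>y\<in>Y. \<Sum>k<q. if (A ^^ k) y = y then 1 else 0)"
    by (rule sum.swap)
  also have "\<dots> = (\<Sum>y\<in>Y. N y y)"
    by (simp add: N_def sum.If_cases Int_def)
  also have "\<dots> = (\<Sum>C\<in>orb ` Y. \<Sum>x\<in>{x \<in> Y. orb x = C}. N x x)"
    by (rule sum.image_gen[OF fin])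
  also have "\<dots> = (\<Sum>C\<in>orb ` Y. q)"
  proof (rule sum.cong[OF refl])
    fix C assume "C \<in> orb ` Y"
    then obtain y where y: "y \<in> Y" "C = orb y" by blast
    have "orb y \<subseteq> Y" by (auto simp: orb_def)
    then have "{x \<in> Y. orb x = C} = orb y" unfolding y(2) using self orb_eq[OF y(1)] by blast
    then have "(\<Sum>x\<in>{x \<in> Y. orb x = C}. N x x) = (\<Sum>x\<in>orb y. N y x)"
      using N_self[OF y(1)] by (intro sum.cong) auto
    then show "(\<Sum>x\<in>{x \<in> Y. orb x = C}. N x x) = q" using total[OF y(1)] by simp
  qed
  finally show ?thesis unfolding orb_def by (simp add: mult.commute)
qed

section \<open>Involutions of the nonzero residues\<close>

lemma funpow_ncycle: "(ncycle q ^^ k) i = (if i < q then (i + k) mod q else i)"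
proof (induction k)
  case (Suc k)
  then show ?case by (auto simp: ncycle_def mod_Suc_eq)
qed simp

lemma ncycle_permutes: "ncycle q permutes {0..<q}"
proof -
  have "inj_on (ncycle q) {0..<q}"
  proof (rule inj_onI)
    fix i j assume *: "i \<in> {0..<q}" "j \<in> {0..<q}" "ncycle q i = ncycle q j"
    then have "[i + 1 = j + 1] (mod q)" by (simp add: ncycle_def cong_def)
    then have "[i = j] (mod q)" by (simp only: cong_add_rcancel_nat)
    then show "i = j" using * by (simp add: cong_less_modulus_unique_nat)
  qed
  moreover have "ncycle q ` {0..<q} \<subseteq> {0..<q}" by (auto simp: ncycle_def)
  ultimately have "ncycle q ` {0..<q} = {0..<q}" by (intro endo_inj_surj) simp_all
  then have "bij_betw (ncycle q) {0..<q} {0..<q}"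
    using \<open>inj_on (ncycle q) {0..<q}\<close> unfolding bij_betw_def by blast
  then show ?thesis by (rule bij_imp_permutes) (simp add: ncycle_def)
qed

lemma involution_permutes:
  assumes "\<tau> \<circ> \<tau> = id" "\<And>x. x \<notin> S \<Longrightarrow> \<tau> x = x" shows "\<tau> permutes S"
proof -
  have "\<tau> (\<tau> x) = x" for x using assms(1) by (metis comp_apply id_apply)
  then show ?thesis unfolding permutes_def using assms(2) by metis
qed

locale primitive_root =
  fixes p g q :: nat
  assumes p: "prime p" and q_def: "q = p - 1" and g: "residue_primroot p g"
begin

definition G :: "nat \<Rightarrow> int" where "G k = int g ^ k"

lemma p1: "p > 1" using p by (rule prime_gt_1_nat)

lemma q0: "q > 0" using p1 by (simp add: q_def)

lemma G_eq_iff: "[G i = G j] (mod int p) \<longleftrightarrow> [i = j] (mod q)"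
proof -
  have "coprime p g" "ord p g = q" using g p by (simp_all add: residue_primroot_def totient_prime q_def)
  then have "[g ^ i = g ^ j] (mod p) \<longleftrightarrow> [i = j] (mod q)" using order_divides_expdiff by metis
  then show ?thesis by (simp add: G_def flip: cong_int_iff)
qed

lemma G_add: "G (i + j) = G i * G j"
  by (simp add: G_def power_add)

lemma G_ndvd: "\<not> int p dvd G k"
proof
  assume "int p dvd G k"
  then have "p dvd g" using p by (simp add: G_def prime_dvd_power flip: of_nat_power)
  moreover have "coprime p g" using g by (simp add: residue_primroot_def)
  ultimately show False using p1 by (metis coprime_absorb_left dvd_refl nat_dvd_1_iff_1 not_less_iff_gr_or_eq)
qed

lemma G_surj:
  assumes "\<not> int p dvd x" obtains k where "k < q" "[G k = x] (mod int p)"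
proof -
  have b: "bij_betw (\<lambda>i. g ^ i mod p) {..<q} (totatives p)"
    using residue_primroot_is_generator[OF p1 g] p by (simp add: totient_prime q_def)
  define y where "y = nat (x mod int p)"
  have y: "int y = x mod int p" using p1 by (simp add: y_def)
  have "y \<in> totatives p"
  proof -
    have "y < p" using p1 by (simp add: y_def nat_less_iff)
    moreover have "y \<noteq> 0" using y assms by (auto simp: dvd_eq_mod_eq_0)
    ultimately show ?thesis using p by (simp add: totatives_prime)
  qed
  then have "y \<in> (\<lambda>i. g ^ i mod p) ` {..<q}" using bij_betw_imp_surj_on[OF b] by simp
  then obtain k where k: "k < q" "g ^ k mod p = y" by auto
  have "[G k = x] (mod int p)" using k(2) y by (simp add: G_def cong_def flip: of_nat_power zmod_int)
  then show thesis using that k(1) by blast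
qed

text \<open>The discrete logarithm to the base \<open>g\<close>, in \<open>{0..<q}\<close>; at
  multiples of \<open>p\<close> its value is unspecified.\<close>

definition ind :: "int \<Rightarrow> nat" where
  "ind x = (SOME k. k < q \<and> [G k = x] (mod int p))"

lemma ind: "\<not> int p dvd x \<Longrightarrow> ind x < q \<and> [G (ind x) = x] (mod int p)"
  unfolding ind_def by (rule someI_ex) (metis G_surj)

text \<open>\<open>\<tau>\<close> acts on exponents of the primitive root, and 0, which has no
  exponent, is fixed.\<close>

definition sig :: "(nat \<Rightarrow> nat) \<Rightarrow> int \<Rightarrow> int" where
  "sig \<tau> x = (if int p dvd x then 0 else G (\<tau> (ind x)))"

lemma sig_cong: "[x = y] (mod int p) \<Longrightarrow> sig \<tau> x = sig \<tau> y"
proof -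
  assume *: "[x = y] (mod int p)"
  then have "[G k = x] (mod int p) \<longleftrightarrow> [G k = y] (mod int p)" for k by (metis cong_sym cong_trans)
  then show ?thesis using * by (simp add: sig_def ind_def cong_dvd_iff)
qed

lemma sig_G: "sig \<tau> (G k) = G (\<tau> (k mod q))"
proof -
  have "ind (G k) < q" "[ind (G k) = k] (mod q)" using ind[OF G_ndvd] G_eq_iff by blast+
  then have "ind (G k) = k mod q" by (simp add: cong_def)
  then show ?thesis using G_ndvd by (simp add: sig_def)
qed

lemma sig_0: "int p dvd x \<Longrightarrow> sig \<tau> x = 0"
  by (simp add: sig_def)

lemma invol0_sig:
  assumes \<tau>: "\<tau> permutes {0..<q}" "\<tau> \<circ> \<tau> = id"
  shows "invol0 p (sig \<tau>)"
  unfolding invol0_def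
proof (intro conjI allI impI)
  show "[sig \<tau> i = sig \<tau> j] (mod int p)" if "[i = j] (mod int p)" for i j
    using sig_cong[OF that] by simp
  show "[sig \<tau> 0 = 0] (mod int p)" by (simp add: sig_0)
  show "[sig \<tau> (sig \<tau> i) = i] (mod int p)" for i
  proof (cases "int p dvd i")
    case True
    then have "[0 = i] (mod int p)" by (simp add: cong_iff_dvd_diff)
    then show ?thesis using True by (simp add: sig_0)
  next
    case False
    obtain k where k: "k < q" "[G k = i] (mod int p)" by (rule G_surj[OF False])
    have "\<tau> k < q" using permutes_in_image[OF \<tau>(1), of k] k(1) by simp
    moreover have "\<tau> (\<tau> k) = k" using \<tau>(2) by (metis comp_apply id_apply)
    ultimately have "sig \<tau> (sig \<tau> (G k)) = G k" using k(1) by (simp add: sig_G)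
    then show ?thesis using k(2) sig_cong[OF k(2), of \<tau>] by simp
  qed
qed

lemma ex_sig:
  assumes \<sigma>: "invol0 p \<sigma>"
  obtains \<tau> where "\<tau> permutes {0..<q}" "\<tau> \<circ> \<tau> = id" "\<And>x. [\<sigma> x = sig \<tau> x] (mod int p)"
proof -
  have c: "[\<sigma> i = \<sigma> j] (mod int p)" if "[i = j] (mod int p)" for i j
    using \<sigma> that by (simp add: invol0_def)
  have i: "[\<sigma> (\<sigma> i) = i] (mod int p)" "[\<sigma> 0 = 0] (mod int p)" for i using \<sigma> by (simp_all add: invol0_def)
  \<comment> \<open>An involution that fixes the residue 0 preserves the nonzero residues, so the
    logarithm of \<open>\<sigma> (G k)\<close> makes sense.\<close>
  have nd: "\<not> int p dvd \<sigma> x" if "\<not> int p dvd x" for x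
  proof
    assume "int p dvd \<sigma> x"
    then have "[\<sigma> x = 0] (mod int p)" by (simp add: cong_0_iff)
    then have "[\<sigma> (\<sigma> x) = \<sigma> 0] (mod int p)" by (rule c)
    then have "[x = 0] (mod int p)" using i by (meson cong_sym cong_trans)
    then show False using that by (simp add: cong_0_iff)
  qed
  define \<tau> where "\<tau> k = (if k < q then ind (\<sigma> (G k)) else k)" for k
  have \<tau>k: "\<tau> k < q" "[G (\<tau> k) = \<sigma> (G k)] (mod int p)" if "k < q" for k
    using ind[OF nd[OF G_ndvd[of k]]] that by (simp_all add: \<tau>_def)
  have "\<tau> (\<tau> k) = k" for k
  proof (cases "k < q")
    case True
    have "[G (\<tau> (\<tau> k)) = \<sigma> (G (\<tau> k))] (mod int p)" using \<tau>k[OF \<tau>k(1)[OF True]] by simp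
    also have "[\<sigma> (G (\<tau> k)) = \<sigma> (\<sigma> (G k))] (mod int p)" using c \<tau>k(2)[OF True] by blast
    also have "[\<sigma> (\<sigma> (G k)) = G k] (mod int p)" using i by blast
    finally have "[\<tau> (\<tau> k) = k] (mod q)" by (simp only: G_eq_iff)
    then show ?thesis using True \<tau>k(1)[OF \<tau>k(1)[OF True]] by (simp add: cong_less_modulus_unique_nat)
  qed (simp add: \<tau>_def)
  then have tt: "\<tau> \<circ> \<tau> = id" by auto
  have tp: "\<tau> permutes {0..<q}" by (rule involution_permutes[OF tt]) (simp add: \<tau>_def)
  have "[\<sigma> x = sig \<tau> x] (mod int p)" for x
  proof (cases "int p dvd x")
    case True
    then have "[\<sigma> x = \<sigma> 0] (mod int p)" by (intro c) (simp add: cong_0_iff)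
    then show ?thesis using True i(2) by (metis cong_trans sig_0)
  next
    case False
    obtain k where k: "k < q" "[G k = x] (mod int p)" by (rule G_surj[OF False])
    have "[\<sigma> x = \<sigma> (G k)] (mod int p)" using c[OF k(2)] by (rule cong_sym)
    also have "[\<sigma> (G k) = G (\<tau> k)] (mod int p)" using \<tau>k(2)[OF k(1)] by (rule cong_sym)
    also have "G (\<tau> k) = sig \<tau> x" using sig_cong[OF k(2)] k(1) by (simp add: sig_G)
    finally show ?thesis .
  qed
  then show thesis using that tt tp by blast
qed

text \<open>Multiplication by \<open>G k\<close> adds \<open>k\<close> to exponents modulo
  \<open>q\<close>, which is the \<open>k\<close>-th power of \<open>ncycle q\<close>; at multiples
  of \<open>p\<close> both sides of the scaling relation vanish.\<close>

lemma sig_scale_iff: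
  assumes \<tau>: "\<tau> permutes {0..<q}" and \<tau>': "\<tau>' permutes {0..<q}"
  shows "(\<forall>x. [sig \<tau>' (G k * x) = G k * sig \<tau> x] (mod int p)) \<longleftrightarrow>
    \<tau>' \<circ> (ncycle q ^^ k) = (ncycle q ^^ k) \<circ> \<tau>"
proof -
  have lt: "\<tau> j < q" "\<tau>' j < q" if "j < q" for j
    using permutes_in_image[OF \<tau>, of j] permutes_in_image[OF \<tau>', of j] that by simp_all
  have one: "[sig \<tau>' (G k * G j) = G k * sig \<tau> (G j)] (mod int p) \<longleftrightarrow>
      \<tau>' ((j + k) mod q) = (\<tau> j + k) mod q" if j: "j < q" for j
  proof -
    have "[sig \<tau>' (G k * G j) = G k * sig \<tau> (G j)] (mod int p) \<longleftrightarrow> [\<tau>' ((j + k) mod q) = \<tau> j + k] (mod q)"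
      using j by (simp add: sig_G G_eq_iff add.commute flip: G_add)
    also have "\<dots> \<longleftrightarrow> \<tau>' ((j + k) mod q) = (\<tau> j + k) mod q"
      using lt(2)[of "(j + k) mod q"] q0 by (simp add: cong_def)
    finally show ?thesis .
  qed
  have out: "\<tau> j = j" "\<tau>' j = j" if "\<not> j < q" for j
    using permutes_not_in[OF \<tau>] permutes_not_in[OF \<tau>'] that by simp_all
  have "(\<forall>x. [sig \<tau>' (G k * x) = G k * sig \<tau> x] (mod int p)) \<longleftrightarrow>
      (\<forall>j<q. [sig \<tau>' (G k * G j) = G k * sig \<tau> (G j)] (mod int p))"
  proof (intro iffI allI impI)
    fix x assume *: "\<forall>j<q. [sig \<tau>' (G k * G j) = G k * sig \<tau> (G j)] (mod int p)"
    show "[sig \<tau>' (G k * x) = G k * sig \<tau> x] (mod int p)"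
    proof (cases "int p dvd x")
      case True
      then show ?thesis by (simp add: sig_0)
    next
      case False
      obtain j where j: "j < q" "[G j = x] (mod int p)" by (rule G_surj[OF False])
      have "[G k * G j = G k * x] (mod int p)" using j(2) by (rule cong_scalar_left)
      then show ?thesis using * j sig_cong by metis
    qed
  qed blast
  also have "\<dots> \<longleftrightarrow> (\<forall>j<q. \<tau>' ((j + k) mod q) = (\<tau> j + k) mod q)" using one by blast
  also have "\<dots> \<longleftrightarrow> \<tau>' \<circ> (ncycle q ^^ k) = (ncycle q ^^ k) \<circ> \<tau>"
    using lt(1) out by (auto simp: fun_eq_iff funpow_ncycle)
  finally show ?thesis .
qed

section \<open>The cyclic action whose orbits are the types in the second family\<close>

definition Y :: "((nat \<Rightarrow> nat) \<times> nat) set" where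
  "Y = {\<tau>. \<tau> permutes {0..<q} \<and> \<tau> \<circ> \<tau> = id} \<times> {..<p}"

text \<open>Scaling by the generator \<open>g\<close>, in the parameters \<open>(\<tau>, d)\<close>:
  a rotation of the exponents in the first, multiplication in the second.\<close>

definition A :: "(nat \<Rightarrow> nat) \<times> nat \<Rightarrow> (nat \<Rightarrow> nat) \<times> nat" where
  "A = (\<lambda>(\<tau>, d). (conj_by (ncycle q) \<tau>, g * d mod p))"

lemma finite_Y: "finite Y"
proof -
  have "finite {\<tau>. \<tau> permutes {0..<q} \<and> \<tau> \<circ> \<tau> = id}"
    by (rule finite_subset[OF _ finite_permutations[of "{0..<q}"]]) auto
  then show ?thesis by (simp add: Y_def)
qed

lemma A_pow:
  assumes "y \<in> Y"
  shows "(A ^^ k) y = (conj_by (ncycle q ^^ k) (fst y), g ^ k * snd y mod p)"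
proof (induction k)
  case 0
  have 1: "(A ^^ 0) y = y" by simp
  have 2: "conj_by (ncycle q ^^ 0) (fst y) = fst y" by (simp only: funpow.simps conj_by_id)
  have 3: "g ^ 0 * snd y mod p = snd y" using assms by (auto simp: Y_def)
  show ?case by (simp only: 1 2 3 prod.collapse)
next
  case (Suc k)
  have c: "conj_by (ncycle q ^^ Suc k) t = conj_by (ncycle q) (conj_by (ncycle q ^^ k) t)" for t
    using conj_by_comp[OF ncycle_permutes funpow_permutes[OF ncycle_permutes]] by simp
  have e: "g * (g ^ k * snd y mod p) mod p = g ^ Suc k * snd y mod p"
    by (simp add: mod_mult_right_eq mult.assoc)
  have "(A ^^ Suc k) y = A ((A ^^ k) y)" by simp
  also have "\<dots> = (conj_by (ncycle q) (conj_by (ncycle q ^^ k) (fst y)), g * (g ^ k * snd y mod p) mod p)"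
    unfolding Suc by (simp add: A_def)
  finally show ?case by (simp only: c e)
qed

lemma A_in_Y: "y \<in> Y \<Longrightarrow> A y \<in> Y"
  unfolding A_def Y_def using p1 conj_by_permutes[OF ncycle_permutes]
    conj_by_of_comp[OF ncycle_permutes] conj_by_id_right[OF ncycle_permutes]
  by (auto simp flip: conj_by_of_comp[OF ncycle_permutes])

lemma ncycle_pow_q: "ncycle q ^^ q = id"
  by (auto simp: fun_eq_iff funpow_ncycle)

lemma g_pow_cong: "[g ^ i = g ^ j] (mod p) \<longleftrightarrow> [i = j] (mod q)"
  using G_eq_iff[of i j] by (simp add: G_def flip: cong_int_iff)

lemma A_pow_q: "y \<in> Y \<Longrightarrow> (A ^^ q) y = y"
proof -
  assume y: "y \<in> Y"
  have "[g ^ q = g ^ 0] (mod p)" unfolding g_pow_cong by (simp add: cong_def)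
  then have "[g ^ q * snd y = 1 * snd y] (mod p)" by (intro cong_mult) simp_all
  moreover have "snd y < p" using y by (auto simp: Y_def)
  ultimately have "g ^ q * snd y mod p = snd y" by (simp add: cong_def)
  then show ?thesis using A_pow[OF y, of q] by (simp add: ncycle_pow_q)
qed

lemma eq_A_pow_iff:
  assumes y: "y \<in> Y" and x: "x \<in> Y"
  shows "x = (A ^^ k) y \<longleftrightarrow> fst x \<circ> (ncycle q ^^ k) = (ncycle q ^^ k) \<circ> fst y \<and> [int (snd x) = G k * int (snd y)] (mod int p)"
proof -
  have "fst x = conj_by (ncycle q ^^ k) (fst y) \<longleftrightarrow> fst x \<circ> (ncycle q ^^ k) = (ncycle q ^^ k) \<circ> fst y"
    using conj_by_eq_iff[OF funpow_permutes[OF ncycle_permutes[of q], of k]] by metis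
  moreover have "snd x = g ^ k * snd y mod p \<longleftrightarrow> [snd x = g ^ k * snd y] (mod p)"
    using x by (auto simp: Y_def cong_def)
  moreover have "[snd x = g ^ k * snd y] (mod p) \<longleftrightarrow> [int (snd x) = G k * int (snd y)] (mod int p)"
    by (simp add: G_def flip: cong_int_iff)
  ultimately show ?thesis unfolding A_pow[OF y] by (simp add: prod_eq_iff)
qed

lemma card_fixed:
  assumes k: "k \<in> {1..q}"
  shows "card {y \<in> Y. (A ^^ k) y = y} = I2 q k * (if k = q then p else 1)"
proof -
  let ?I = "{\<tau>. \<tau> permutes {0..<q} \<and> \<tau> \<circ> \<tau> = id \<and> \<tau> \<circ> (ncycle q ^^ k) = (ncycle q ^^ k) \<circ> \<tau>}"
  let ?D = "{d. d < p \<and> [int d = G k * int d] (mod int p)}"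
  have "{y \<in> Y. (A ^^ k) y = y} = ?I \<times> ?D"
  proof (intro equalityI subsetI)
    fix y assume "y \<in> {y \<in> Y. (A ^^ k) y = y}"
    then have y: "y \<in> Y" "y = (A ^^ k) y" by simp_all
    then show "y \<in> ?I \<times> ?D" using eq_A_pow_iff[OF y(1) y(1), of k] by (cases y) (auto simp: Y_def)
  next
    fix y assume *: "y \<in> ?I \<times> ?D"
    then have y: "y \<in> Y" by (auto simp: Y_def)
    then show "y \<in> {y \<in> Y. (A ^^ k) y = y}" using eq_A_pow_iff[OF y y, of k] * by (cases y) auto
  qed
  moreover have "card ?D = (if k = q then p else 1)"
  proof (cases "k = q")
    case True
    have "[G q = G 0] (mod int p)" unfolding G_eq_iff by (simp add: cong_def)
    then have "[int d = G q * int d] (mod int p)" for d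
      by (rule cong_comb[where k = "- int d"]) (simp add: G_def algebra_simps)
    then have "?D = {..<p}" using True by auto
    then show ?thesis using True by simp
  next
    case False
    have "d = 0" if "d < p" "[int d = G k * int d] (mod int p)" for d
    proof -
      have "int p dvd (G k - 1) * int d"
        using that(2) by (simp add: cong_iff_dvd_diff algebra_simps dvd_diff_commute)
      moreover have "\<not> int p dvd G k - 1"
      proof
        assume "int p dvd G k - 1"
        then have "[G k = G 0] (mod int p)" by (simp add: cong_iff_dvd_diff G_def)
        then have "[k = 0] (mod q)" by (simp only: G_eq_iff)
        then have "q dvd k" by (simp add: cong_0_iff)
        then show False using k False by (auto dest: dvd_imp_le)
      qed
      ultimately have "int p dvd int d" using p by (metis prime_dvd_mult_iff prime_nat_int_transfer)
      then show ?thesis using that(1) by (auto dest: dvd_imp_le)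
    qed
    then have "?D = {0}" using p1 by auto
    then show ?thesis using False by simp
  qed
  ultimately show ?thesis by (simp add: I2_def card_cartesian_product)
qed

text \<open>The identity \<open>A ^^ q\<close> contributes \<open>p * I2 q q\<close>. Since
  \<open>p = q + 1\<close>, one copy completes the sum over \<open>k\<close> and the other
  \<open>q\<close> copies become the separate summand \<open>I1 q\<close> after division by
  \<open>q\<close>.\<close>

lemma card_orbits:
  "q * card ((\<lambda>y. {x \<in> Y. \<exists>k. x = (A ^^ k) y}) ` Y) = q * I1 q + (\<Sum>k = 1..q. I2 q k)"
proof -
  have "q * card ((\<lambda>y. {x \<in> Y. \<exists>k. x = (A ^^ k) y}) ` Y) = (\<Sum>k = 1..q. card {y \<in> Y. (A ^^ k) y = y})"
    by (rule burnside_cyclic[OF finite_Y q0 A_in_Y A_pow_q])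
  also have "\<dots> = (\<Sum>k = 1..q. I2 q k * (if k = q then p else 1))"
    using card_fixed by (intro sum.cong) auto
  also have "\<dots> = (\<Sum>k = 1..q. I2 q k + (if k = q then q * I2 q q else 0))"
    using p1 by (intro sum.cong) (auto simp: q_def algebra_simps)
  also have "\<dots> = (\<Sum>k = 1..q. I2 q k) + q * I2 q q"
    using q0 by (simp add: sum.distrib)
  finally show ?thesis by (simp add: I1_def)
qed

end

section \<open>Counting\<close>

context coordinates
begin

lemma TB_cong:
  assumes "\<And>i. [\<sigma> i = \<sigma>' i] (mod int p)" "[d = d'] (mod int p)"
  shows "TB S \<kappa> \<sigma> d = TB S \<kappa> \<sigma>' d'"
proof -
  have 1: "aff \<kappa> False 1 i 1 (\<sigma> i) t \<longleftrightarrow> aff \<kappa> False 1 i 1 (\<sigma>' i) t" for i t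
    using aff_cong[of False 1 i 1 "\<sigma> i" t 1 i 1 "\<sigma>' i"] aff_cong[of False 1 i 1 "\<sigma>' i" t 1 i 1 "\<sigma> i"] assms(1)
    by (auto simp: cong_sym_eq)
  have d: "[d - u = d' - u] (mod int p)" for u using assms(2) by (rule cong_comb[where k = 1]) simp
  have 2: "aff \<kappa> True 1 u 1 (d - u) t \<longleftrightarrow> aff \<kappa> True 1 u 1 (d' - u) t" for u t
    using aff_cong[of True 1 u 1 "d - u" t 1 u 1 "d' - u"] aff_cong[of True 1 u 1 "d' - u" t 1 u 1 "d - u"] d[of u]
    by (auto simp: cong_sym_eq)
  show ?thesis unfolding TB_def 1 2 ..
qed

lemma conjugate_TA_D:
  assumes "conjugate S (TA S \<kappa> a) T"
  obtains \<kappa>' where "coordinates p S \<kappa>'" "T = TA S \<kappa>' a"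
proof -
  obtain \<phi> where \<phi>: "\<phi> permutes S" "T = conj_by \<phi> ` TA S \<kappa> a" using assms by (auto simp: conjugate_def)
  show thesis using that[OF coordinates_perm[OF \<phi>(1)]] conj_by_TA[OF \<phi>(1)] \<phi>(2) by metis
qed

lemma conjugate_TB_D:
  assumes "conjugate S (TB S \<kappa> \<sigma> d) T"
  obtains \<kappa>' where "coordinates p S \<kappa>'" "T = TB S \<kappa>' \<sigma> d"
proof -
  obtain \<phi> where \<phi>: "\<phi> permutes S" "T = conj_by \<phi> ` TB S \<kappa> \<sigma> d" using assms by (auto simp: conjugate_def)
  show thesis using that[OF coordinates_perm[OF \<phi>(1)]] conj_by_TB[OF \<phi>(1)] \<phi>(2) by metis
qed

lemma conjugate_refl: "conjugate S T T"
  unfolding conjugate_def by (intro exI[of _ id]) simp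

end

definition std :: "nat \<Rightarrow> bool \<Rightarrow> int \<Rightarrow> nat" where
  "std p b x = nat (x mod int p) + (if b then p else 0)"

lemma coordinates_std:
  assumes p: "prime p" shows "coordinates p {0..<2 * p} (std p)"
proof
  have p0: "int p > 0" using p by (simp add: prime_gt_0_nat)
  have lt: "nat (x mod int p) < p" for x using p0 by (simp add: nat_less_iff)
  show "prime p" by (rule p)
  show "std p b x = std p c y \<longleftrightarrow> b = c \<and> [x = y] (mod int p)" for b x c y
  proof (cases "b = c")
    case True
    then show ?thesis using p0 by (simp add: std_def cong_def eq_nat_nat_iff)
  next
    case False
    then show ?thesis using lt[of x] lt[of y] by (cases b; cases c) (simp_all add: std_def)
  qed
  show "{0..<2 * p} = {std p b x | b x. True}"
  proof (intro equalityI subsetI)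
    fix y assume y: "y \<in> {0..<2 * p}"
    have "y = std p (p \<le> y) (int (if p \<le> y then y - p else y))"
      using y by (auto simp: std_def nat_mod_as_int [symmetric] simp flip: zmod_int)
    then show "y \<in> {std p b x | b x. True}" by blast
  next
    fix y assume "y \<in> {std p b x | b x. True}"
    then obtain b x where "y = std p b x" by blast
    then show "y \<in> {0..<2 * p}" using lt[of x] by (cases b) (auto simp: std_def)
  qed
qed

locale rcc_count = primitive_root + coordinates p "{0..<2 * p}" \<kappa> for \<kappa>
begin

abbreviation S where "S \<equiv> {0..<2 * p}"

definition hA :: "int \<Rightarrow> (nat \<Rightarrow> nat) set" where "hA a = TA S \<kappa> a"

definition hB :: "(nat \<Rightarrow> nat) \<times> nat \<Rightarrow> (nat \<Rightarrow> nat) set" where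
  "hB y = TB S \<kappa> (sig (fst y)) (int (snd y))"

lemma a_ndvd: "a \<in> {1..int p - 2} \<Longrightarrow> \<not> int p dvd a \<and> \<not> int p dvd a + 1"
  by (auto dest: zdvd_imp_le)

text \<open>A parameter of the first family exists only for \<open>p > 2\<close>; so comparisons
  that involve this family always concern odd \<open>p\<close>.\<close>

lemma odd_p: "a \<in> {1..int p - 2} \<Longrightarrow> odd p"
  using prime_odd_nat[OF p] by simp

lemma invol_Y: "y \<in> Y \<Longrightarrow> invol0 p (sig (fst y))"
  by (auto simp: Y_def intro: invol0_sig)

lemma rcc_hA: "a \<in> {1..int p - 2} \<Longrightarrow> rcc_set S (hA a)"
  unfolding hA_def using rcc_TA a_ndvd by blast

lemma rcc_hB: "y \<in> Y \<Longrightarrow> rcc_set S (hB y)"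
  unfolding hB_def by (intro rcc_TB invol_Y)

lemma conj_hA_hA:
  assumes "a \<in> {1..int p - 2}" "b \<in> {1..int p - 2}" "conjugate S (hA a) (hA b)" shows "a = b"
proof -
  obtain \<kappa>' where k: "coordinates p S \<kappa>'" "hA b = TA S \<kappa>' a"
    using assms(3) unfolding hA_def by (rule conjugate_TA_D)
  have "[b = a] (mod int p)"
    using TA_eq_TA[OF k(1) odd_p[OF assms(1)]] a_ndvd[OF assms(2)] k(2) unfolding hA_def by blast
  then show ?thesis using assms(1,2) by (intro cong_less_imp_eq_int) (auto simp: cong_sym_eq)
qed

lemma conj_hA_hB:
  assumes "a \<in> {1..int p - 2}" "y \<in> Y" shows "\<not> conjugate S (hB y) (hA a)"
proof
  assume "conjugate S (hB y) (hA a)"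
  then obtain \<kappa>' where k: "coordinates p S \<kappa>'" "hA a = TB S \<kappa>' (sig (fst y)) (int (snd y))"
    unfolding hB_def by (rule conjugate_TB_D)
  then show False
    using TA_neq_TB[OF k(1) odd_p[OF assms(1)] _ _ invol_Y[OF assms(2)]] a_ndvd[OF assms(1)]
    unfolding hA_def by blast
qed

text \<open>For odd \<open>p\<close> conjugacy means scaling by a nonzero residue, and every nonzero
  residue is a power of \<open>g\<close>, so scalings are exactly the iterates of
  \<open>A\<close>.\<close>

lemma conj_hB_hB:
  assumes y: "y \<in> Y" and x: "x \<in> Y"
  shows "conjugate S (hB y) (hB x) \<longleftrightarrow> (\<exists>k. x = (A ^^ k) y)"
proof
  assume "\<exists>k. x = (A ^^ k) y"
  then obtain k where "x = (A ^^ k) y" by blast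
  then have k: "fst x \<circ> (ncycle q ^^ k) = (ncycle q ^^ k) \<circ> fst y" "[int (snd x) = G k * int (snd y)] (mod int p)"
    using eq_A_pow_iff[OF y x] by blast+
  have "fst y permutes {0..<q}" "fst x permutes {0..<q}" using x y by (auto simp: Y_def)
  then have "\<forall>i. [sig (fst x) (G k * i) = G k * sig (fst y) i] (mod int p)"
    using sig_scale_iff k(1) by blast
  then obtain \<kappa>' where "coordinates p S \<kappa>'" "hB x = TB S \<kappa>' (sig (fst y)) (int (snd y))"
    using TB_scale[OF G_ndvd invol_Y[OF x] _ k(2)] unfolding hB_def by blast
  then have "conjugate S (hB x) (hB y)" using conjugate_families(2) unfolding hB_def by metis
  then show "conjugate S (hB y) (hB x)" by (rule conjugate_sym)
next
  assume "conjugate S (hB y) (hB x)"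
  then obtain \<kappa>' where k: "coordinates p S \<kappa>'" "TB S \<kappa> (sig (fst x)) (int (snd x)) = TB S \<kappa>' (sig (fst y)) (int (snd y))"
    unfolding hB_def by (rule conjugate_TB_D)
  have yx: "fst y permutes {0..<q}" "fst x permutes {0..<q}" using x y by (auto simp: Y_def)
  show "\<exists>k. x = (A ^^ k) y"
  proof (cases "p = 2")
    case True
    have "[int (snd x) = int (snd y)] (mod int p)"
      using TB_eq_TB_2[OF k(1) True invol_Y[OF x] invol_Y[OF y] k(2)] .
    moreover have "snd x < p" "snd y < p" using x y by (auto simp: Y_def)
    ultimately have "snd x = snd y" by (simp add: cong_int_iff cong_less_modulus_unique_nat)
    \<comment> \<open>For \<open>p = 2\<close> there is one exponent, as \<open>q = 1\<close>, so
      only \<open>d\<close> distinguishes the members of the family.\<close>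
    moreover have "fst x = id" "fst y = id" using yx True by (simp_all add: q_def)
    ultimately have "x = (A ^^ 0) y" by (simp add: prod_eq_iff)
    then show ?thesis by blast
  next
    case False
    then have "odd p" using p by (metis prime_odd_nat le_neq_implies_less prime_ge_2_nat)
    from TB_eq_TB[OF k(1) this invol_Y[OF x] invol_Y[OF y] k(2)]
    obtain c where c: "\<not> int p dvd c" "\<And>i. [sig (fst x) (c * i) = c * sig (fst y) i] (mod int p)"
      "[int (snd x) = c * int (snd y)] (mod int p)" by blast
    obtain k where k: "[G k = c] (mod int p)" using G_surj[OF c(1)] by blast
    have "[sig (fst x) (G k * i) = G k * sig (fst y) i] (mod int p)" for i
    proof -
      have "sig (fst x) (G k * i) = sig (fst x) (c * i)" using k by (intro sig_cong cong_scalar_right)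
      also have "[sig (fst x) (c * i) = c * sig (fst y) i] (mod int p)" by (rule c(2))
      also have "[c * sig (fst y) i = G k * sig (fst y) i] (mod int p)"
        using k by (intro cong_scalar_right) (rule cong_sym)
      finally show ?thesis .
    qed
    then have "fst x \<circ> (ncycle q ^^ k) = (ncycle q ^^ k) \<circ> fst y"
      using sig_scale_iff[OF yx] by blast
    moreover have "[int (snd x) = G k * int (snd y)] (mod int p)"
      using c(3) k by (rule cong_comb2[where k = 1 and l = "- int (snd y)"]) (simp add: algebra_simps)
    ultimately show ?thesis using eq_A_pow_iff[OF y x] by blast
  qed
qed

definition h :: "int + (nat \<Rightarrow> nat) \<times> nat \<Rightarrow> (nat \<Rightarrow> nat) set" where "h = case_sum hA hB"

text \<open>The first summand is free of repetitions up to conjugacy; the second has to be counted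
  modulo \<open>A\<close>.\<close>

definition J :: "(int + (nat \<Rightarrow> nat) \<times> nat) set" where "J = {1..int p - 2} <+> Y"

lemma ex_conjugate:
  assumes T: "rcc_set S T" shows "\<exists>j\<in>J. conjugate S (h j) T"
proof -
  interpret T: rcc_set S T by (rule T)
  consider (A) L a where "coordinates p S L" "a \<in> {1..int p - 2}" "T = TA S L a"
    | (B) L \<sigma> d where "coordinates p S L" "invol0 p \<sigma>" "T = TB S L \<sigma> d"
    using T.classification[OF p] by auto
  then show ?thesis
  proof cases
    case A
    have "conjugate S T (hA a)" using conjugate_families(1)[OF A(1)] A(3) by (simp add: hA_def)
    then have "conjugate S (h (Inl a)) T" by (simp add: conjugate_sym h_def)
    then show ?thesis using A(2) unfolding J_def by blast
  next
    case B
    interpret L: coordinates p S L by (rule B(1))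
    obtain \<tau> where \<tau>: "\<tau> permutes {0..<q}" "\<tau> \<circ> \<tau> = id" "\<And>x. [\<sigma> x = sig \<tau> x] (mod int p)"
      using ex_sig[OF B(2)] by blast
    define e where "e = nat (d mod int p)"
    have e: "e < p" "[d = int e] (mod int p)" using p1 by (simp_all add: e_def nat_less_iff)
    have "T = TB S L (sig \<tau>) (int e)" using B(3) L.TB_cong[OF \<tau>(3) e(2)] by simp
    then have "conjugate S T (hB (\<tau>, e))" using conjugate_families(2)[OF B(1)] by (simp add: hB_def)
    then have "conjugate S (h (Inr (\<tau>, e))) T" by (simp add: conjugate_sym h_def)
    moreover have "(\<tau>, e) \<in> Y" using \<tau> e by (simp add: Y_def)
    ultimately show ?thesis unfolding J_def by blast
  qed
qed

lemma rcc_h: "j \<in> J \<Longrightarrow> rcc_set S (h j)"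
  by (auto simp: J_def h_def rcc_hA rcc_hB)

text \<open>Conjugacy classes of parameters are singletons in the first family and orbits of
  \<open>A\<close> in the second, and they never mix. The factor \<open>q\<close> keeps Burnside's
  count in the natural numbers.\<close>

lemma num_rcc_loops: "q * num_rcc_loops (2 * p) = q * (p - 2) + (q * I1 q + (\<Sum>k = 1..q. I2 q k))"
proof -
  define cls where "cls j = {i \<in> J. conjugate S (h j) (h i)}" for j
  define orb where "orb y = {x \<in> Y. \<exists>k. x = (A ^^ k) y}" for y
  have clsA: "cls (Inl a) = {Inl a}" if a: "a \<in> {1..int p - 2}" for a
  proof (intro equalityI subsetI)
    fix i assume "i \<in> cls (Inl a)"
    then have i: "i \<in> J" "conjugate S (hA a) (h i)" by (simp_all add: cls_def h_def)
    show "i \<in> {Inl a}"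
    proof (cases i)
      case (Inl b)
      then show ?thesis using conj_hA_hA[OF a, of b] i by (auto simp: J_def h_def)
    next
      case (Inr y)
      then show ?thesis using conj_hA_hB[OF a, of y] i conjugate_sym by (auto simp: J_def h_def)
    qed
  qed (use a conjugate_refl in \<open>auto simp: cls_def J_def\<close>)
  have clsB: "cls (Inr y) = (Inr ` orb y :: (int + (nat \<Rightarrow> nat) \<times> nat) set)" if y: "y \<in> Y" for y
  proof (intro equalityI subsetI)
    fix i assume "i \<in> cls (Inr y)"
    then have i: "i \<in> J" "conjugate S (hB y) (h i)" by (simp_all add: cls_def h_def)
    show "i \<in> Inr ` orb y"
    proof (cases i)
      case (Inl b)
      then show ?thesis using conj_hA_hB[OF _ y, of b] i by (auto simp: J_def h_def)
    next
      case (Inr x)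
      then show ?thesis using conj_hB_hB[OF y, of x] i by (auto simp: J_def h_def orb_def)
    qed
  next
    fix i :: "int + (nat \<Rightarrow> nat) \<times> nat" assume "i \<in> Inr ` orb y"
    then obtain x where "i = Inr x" "x \<in> orb y" by blast
    then show "i \<in> cls (Inr y)" using conj_hB_hB[OF y, of x] by (auto simp: cls_def J_def h_def orb_def)
  qed
  have "cls ` J = (\<lambda>a. {Inl a}) ` {1..int p - 2} \<union> (\<lambda>y. Inr ` orb y) ` Y"
    unfolding J_def Plus_def image_Un image_image using clsA clsB by simp
  moreover have "card ((\<lambda>a. {Inl a :: int + (nat \<Rightarrow> nat) \<times> nat}) ` {1..int p - 2}) = p - 2"
    by (subst card_image) (auto simp: inj_on_def nat_diff_distrib)
  moreover have "card ((\<lambda>y. Inr ` orb y :: (int + (nat \<Rightarrow> nat) \<times> nat) set) ` Y) = card (orb ` Y)"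
    by (rule card_image_eq) (simp add: inj_image_eq_iff)
  moreover have "(\<lambda>a. {Inl a}) ` {1..int p - 2} \<inter> (\<lambda>y. Inr ` orb y) ` Y = {}" by auto
  ultimately have "card (cls ` J) = (p - 2) + card (orb ` Y)"
    using finite_Y by (simp add: card_Un_disjoint)
  moreover have "num_rcc_loops (2 * p) = card (cls ` J)"
    unfolding cls_def using p1 rcc_h ex_conjugate by (intro num_rcc_loops_eq) auto
  ultimately show ?thesis using card_orbits unfolding orb_def by (simp add: distrib_left)
qed

end

theorem theorem6p5:
  fixes p :: nat
  assumes "prime p"
  shows "real (num_rcc_loops (2 * p)) =
           real p - 2 + real (I1 (p - 1)) + (1 / real (p - 1)) * (\<Sum>d = 1..p - 1. real (I2 (p - 1) d))"
proof -
  obtain g where g: "residue_primroot p g"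
    using prime_primitive_root_exists[OF prime_gt_1_nat assms] assms by blast
  interpret primitive_root p g "p - 1" by standard (use assms g in auto)
  interpret coordinates p "{0..<2 * p}" "std p" by (rule coordinates_std[OF assms])
  interpret rcc_count p g "p - 1" "std p" ..
  have "real ((p - 1) * num_rcc_loops (2 * p)) =
      real ((p - 1) * (p - 2) + ((p - 1) * I1 (p - 1) + (\<Sum>k = 1..p - 1. I2 (p - 1) k)))"
    using num_rcc_loops by (simp only:)
  \<comment> \<open>The subtraction in \<open>nat\<close> is exact, since a prime is at least
    2.\<close>
  moreover have "real (p - 2) = real p - 2" using p1 by simp
  moreover have "real (p - 1) > 0" using p1 by simp
  ultimately show ?thesis by (simp add: field_simps)
qed

end
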